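(* Let $K$ be a weak Kac algebra and let $\lambda>0$. Write $K\cong\bigoplus_{i=1}^N M_{d_i}(\mathbb{C})$ and $K_s\cong K_t\cong\bigoplus_{\alpha=1}^L M_{m_\alpha}(\mathbb{C})$, and let $\Lambda=(\Lambda_{\alpha i})$ be the $L\times N$ inclusion matrix of $K_s\subset K$. The following conditions are equivalent: (i) $K$ satisfies the $\lambda$-Markov condition, i.e. $E_s(p_\varepsilon)=E_t(p_\varepsilon)=\lambda 1$; (ii) $\tau=\lambda\,\mathrm{Tr}$, where $\mathrm{Tr}$ is the trace of the left regular representation of $K$ on itself; (iii) $(\Lambda\Lambda^t)\vec m=\lambda^{-1}\vec m$, where $\vec m=(m_1,\dots,m_L)$ is the dimension vector of a Cartan subalgebra; (iv) $n=\lambda^{-1}$ is an integer and there is a basis $\{x_\nu\}_{\nu=1,\dots,n}$ for $E_s$, i.e. a basis of $K$ over $K_s$ such that $x=\sum_\nu x_\nu E_s(x_\nu^*x)$ for all $x\in K$; (v) $n=\lambda^{-1}$ is an integer and there is a basis $\{y_\nu\}_{\nu=1,\dots,n}$ for $E_t$, i.e. a basis of $K$ over $K_t$ such that $y=\sum_\nu y_\nu E_t(y_\nu^*y)$ for all $y\in K$.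
   Context: A weak Kac algebra is a finite-dimensional $C^*$-algebra $K$ with linear maps $\Delta:K\to K\otimes K$ (a not necessarily unital $*$-homomorphism), $\varepsilon:K\to\mathbb{C}$ (a positive, not necessarily multiplicative functional) and $S:K\to K$ (a $*$-preserving, anti-multiplicative and anti-comultiplicative map with $S^2=\mathrm{id}$) such that, with $\varepsilon_s(x)=(\mathrm{id}\otimes\varepsilon)((1\otimes x)\Delta(1))$ and $\varepsilon_t(x)=(\varepsilon\otimes\mathrm{id})(\Delta(1)(x\otimes1))$, for all $x,y\in K$: (1) $(\Delta\otimes\mathrm{id})\Delta=(\mathrm{id}\otimes\Delta)\Delta$ and $(\varepsilon\otimes\mathrm{id})\Delta=\mathrm{id}=(\mathrm{id}\otimes\varepsilon)\Delta$; (2) $\varepsilon_s(x)y=(\mathrm{id}\otimes\varepsilon)((1\otimes x)\Delta(y))$; (3) $(\varepsilon_s\otimes\mathrm{id})\Delta(x)=(1\otimes x)\Delta(1)$; (4) $m(S\otimes\mathrm{id})\Delta(x)=\varepsilon_s(x)$, where $m$ is multiplication. The Cartan subalgebras are the unital $C^*$-subalgebras $K_s=\varepsilon_s(K)$ and $K_t=\varepsilon_t(K)$; $S(K_s)=K_t$. The Haar projection $p_\varepsilon\in K$ is the unique projection with $p_\varepsilon x=p_\varepsilon\varepsilon_s(x)$, $xp_\varepsilon=\varepsilon_t(x)p_\varepsilon$ for all $x\in K$, and $\varepsilon_s(p_\varepsilon)=\varepsilon_t(p_\varepsilon)=1$. The normalized Haar trace $\tau$ is the unique faithful trace on $K$ with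 $(\tau\otimes\mathrm{id})\Delta=(\tau\otimes\varepsilon_s)\Delta$, $(\mathrm{id}\otimes\tau)\Delta=(\varepsilon_t\otimes\tau)\Delta$ and $\tau\circ\varepsilon_s=\tau\circ\varepsilon_t=\varepsilon$. The maps $E_s=(\tau\otimes\mathrm{id})\Delta:K\to K_s$ and $E_t=(\mathrm{id}\otimes\tau)\Delta:K\to K_t$ are $\tau$-preserving conditional expectations. For a conditional expectation $E:B\to A$, a basis for $E$ is a finite family $\{u_i\}\subset B$ with $b=\sum_iu_iE(u_i^*b)$ for all $b\in B$ and such that $\sum_iu_ia_i=0$ with $a_i\in A$ implies all $a_i=0$. *)

theory Defs
  imports
    "HOL-Library.Poly_Mapping"
    "HOL-Library.FuncSet"
    "HOL-Library.Complex_Order"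
    "Jordan_Normal_Form.Schur_Decomposition"
begin

section \<open>Complex vector spaces, star-algebras and C*-algebras\<close>

class complex_vector = ab_group_add +
  fixes scaleC :: "complex \<Rightarrow> 'a \<Rightarrow> 'a"  (infixr "*\<^sub>C" 75)
  assumes scaleC_add_right: "c *\<^sub>C (x + y) = c *\<^sub>C x + c *\<^sub>C y"
    and scaleC_add_left: "(c + d) *\<^sub>C x = c *\<^sub>C x + d *\<^sub>C x"
    and scaleC_scaleC: "c *\<^sub>C (d *\<^sub>C x) = (c * d) *\<^sub>C x"
    and scaleC_one: "1 *\<^sub>C x = x"

global_interpretation complex_vector: vector_space "scaleC :: complex \<Rightarrow> 'a \<Rightarrow> 'a :: complex_vector"
  by unfold_locales
    (auto simp: scaleC_add_right scaleC_add_left scaleC_scaleC scaleC_one)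

global_interpretation complex_vector_pair:
  vector_space_pair "scaleC :: complex \<Rightarrow> 'a \<Rightarrow> 'a :: complex_vector"
    "scaleC :: complex \<Rightarrow> 'b \<Rightarrow> 'b :: complex_vector"
  by unfold_locales

abbreviation clinear :: "('a::complex_vector \<Rightarrow> 'b::complex_vector) \<Rightarrow> bool"
  where "clinear \<equiv> Vector_Spaces.linear scaleC scaleC"

lemma clinear_iff:
  "clinear f \<longleftrightarrow> (\<forall>x y. f (x + y) = f x + f y) \<and> (\<forall>c x. f (c *\<^sub>C x) = c *\<^sub>C f x)"
  by (auto simp: Vector_Spaces.linear_iff complex_vector.vector_space_axioms)

instantiation complex :: complex_vector
begin
definition scaleC_complex_def [simp]: "scaleC c (x::complex) = c * x"
instance by standard (auto simp: algebra_simps)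
end

instantiation poly_mapping :: (type, complex_vector) complex_vector
begin
definition "scaleC c (p :: 'a \<Rightarrow>\<^sub>0 'b) = Poly_Mapping.map (scaleC c) p"
lemma lookup_scaleC [simp]: "Poly_Mapping.lookup (c *\<^sub>C p) k = c *\<^sub>C Poly_Mapping.lookup (p :: 'a \<Rightarrow>\<^sub>0 'b) k"
  unfolding scaleC_poly_mapping_def by transfer (simp add: when_def)
instance
  by standard
    (auto intro!: poly_mapping_eqI simp: lookup_add scaleC_add_right scaleC_add_left
      scaleC_scaleC scaleC_one)
end

class complex_algebra_1 = complex_vector + ring_1 +
  assumes mult_scaleC_left: "(c *\<^sub>C x) * y = c *\<^sub>C (x * y)"
    and mult_scaleC_right: "x * (c *\<^sub>C y) = c *\<^sub>C (x * y)"

class complex_star_algebra = complex_algebra_1 +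
  fixes star :: "'a \<Rightarrow> 'a"  ("_\<^sup>\<star>" [1000] 999)
  assumes star_add: "(x + y)\<^sup>\<star> = x\<^sup>\<star> + y\<^sup>\<star>"
    and star_scaleC: "(c *\<^sub>C x)\<^sup>\<star> = cnj c *\<^sub>C x\<^sup>\<star>"
    and star_mult: "(x * y)\<^sup>\<star> = y\<^sup>\<star> * x\<^sup>\<star>"
    and star_star: "(x\<^sup>\<star>)\<^sup>\<star> = x"

class cstar_algebra = complex_star_algebra + real_normed_algebra_1 + complete_space +
  assumes scaleR_scaleC: "r *\<^sub>R x = complex_of_real r *\<^sub>C x"
    and norm_scaleC: "norm (c *\<^sub>C x) = cmod c * norm x"
    and cstar_identity: "norm (x\<^sup>\<star> * x) = (norm x)\<^sup>2"

definition cfinite_dimensional :: "'a::complex_vector itself \<Rightarrow> bool"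
  where "cfinite_dimensional _ \<longleftrightarrow> (\<exists>B :: 'a set. finite B \<and> complex_vector.span B = UNIV)"

instantiation complex :: cstar_algebra
begin
definition star_complex_def [simp]: "star (z::complex) = cnj z"
instance
  by standard
    (auto simp: scaleR_conv_of_real norm_mult power2_eq_square)
end

text \<open>The trace of an endomorphism of a finite-dimensional space, computed in a basis; its value
  does not depend on which basis \<open>extend_basis {}\<close> happens to be.\<close>

definition ctrace :: "('a::complex_vector \<Rightarrow> 'a) \<Rightarrow> complex"
  where "ctrace f = (let B = complex_vector.extend_basis {} in
    \<Sum>b\<in>B. complex_vector.representation B (f b) b)"

definition regular_trace :: "'a::complex_algebra_1 \<Rightarrow> complex"
  where "regular_trace x = ctrace (\<lambda>y. x * y)"


section \<open>Tensor products\<close>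

text \<open>\<open>V \<otimes> W\<close> is the free complex vector space on \<open>V \<times> W\<close> modulo the bilinearity relations.\<close>

definition tensor_relators :: "(('a::complex_vector \<times> 'b::complex_vector) \<Rightarrow>\<^sub>0 complex) set" where
  "tensor_relators =
     {Poly_Mapping.single (x + x', y) 1 - Poly_Mapping.single (x, y) 1 - Poly_Mapping.single (x', y) 1 | x x' y. True} \<union>
     {Poly_Mapping.single (x, y + y') 1 - Poly_Mapping.single (x, y) 1 - Poly_Mapping.single (x, y') 1 | x y y'. True} \<union>
     {Poly_Mapping.single (c *\<^sub>C x, y) 1 - Poly_Mapping.single (x, y) c | c x y. True} \<union>
     {Poly_Mapping.single (x, c *\<^sub>C y) 1 - Poly_Mapping.single (x, y) c | c x y. True}"

definition tensor_eq ::
  "(('a::complex_vector \<times> 'b::complex_vector) \<Rightarrow>\<^sub>0 complex) \<Rightarrow> (('a \<times> 'b) \<Rightarrow>\<^sub>0 complex) \<Rightarrow> bool"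
  where "tensor_eq p q \<longleftrightarrow> p - q \<in> complex_vector.span tensor_relators"

lemma equivp_tensor_eq:
  "equivp (tensor_eq ::
     (('a::complex_vector \<times> 'b::complex_vector) \<Rightarrow>\<^sub>0 complex) \<Rightarrow> (('a \<times> 'b) \<Rightarrow>\<^sub>0 complex) \<Rightarrow> bool)"
    (is "equivp ?R")
proof (rule equivpI)
  show "reflp ?R"
    by (auto simp: reflp_def tensor_eq_def complex_vector.span_zero)
  show "symp ?R"
  proof (rule sympI)
    fix p q :: "('a \<times> 'b) \<Rightarrow>\<^sub>0 complex"
    assume "tensor_eq p q"
    then show "tensor_eq q p"
      unfolding tensor_eq_def using complex_vector.span_neg[of "p - q"] by simp
  qed
  show "transp ?R"
  proof (rule transpI)
    fix p q r :: "('a \<times> 'b) \<Rightarrow>\<^sub>0 complex"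
    assume "tensor_eq p q" "tensor_eq q r"
    then show "tensor_eq p r"
      unfolding tensor_eq_def using complex_vector.span_add[of "p - q" _ "q - r"] by simp
  qed
qed

quotient_type (overloaded) ('a, 'b) tensor =
  "('a::complex_vector \<times> 'b::complex_vector) \<Rightarrow>\<^sub>0 complex" / tensor_eq
  by (rule equivp_tensor_eq)

instantiation tensor :: (complex_vector, complex_vector) complex_vector
begin

lift_definition zero_tensor :: "('a, 'b) tensor" is 0 .
lift_definition plus_tensor :: "('a, 'b) tensor \<Rightarrow> ('a, 'b) tensor \<Rightarrow> ('a, 'b) tensor" is "(+)"
proof -
  fix p p' q q' :: "('a \<times> 'b) \<Rightarrow>\<^sub>0 complex"
  assume "tensor_eq p p'" "tensor_eq q q'"
  then have "(p - p') + (q - q') \<in> complex_vector.span tensor_relators"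
    unfolding tensor_eq_def by (rule complex_vector.span_add)
  then show "tensor_eq (p + q) (p' + q')"
    unfolding tensor_eq_def by (simp add: algebra_simps)
qed
lift_definition uminus_tensor :: "('a, 'b) tensor \<Rightarrow> ('a, 'b) tensor" is uminus
proof -
  fix p q :: "('a \<times> 'b) \<Rightarrow>\<^sub>0 complex"
  assume "tensor_eq p q"
  then have "- (p - q) \<in> complex_vector.span tensor_relators"
    unfolding tensor_eq_def by (rule complex_vector.span_neg)
  then show "tensor_eq (- p) (- q)"
    unfolding tensor_eq_def by (simp add: algebra_simps)
qed
lift_definition minus_tensor :: "('a, 'b) tensor \<Rightarrow> ('a, 'b) tensor \<Rightarrow> ('a, 'b) tensor" is "(-)"
proof -
  fix p p' q q' :: "('a \<times> 'b) \<Rightarrow>\<^sub>0 complex"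
  assume "tensor_eq p p'" "tensor_eq q q'"
  then have "(p - p') - (q - q') \<in> complex_vector.span tensor_relators"
    unfolding tensor_eq_def by (rule complex_vector.span_diff)
  then show "tensor_eq (p - q) (p' - q')"
    unfolding tensor_eq_def by (simp add: algebra_simps)
qed
lift_definition scaleC_tensor :: "complex \<Rightarrow> ('a, 'b) tensor \<Rightarrow> ('a, 'b) tensor" is scaleC
proof -
  fix c and p q :: "('a \<times> 'b) \<Rightarrow>\<^sub>0 complex"
  assume "tensor_eq p q"
  then have "c *\<^sub>C (p - q) \<in> complex_vector.span tensor_relators"
    unfolding tensor_eq_def by (rule complex_vector.span_scale)
  then show "tensor_eq (c *\<^sub>C p) (c *\<^sub>C q)"
    unfolding tensor_eq_def by (simp add: complex_vector.scale_right_diff_distrib)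
qed

instance
proof
  fix x y z :: "('a, 'b) tensor" and c d :: complex
  have refl: "tensor_eq p p" for p :: "('a \<times> 'b) \<Rightarrow>\<^sub>0 complex"
    using equivp_tensor_eq by (rule equivp_reflp)
  show "x + y + z = x + (y + z)" by transfer (simp add: refl add.assoc)
  show "x + y = y + x" by transfer (simp add: refl add.commute)
  show "0 + x = x" by transfer (simp add: refl)
  show "- x + x = 0" by transfer (simp add: refl)
  show "x - y = x + - y" by transfer (simp add: refl)
  show "c *\<^sub>C (x + y) = c *\<^sub>C x + c *\<^sub>C y" by transfer (simp add: refl scaleC_add_right)
  show "(c + d) *\<^sub>C x = c *\<^sub>C x + d *\<^sub>C x" by transfer (simp add: refl scaleC_add_left)
  show "c *\<^sub>C (d *\<^sub>C x) = (c * d) *\<^sub>C x" by transfer (simp add: refl scaleC_scaleC)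
  show "1 *\<^sub>C x = x" by transfer (simp add: refl scaleC_one)
qed

end

lift_definition tensor_of :: "'a::complex_vector \<Rightarrow> 'b::complex_vector \<Rightarrow> ('a, 'b) tensor"
  (infixr "\<otimes>\<^sub>C" 76) is "\<lambda>x y. Poly_Mapping.single (x, y) 1" .

definition cbilinear ::
  "('a::complex_vector \<Rightarrow> 'b::complex_vector \<Rightarrow> 'c::complex_vector) \<Rightarrow> bool"
  where "cbilinear f \<longleftrightarrow> (\<forall>x. clinear (f x)) \<and> (\<forall>y. clinear (\<lambda>x. f x y))"

definition free_lift :: "('a \<Rightarrow> 'b \<Rightarrow> 'c::complex_vector) \<Rightarrow> (('a \<times> 'b) \<Rightarrow>\<^sub>0 complex) \<Rightarrow> 'c"
  where "free_lift f p = (\<Sum>(x, y)\<in>Poly_Mapping.keys p. Poly_Mapping.lookup p (x, y) *\<^sub>C f x y)"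

text \<open>The linear map on \<open>V \<otimes> W\<close> induced by a bilinear map \<open>f\<close>; for bilinear \<open>f\<close> the chosen
  representative is irrelevant, and for other \<open>f\<close> the value is meaningless.\<close>

definition tensor_lift ::
  "('a::complex_vector \<Rightarrow> 'b::complex_vector \<Rightarrow> 'c::complex_vector) \<Rightarrow> ('a, 'b) tensor \<Rightarrow> 'c"
  where "tensor_lift f t = free_lift f (rep_tensor t)"

lemma free_lift_add: "free_lift f (p + q) = free_lift f p + free_lift f q"
proof -
  have "(\<Sum>k\<in>Poly_Mapping.keys (p + q). case k of (x, y) \<Rightarrow> Poly_Mapping.lookup (p + q) k *\<^sub>C f x y)
      = (\<Sum>k\<in>Poly_Mapping.keys p. case k of (x, y) \<Rightarrow> Poly_Mapping.lookup p k *\<^sub>C f x y)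
      + (\<Sum>k\<in>Poly_Mapping.keys q. case k of (x, y) \<Rightarrow> Poly_Mapping.lookup q k *\<^sub>C f x y)"
    using setsum_keys_plus_distrib[of "\<lambda>k c. case k of (x, y) \<Rightarrow> c *\<^sub>C f x y" p q]
    by (auto simp: scaleC_add_left split: prod.splits)
  then show ?thesis
    by (simp add: free_lift_def case_prod_unfold)
qed

lemma free_lift_scaleC: "free_lift f (c *\<^sub>C p) = c *\<^sub>C free_lift f p"
proof -
  have "free_lift f (c *\<^sub>C p) = (\<Sum>k\<in>Poly_Mapping.keys p. Poly_Mapping.lookup (c *\<^sub>C p) k *\<^sub>C f (fst k) (snd k))"
    unfolding free_lift_def case_prod_unfold
    by (rule sum.mono_neutral_cong_left) (auto simp: in_keys_iff)
  then show ?thesis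
    by (simp add: free_lift_def case_prod_unfold complex_vector.scale_sum_right scaleC_scaleC)
qed

lemma clinear_free_lift: "clinear (free_lift f)"
  by (simp add: clinear_iff free_lift_add free_lift_scaleC)

lemma free_lift_single [simp]: "free_lift f (Poly_Mapping.single (x, y) c) = c *\<^sub>C f x y"
  by (simp add: free_lift_def)

lemma free_lift_diff: "free_lift f (p - q) = free_lift f p - free_lift f q"
  by (rule complex_vector_pair.linear_diff[OF clinear_free_lift])

lemma free_lift_relator:
  assumes "cbilinear f" "p \<in> complex_vector.span tensor_relators"
  shows "free_lift f p = 0"
  using clinear_free_lift _ assms(2)
proof (rule complex_vector_pair.linear_eq_0_on_span)
  fix r assume "r \<in> (tensor_relators :: (('a \<times> 'b) \<Rightarrow>\<^sub>0 complex) set)"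
  then show "free_lift f r = 0"
    using assms(1) unfolding tensor_relators_def cbilinear_def clinear_iff
    by (auto simp: free_lift_diff scaleC_one)
qed

lemma tensor_lift_abs:
  assumes "cbilinear f"
  shows "tensor_lift f (abs_tensor p) = free_lift f p"
proof -
  have "tensor_eq (rep_tensor (abs_tensor p)) p"
    using Quotient_rep_abs[OF Quotient_tensor] equivp_reflp[OF equivp_tensor_eq] by blast
  then have "free_lift f (rep_tensor (abs_tensor p) - p) = 0"
    unfolding tensor_eq_def by (rule free_lift_relator[OF assms])
  then show ?thesis by (simp add: tensor_lift_def free_lift_diff)
qed

lemma tensor_abs_ex: obtains p where "t = abs_tensor p"
  by (metis Quotient_abs_rep[OF Quotient_tensor])

lemma tensor_lift_tensor_of [simp]:
  "cbilinear f \<Longrightarrow> tensor_lift f (x \<otimes>\<^sub>C y) = f x y"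
  by (simp add: tensor_of.abs_eq tensor_lift_abs scaleC_one)

lemma clinear_tensor_lift:
  fixes f :: "'a::complex_vector \<Rightarrow> 'b::complex_vector \<Rightarrow> 'c::complex_vector"
  assumes "cbilinear f"
  shows "clinear (tensor_lift f)"
  unfolding clinear_iff
proof (intro conjI allI)
  fix s t :: "('a, 'b) tensor" and c :: complex
  obtain p where s: "s = abs_tensor p" by (rule tensor_abs_ex)
  obtain q where t: "t = abs_tensor q" by (rule tensor_abs_ex)
  show "tensor_lift f (s + t) = tensor_lift f s + tensor_lift f t"
    by (simp add: s t plus_tensor.abs_eq tensor_lift_abs[OF assms] free_lift_add)
  show "tensor_lift f (c *\<^sub>C s) = c *\<^sub>C tensor_lift f s"
    by (simp add: s scaleC_tensor.abs_eq tensor_lift_abs[OF assms] free_lift_scaleC)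
qed

lemma abs_tensor_eqI: "p - q \<in> tensor_relators \<Longrightarrow> abs_tensor p = abs_tensor q"
  using tensor.abs_eq_iff tensor_eq_def complex_vector.span_base by blast

lemma tensor_of_add_left: "(x + x') \<otimes>\<^sub>C y = x \<otimes>\<^sub>C y + x' \<otimes>\<^sub>C y"
  unfolding tensor_of.abs_eq plus_tensor.abs_eq
  by (rule abs_tensor_eqI, unfold tensor_relators_def diff_diff_eq) blast

lemma tensor_of_add_right: "x \<otimes>\<^sub>C (y + y') = x \<otimes>\<^sub>C y + x \<otimes>\<^sub>C y'"
  unfolding tensor_of.abs_eq plus_tensor.abs_eq
  by (rule abs_tensor_eqI, unfold tensor_relators_def diff_diff_eq) blast

lemma scaleC_single: "c *\<^sub>C Poly_Mapping.single k d = Poly_Mapping.single k (c *\<^sub>C d)"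
  by (rule poly_mapping_eqI) (simp add: lookup_single when_def)

lemma tensor_of_scaleC_left: "(c *\<^sub>C x) \<otimes>\<^sub>C y = c *\<^sub>C (x \<otimes>\<^sub>C y)"
  unfolding tensor_of.abs_eq scaleC_tensor.abs_eq scaleC_single scaleC_complex_def mult_1_right
  by (rule abs_tensor_eqI, unfold tensor_relators_def) blast

lemma tensor_of_scaleC_right: "x \<otimes>\<^sub>C (c *\<^sub>C y) = c *\<^sub>C (x \<otimes>\<^sub>C y)"
  unfolding tensor_of.abs_eq scaleC_tensor.abs_eq scaleC_single scaleC_complex_def mult_1_right
  by (rule abs_tensor_eqI, unfold tensor_relators_def) blast

lemma cbilinear_tensor_of: "cbilinear (\<otimes>\<^sub>C)"
  by (simp add: cbilinear_def clinear_iff tensor_of_add_left tensor_of_add_right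
      tensor_of_scaleC_left tensor_of_scaleC_right)

lemma tensor_induct [case_names tensor_of add, induct type: tensor]:
  assumes "\<And>x y. P (x \<otimes>\<^sub>C y)" and "\<And>s t. P s \<Longrightarrow> P t \<Longrightarrow> P (s + t)"
  shows "P t"
proof -
  obtain p where t: "t = abs_tensor p" by (rule tensor_abs_ex)
  have "P (abs_tensor p)"
  proof (induction p rule: update_induct)
    case const
    have "0 = (0::'a) \<otimes>\<^sub>C (0::'b)"
      using tensor_of_scaleC_left[of 0 "0::'a" "0::'b"] by simp
    then have "abs_tensor 0 = (0::'a) \<otimes>\<^sub>C (0::'b)"
      by (simp add: zero_tensor.abs_eq)
    then show ?case
      using assms(1) by simp
  next
    case (update p k c)
    have "Poly_Mapping.update k c p = p + Poly_Mapping.single k c"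
      using update(1)
      by (intro poly_mapping_eqI) (auto simp: lookup_update lookup_add lookup_single in_keys_iff when_def)
    moreover have "abs_tensor (Poly_Mapping.single k c) = (c *\<^sub>C fst k) \<otimes>\<^sub>C snd k"
      by (subst tensor_of_scaleC_left)
        (simp add: tensor_of.abs_eq scaleC_tensor.abs_eq scaleC_single)
    ultimately show ?case
      using assms update(3) by (simp add: plus_tensor.abs_eq[symmetric])
  qed
  with t show ?thesis by simp
qed

lemma clinear_tensor_eqI:
  assumes "clinear f" "clinear g" "\<And>x y. f (x \<otimes>\<^sub>C y) = g (x \<otimes>\<^sub>C y)"
  shows "f t = g t"
  by (induction t) (use assms in \<open>auto simp: clinear_iff\<close>)


subsection \<open>The star-algebra structure on a tensor product\<close>

definition tensor_mult_left ::
  "'a::complex_algebra_1 \<Rightarrow> 'b::complex_algebra_1 \<Rightarrow> ('a, 'b) tensor \<Rightarrow> ('a, 'b) tensor"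
  where "tensor_mult_left x y = tensor_lift (\<lambda>x' y'. (x * x') \<otimes>\<^sub>C (y * y'))"

lemma cbilinear_tensor_mult_left_aux:
  fixes x :: "'a::complex_algebra_1" and y :: "'b::complex_algebra_1"
  shows "cbilinear (\<lambda>x' y'. (x * x') \<otimes>\<^sub>C (y * y'))"
  by (simp add: cbilinear_def clinear_iff distrib_left mult_scaleC_right tensor_of_add_left
      tensor_of_add_right tensor_of_scaleC_left tensor_of_scaleC_right)

lemma clinear_tensor_mult_left: "clinear (tensor_mult_left x y)"
  unfolding tensor_mult_left_def by (rule clinear_tensor_lift[OF cbilinear_tensor_mult_left_aux])

lemma tensor_mult_left_add: "tensor_mult_left x y (s + t) = tensor_mult_left x y s + tensor_mult_left x y t"
  and tensor_mult_left_scaleC: "tensor_mult_left x y (c *\<^sub>C t) = c *\<^sub>C tensor_mult_left x y t"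
  using clinear_tensor_mult_left unfolding clinear_iff by blast+

lemma tensor_mult_left_tensor_of [simp]:
  "tensor_mult_left x y (x' \<otimes>\<^sub>C y') = (x * x') \<otimes>\<^sub>C (y * y')"
  unfolding tensor_mult_left_def by (rule tensor_lift_tensor_of[OF cbilinear_tensor_mult_left_aux])

lemma cbilinear_tensor_mult_left: "cbilinear (\<lambda>x y. tensor_mult_left x y t)"
proof (induction t)
  case (tensor_of x' y')
  show ?case
    by (simp add: cbilinear_def clinear_iff distrib_right mult_scaleC_left tensor_of_add_left
      tensor_of_add_right tensor_of_scaleC_left tensor_of_scaleC_right)
next
  case (add s t)
  then show ?case
    by (simp add: cbilinear_def clinear_iff tensor_mult_left_add scaleC_add_right algebra_simps)
qed

lemma unit_functional:
  obtains f :: "'a::complex_algebra_1 \<Rightarrow> complex" where "clinear f" "f 1 = 1"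
proof -
  have "complex_vector.independent {1::'a}"
    by (simp add: complex_vector.dependent_single)
  from complex_vector_pair.linear_independent_extend[OF this, of "\<lambda>_. 1 :: complex"]
  show ?thesis using that by auto
qed

instantiation tensor :: (complex_algebra_1, complex_algebra_1) complex_algebra_1
begin

definition one_tensor :: "('a, 'b) tensor" where "one_tensor = 1 \<otimes>\<^sub>C 1"

text \<open>That is, \<open>(x \<otimes> y) (x' \<otimes> y') = x x' \<otimes> y y'\<close>, extended bilinearly.\<close>

definition times_tensor :: "('a, 'b) tensor \<Rightarrow> ('a, 'b) tensor \<Rightarrow> ('a, 'b) tensor"
  where "s * t = tensor_lift (\<lambda>x y. tensor_mult_left x y t) s"

lemma tensor_of_mult_left: "(x \<otimes>\<^sub>C y) * (t :: ('a, 'b) tensor) = tensor_mult_left x y t"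
  by (simp add: times_tensor_def cbilinear_tensor_mult_left)

lemma tensor_distrib_right: "(s + s') * t = s * t + s' * (t :: ('a, 'b) tensor)"
  and tensor_mult_scaleC_left: "(c *\<^sub>C s) * t = c *\<^sub>C (s * t)"
  using clinear_tensor_lift[OF cbilinear_tensor_mult_left[of t]]
  unfolding times_tensor_def clinear_iff by auto

lemma tensor_distrib_left: "s * (t + t') = s * t + s * (t' :: ('a, 'b) tensor)"
  and tensor_mult_scaleC_right: "s * (c *\<^sub>C t) = c *\<^sub>C (s * t)"
  by (induction s)
    (simp_all add: tensor_of_mult_left tensor_distrib_right tensor_mult_left_add
      tensor_mult_left_scaleC scaleC_add_right algebra_simps)

instance
proof
  fix s t u :: "('a, 'b) tensor" and c :: complex
  show "s * t * u = s * (t * u)"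
  proof (induction s)
    case (tensor_of x y)
    show ?case
    proof (induction t)
      case (tensor_of x' y')
      show ?case
        by (induction u)
          (auto simp: tensor_of_mult_left mult.assoc tensor_distrib_left
            tensor_mult_left_add)
    qed (simp add: tensor_distrib_right tensor_distrib_left)
  qed (simp add: tensor_distrib_right)
  show "1 * t = t"
    by (induction t) (simp_all add: one_tensor_def tensor_of_mult_left tensor_distrib_left
        tensor_mult_left_add)
  show "t * 1 = t"
    by (induction t) (simp_all add: one_tensor_def tensor_of_mult_left tensor_distrib_right)
  show "(s + t) * u = s * u + t * u" by (rule tensor_distrib_right)
  show "s * (t + u) = s * t + s * u" by (rule tensor_distrib_left)
  show "(c *\<^sub>C s) * t = c *\<^sub>C (s * t)" by (rule tensor_mult_scaleC_left)
  show "s * (c *\<^sub>C t) = c *\<^sub>C (s * t)" by (rule tensor_mult_scaleC_right)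
  show "(0 :: ('a, 'b) tensor) \<noteq> 1"
  proof
    assume "(0 :: ('a, 'b) tensor) = 1"
    obtain f :: "'a \<Rightarrow> complex" where f: "clinear f" "f 1 = 1" by (rule unit_functional)
    obtain g :: "'b \<Rightarrow> complex" where g: "clinear g" "g 1 = 1" by (rule unit_functional)
    have bil: "cbilinear (\<lambda>x y. f x * g y)"
      using f g by (simp add: cbilinear_def clinear_iff algebra_simps)
    have "tensor_lift (\<lambda>x y. f x * g y) (1 :: ('a, 'b) tensor) = 1"
      using f g bil by (simp add: one_tensor_def)
    moreover have "tensor_lift (\<lambda>x y. f x * g y) (0 :: ('a, 'b) tensor) = 0"
      by (rule complex_vector_pair.linear_0[OF clinear_tensor_lift[OF bil]])
    ultimately show False
      using \<open>(0 :: ('a, 'b) tensor) = 1\<close> by simp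
  qed
qed

end

lemma tensor_of_mult_tensor_of: "(x \<otimes>\<^sub>C y) * (x' \<otimes>\<^sub>C y') = (x * x') \<otimes>\<^sub>C (y * y')"
  by (simp add: tensor_of_mult_left)

definition free_star :: "(('a::complex_star_algebra \<times> 'b::complex_star_algebra) \<Rightarrow>\<^sub>0 complex) \<Rightarrow> ('a, 'b) tensor"
  where "free_star p = (\<Sum>(x, y)\<in>Poly_Mapping.keys p. cnj (Poly_Mapping.lookup p (x, y)) *\<^sub>C (x\<^sup>\<star> \<otimes>\<^sub>C y\<^sup>\<star>))"

lemma free_star_add: "free_star (p + q) = free_star p + free_star q"
proof -
  have "(\<Sum>k\<in>Poly_Mapping.keys (p + q). case k of (x, y) \<Rightarrow> cnj (Poly_Mapping.lookup (p + q) k) *\<^sub>C (x\<^sup>\<star> \<otimes>\<^sub>C y\<^sup>\<star>))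
      = (\<Sum>k\<in>Poly_Mapping.keys p. case k of (x, y) \<Rightarrow> cnj (Poly_Mapping.lookup p k) *\<^sub>C (x\<^sup>\<star> \<otimes>\<^sub>C y\<^sup>\<star>))
      + (\<Sum>k\<in>Poly_Mapping.keys q. case k of (x, y) \<Rightarrow> cnj (Poly_Mapping.lookup q k) *\<^sub>C (x\<^sup>\<star> \<otimes>\<^sub>C y\<^sup>\<star>))"
    using setsum_keys_plus_distrib[of "\<lambda>k c. case k of (x, y) \<Rightarrow> cnj c *\<^sub>C (x\<^sup>\<star> \<otimes>\<^sub>C y\<^sup>\<star>)" p q]
    by (auto simp: scaleC_add_left split: prod.splits)
  then show ?thesis
    by (simp add: free_star_def case_prod_unfold)
qed

lemma free_star_scaleC: "free_star (c *\<^sub>C p) = cnj c *\<^sub>C free_star p"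
proof -
  have "free_star (c *\<^sub>C p)
      = (\<Sum>k\<in>Poly_Mapping.keys p. cnj (Poly_Mapping.lookup (c *\<^sub>C p) k) *\<^sub>C ((fst k)\<^sup>\<star> \<otimes>\<^sub>C (snd k)\<^sup>\<star>))"
    unfolding free_star_def case_prod_unfold
    by (rule sum.mono_neutral_cong_left) (auto simp: in_keys_iff)
  then show ?thesis
    by (simp add: free_star_def case_prod_unfold complex_vector.scale_sum_right scaleC_scaleC)
qed

lemma free_star_single [simp]: "free_star (Poly_Mapping.single (x, y) c) = cnj c *\<^sub>C (x\<^sup>\<star> \<otimes>\<^sub>C y\<^sup>\<star>)"
  by (simp add: free_star_def)

lemma free_star_diff: "free_star (p - q) = free_star p - free_star q"
  by (metis free_star_add diff_add_cancel add_diff_cancel_right')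

lemma free_star_relator:
  assumes "p \<in> complex_vector.span tensor_relators"
  shows "free_star p = 0"
  using assms
proof (induction rule: complex_vector.span_induct)
  case base
  show ?case
    by (auto simp: complex_vector.subspace_def free_star_add free_star_scaleC)
      (simp add: free_star_def)
next
  case (step r)
  then show ?case
    unfolding tensor_relators_def
    by (auto simp: free_star_diff star_add star_scaleC tensor_of_add_left tensor_of_add_right
        tensor_of_scaleC_left tensor_of_scaleC_right scaleC_one)
qed

instantiation tensor :: (complex_star_algebra, complex_star_algebra) complex_star_algebra
begin

text \<open>That is, \<open>(x \<otimes> y)\<^sup>\<star> = x\<^sup>\<star> \<otimes> y\<^sup>\<star>\<close>, extended antilinearly.\<close>

lift_definition star_tensor :: "('a, 'b) tensor \<Rightarrow> ('a, 'b) tensor" is free_star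
proof -
  fix p q :: "('a \<times> 'b) \<Rightarrow>\<^sub>0 complex"
  assume "tensor_eq p q"
  then have "free_star (p - q) = 0"
    unfolding tensor_eq_def by (rule free_star_relator)
  then show "free_star p = free_star q"
    by (simp add: free_star_diff)
qed

lemma star_tensor_of: "(x \<otimes>\<^sub>C y :: ('a, 'b) tensor)\<^sup>\<star> = x\<^sup>\<star> \<otimes>\<^sub>C y\<^sup>\<star>"
  by (simp add: tensor_of.abs_eq[of x y] star_tensor.abs_eq scaleC_one)

lemma star_tensor_add: "(s + t :: ('a, 'b) tensor)\<^sup>\<star> = s\<^sup>\<star> + t\<^sup>\<star>"
proof -
  obtain p where s: "s = abs_tensor p" by (rule tensor_abs_ex)
  obtain q where t: "t = abs_tensor q" by (rule tensor_abs_ex)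
  show ?thesis
    by (simp add: s t plus_tensor.abs_eq star_tensor.abs_eq free_star_add)
qed

instance
proof
  fix s t :: "('a, 'b) tensor" and c :: complex
  show "(s + t)\<^sup>\<star> = s\<^sup>\<star> + t\<^sup>\<star>" by (rule star_tensor_add)
  show "(c *\<^sub>C s)\<^sup>\<star> = cnj c *\<^sub>C s\<^sup>\<star>"
  proof -
    obtain p where s: "s = abs_tensor p" by (rule tensor_abs_ex)
    show ?thesis
      by (simp add: s scaleC_tensor.abs_eq star_tensor.abs_eq free_star_scaleC)
  qed
  show "(s\<^sup>\<star>)\<^sup>\<star> = s"
    by (induction s) (simp_all add: star_tensor_of star_tensor_add star_star)
  show "(s * t)\<^sup>\<star> = t\<^sup>\<star> * s\<^sup>\<star>"
  proof (induction s)
    case (tensor_of x y)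
    show ?case
      by (induction t)
        (simp_all add: star_tensor_of star_tensor_add star_mult tensor_of_mult_tensor_of
          distrib_left distrib_right)
  qed (simp add: star_tensor_add distrib_left distrib_right)
qed

end


subsection \<open>Maps on tensor products\<close>

definition tensor_map :: "('a::complex_vector \<Rightarrow> 'c::complex_vector) \<Rightarrow>
    ('b::complex_vector \<Rightarrow> 'd::complex_vector) \<Rightarrow> ('a, 'b) tensor \<Rightarrow> ('c, 'd) tensor"
  where "tensor_map f g = tensor_lift (\<lambda>x y. f x \<otimes>\<^sub>C g y)"

definition tensor_assoc ::
  "(('a::complex_vector, 'b::complex_vector) tensor, 'c::complex_vector) tensor \<Rightarrow> ('a, ('b, 'c) tensor) tensor"
  where "tensor_assoc = tensor_lift (\<lambda>t z. tensor_lift (\<lambda>x y. x \<otimes>\<^sub>C (y \<otimes>\<^sub>C z)) t)"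

definition tensor_flip :: "('a::complex_vector, 'b::complex_vector) tensor \<Rightarrow> ('b, 'a) tensor"
  where "tensor_flip = tensor_lift (\<lambda>x y. y \<otimes>\<^sub>C x)"

definition tensor_collapse :: "('a::complex_algebra_1, 'a) tensor \<Rightarrow> 'a"
  where "tensor_collapse = tensor_lift (*)"

text \<open>For a functional \<open>\<omega>\<close>, these are \<open>\<omega> \<otimes> f\<close> and \<open>f \<otimes> \<omega>\<close> after identifying
  \<open>\<complex> \<otimes> W\<close> and \<open>W \<otimes> \<complex>\<close> with \<open>W\<close>.\<close>

definition slice_left :: "('a::complex_vector \<Rightarrow> complex) \<Rightarrow>
    ('b::complex_vector \<Rightarrow> 'c::complex_vector) \<Rightarrow> ('a, 'b) tensor \<Rightarrow> 'c"
  where "slice_left \<omega> f = tensor_lift (\<lambda>x y. \<omega> x *\<^sub>C f y)"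

definition slice_right :: "('a::complex_vector \<Rightarrow> 'c::complex_vector) \<Rightarrow>
    ('b::complex_vector \<Rightarrow> complex) \<Rightarrow> ('a, 'b) tensor \<Rightarrow> 'c"
  where "slice_right f \<omega> = tensor_lift (\<lambda>x y. \<omega> y *\<^sub>C f x)"


section \<open>Weak Kac algebras\<close>

definition counital_source ::
  "('a::complex_algebra_1 \<Rightarrow> ('a, 'a) tensor) \<Rightarrow> ('a \<Rightarrow> complex) \<Rightarrow> 'a \<Rightarrow> 'a"
  where "counital_source \<Delta> \<epsilon> x = slice_right id \<epsilon> ((1 \<otimes>\<^sub>C x) * \<Delta> 1)"

definition counital_target ::
  "('a::complex_algebra_1 \<Rightarrow> ('a, 'a) tensor) \<Rightarrow> ('a \<Rightarrow> complex) \<Rightarrow> 'a \<Rightarrow> 'a"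
  where "counital_target \<Delta> \<epsilon> x = slice_left \<epsilon> id (\<Delta> 1 * (x \<otimes>\<^sub>C 1))"

text \<open>The order on \<^typ>\<open>complex\<close> is the one for which \<open>0 \<le> z\<close> means that \<open>z\<close> is real and
  nonnegative.\<close>

definition positive_functional :: "('a::complex_star_algebra \<Rightarrow> complex) \<Rightarrow> bool"
  where "positive_functional \<omega> \<longleftrightarrow> clinear \<omega> \<and> (\<forall>x. 0 \<le> \<omega> (x\<^sup>\<star> * x))"

locale weak_kac_algebra =
  fixes \<Delta> :: "'a::cstar_algebra \<Rightarrow> ('a, 'a) tensor"
    and \<epsilon> :: "'a \<Rightarrow> complex"
    and S :: "'a \<Rightarrow> 'a"
  assumes finite_dimensional: "cfinite_dimensional TYPE('a)"
    and comult_linear: "clinear \<Delta>"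
    and comult_mult: "\<Delta> (x * y) = \<Delta> x * \<Delta> y"
    and comult_star: "\<Delta> (x\<^sup>\<star>) = (\<Delta> x)\<^sup>\<star>"
    and counit_positive: "positive_functional \<epsilon>"
    and antipode_linear: "clinear S"
    and antipode_star: "S (x\<^sup>\<star>) = (S x)\<^sup>\<star>"
    and antipode_antimult: "S (x * y) = S y * S x"
    and antipode_anticomult: "\<Delta> (S x) = tensor_flip (tensor_map S S (\<Delta> x))"
    and antipode_involutive: "S (S x) = x"
    and coassociative: "tensor_assoc (tensor_map \<Delta> id (\<Delta> x)) = tensor_map id \<Delta> (\<Delta> x)"
    and counit_left: "slice_left \<epsilon> id (\<Delta> x) = x"
    and counit_right: "slice_right id \<epsilon> (\<Delta> x) = x"
    and counital_source_mult:
      "counital_source \<Delta> \<epsilon> x * y = slice_right id \<epsilon> ((1 \<otimes>\<^sub>C x) * \<Delta> y)"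
    and counital_source_comult:
      "tensor_map (counital_source \<Delta> \<epsilon>) id (\<Delta> x) = (1 \<otimes>\<^sub>C x) * \<Delta> 1"
    and antipode_counital_source:
      "tensor_collapse (tensor_map S id (\<Delta> x)) = counital_source \<Delta> \<epsilon> x"

definition source_cartan ::
  "('a::complex_algebra_1 \<Rightarrow> ('a, 'a) tensor) \<Rightarrow> ('a \<Rightarrow> complex) \<Rightarrow> 'a set"
  where "source_cartan \<Delta> \<epsilon> = range (counital_source \<Delta> \<epsilon>)"

definition target_cartan ::
  "('a::complex_algebra_1 \<Rightarrow> ('a, 'a) tensor) \<Rightarrow> ('a \<Rightarrow> complex) \<Rightarrow> 'a set"
  where "target_cartan \<Delta> \<epsilon> = range (counital_target \<Delta> \<epsilon>)"

definition haar_projection ::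
  "('a::complex_star_algebra \<Rightarrow> ('a, 'a) tensor) \<Rightarrow> ('a \<Rightarrow> complex) \<Rightarrow> 'a \<Rightarrow> bool"
  where "haar_projection \<Delta> \<epsilon> p \<longleftrightarrow>
    p\<^sup>\<star> = p \<and> p * p = p \<and>
    (\<forall>x. p * x = p * counital_source \<Delta> \<epsilon> x) \<and>
    (\<forall>x. x * p = counital_target \<Delta> \<epsilon> x * p) \<and>
    counital_source \<Delta> \<epsilon> p = 1 \<and> counital_target \<Delta> \<epsilon> p = 1"

definition faithful_trace :: "('a::complex_star_algebra \<Rightarrow> complex) \<Rightarrow> bool"
  where "faithful_trace \<tau> \<longleftrightarrow> positive_functional \<tau> \<and> (\<forall>x y. \<tau> (x * y) = \<tau> (y * x)) \<and>
    (\<forall>x. \<tau> (x\<^sup>\<star> * x) = 0 \<longrightarrow> x = 0)"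

definition haar_trace ::
  "('a::complex_star_algebra \<Rightarrow> ('a, 'a) tensor) \<Rightarrow> ('a \<Rightarrow> complex) \<Rightarrow> ('a \<Rightarrow> complex) \<Rightarrow> bool"
  where "haar_trace \<Delta> \<epsilon> \<tau> \<longleftrightarrow>
    faithful_trace \<tau> \<and>
    (\<forall>x. slice_left \<tau> id (\<Delta> x) = slice_left \<tau> (counital_source \<Delta> \<epsilon>) (\<Delta> x)) \<and>
    (\<forall>x. slice_right id \<tau> (\<Delta> x) = slice_right (counital_target \<Delta> \<epsilon>) \<tau> (\<Delta> x)) \<and>
    (\<forall>x. \<tau> (counital_source \<Delta> \<epsilon> x) = \<epsilon> x) \<and>
    (\<forall>x. \<tau> (counital_target \<Delta> \<epsilon> x) = \<epsilon> x)"

definition source_expectation ::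
  "('a::complex_vector \<Rightarrow> ('a, 'a) tensor) \<Rightarrow> ('a \<Rightarrow> complex) \<Rightarrow> 'a \<Rightarrow> 'a"
  where "source_expectation \<Delta> \<tau> x = slice_left \<tau> id (\<Delta> x)"

definition target_expectation ::
  "('a::complex_vector \<Rightarrow> ('a, 'a) tensor) \<Rightarrow> ('a \<Rightarrow> complex) \<Rightarrow> 'a \<Rightarrow> 'a"
  where "target_expectation \<Delta> \<tau> x = slice_right id \<tau> (\<Delta> x)"

definition markov_condition ::
  "('a::complex_algebra_1 \<Rightarrow> ('a, 'a) tensor) \<Rightarrow> ('a \<Rightarrow> complex) \<Rightarrow> 'a \<Rightarrow> real \<Rightarrow> bool"
  where "markov_condition \<Delta> \<tau> p c \<longleftrightarrow>
    source_expectation \<Delta> \<tau> p = complex_of_real c *\<^sub>C 1 \<and>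
    target_expectation \<Delta> \<tau> p = complex_of_real c *\<^sub>C 1"

text \<open>The family \<open>(u i)\<^bsub>i \<in> I\<^esub>\<close> is a basis for the conditional expectation \<open>E\<close> of the whole
  algebra onto \<open>A\<close>.\<close>

definition expectation_basis ::
  "'a::complex_star_algebra set \<Rightarrow> ('a \<Rightarrow> 'a) \<Rightarrow> 'i set \<Rightarrow> ('i \<Rightarrow> 'a) \<Rightarrow> bool"
  where "expectation_basis A E I u \<longleftrightarrow> finite I \<and>
    (\<forall>b. b = (\<Sum>i\<in>I. u i * E ((u i)\<^sup>\<star> * b))) \<and>
    (\<forall>a. (\<forall>i\<in>I. a i \<in> A) \<and> (\<Sum>i\<in>I. u i * a i) = 0 \<longrightarrow> (\<forall>i\<in>I. a i = 0))"


section \<open>Multimatrix decompositions and inclusion matrices\<close>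

definition multimatrix_carrier :: "nat vec \<Rightarrow> (nat \<Rightarrow> complex mat) set"
  where "multimatrix_carrier d = (\<Pi>\<^sub>E i\<in>{..<dim_vec d}. carrier_mat (d $ i) (d $ i))"

text \<open>\<open>\<phi>\<close> is a star-isomorphism of the unital star-subalgebra \<open>A\<close> onto
  \<open>\<Oplus>\<^sub>i M\<^bsub>d i\<^esub>(\<complex>)\<close>, with \<open>\<phi> x i\<close> the \<open>i\<close>-th component of \<open>\<phi> x\<close>. The function
  \<open>mat_adjoint\<close> is the conjugate transpose.\<close>

definition multimatrix_iso ::
  "'a::complex_star_algebra set \<Rightarrow> nat vec \<Rightarrow> ('a \<Rightarrow> nat \<Rightarrow> complex mat) \<Rightarrow> bool"
  where "multimatrix_iso A d \<phi> \<longleftrightarrow>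
    (\<forall>i<dim_vec d. 0 < d $ i) \<and>
    bij_betw \<phi> A (multimatrix_carrier d) \<and>
    (\<forall>i<dim_vec d.
      (\<forall>x\<in>A. \<forall>y\<in>A. \<phi> (x + y) i = \<phi> x i + \<phi> y i) \<and>
      (\<forall>c. \<forall>x\<in>A. \<phi> (c *\<^sub>C x) i = c \<cdot>\<^sub>m \<phi> x i) \<and>
      (\<forall>x\<in>A. \<forall>y\<in>A. \<phi> (x * y) i = \<phi> x i * \<phi> y i) \<and>
      (\<forall>x\<in>A. \<phi> (x\<^sup>\<star>) i = mat_adjoint (\<phi> x i)) \<and>
      \<phi> 1 i = 1\<^sub>m (d $ i))"

text \<open>\<open>\<Lambda> $$ (\<alpha>, i)\<close> is the multiplicity of the \<open>\<alpha>\<close>-th summand of \<open>A\<close> in the \<open>i\<close>-th summand of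
  the whole algebra: up to conjugation by a unitary \<open>U\<close> that does not depend on \<open>x\<close>, the matrix
  \<open>\<phi> x i\<close> is block diagonal, with each \<open>\<psi> x \<alpha>\<close> repeated \<open>\<Lambda> $$ (\<alpha>, i)\<close> times. (Unitarity and the
  matching of dimensions are part of \<^const>\<open>similar_mat_wit\<close>.)\<close>

definition inclusion_matrix ::
  "'a::complex_star_algebra set \<Rightarrow> nat vec \<Rightarrow> ('a \<Rightarrow> nat \<Rightarrow> complex mat) \<Rightarrow>
    nat vec \<Rightarrow> ('a \<Rightarrow> nat \<Rightarrow> complex mat) \<Rightarrow> nat mat \<Rightarrow> bool"
  where "inclusion_matrix A m \<psi> d \<phi> \<Lambda> \<longleftrightarrow>
    \<Lambda> \<in> carrier_mat (dim_vec m) (dim_vec d) \<and>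
    (\<forall>i<dim_vec d. \<exists>U. \<forall>x\<in>A. similar_mat_wit (\<phi> x i)
      (diag_block_mat (concat (map (\<lambda>\<alpha>. replicate (\<Lambda> $$ (\<alpha>, i)) (\<psi> x \<alpha>)) [0..<dim_vec m])))
      U (mat_adjoint U))"

end

theory Submission
  imports Defs
begin

text \<open>
  In Sweedler notation, the invariance \<open>p\<^sub>1 \<otimes> x p\<^sub>2 = S(x) p\<^sub>1 \<otimes> p\<^sub>2\<close> of the Haar projection
  gives \<open>x h = S(p\<^sub>1) \<tau>(p\<^sub>2 x)\<close> with \<open>h = E\<^sub>s(p) = S(E\<^sub>t(p))\<close>. Hence \<open>h\<close> is central, and computing
  the trace of \<open>y \<mapsto> x y h\<close> in this dual basis yields \<open>Tr(x h) = \<tau>(x)\<close>. So the Markov condition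
  \<open>h = \<lambda>1\<close> is equivalent to \<open>\<tau> = \<lambda> Tr\<close>, and, because \<open>h\<close> lies in \<open>K\<^sub>s\<close>, already to
  \<open>\<tau> = \<lambda> Tr\<close> on \<open>K\<^sub>s\<close>.

  On \<open>K\<^sub>s\<close> the trace \<open>\<tau>\<close> is the regular trace of \<open>K\<^sub>s\<close>, with dual basis
  \<open>z = 1\<^sub>1 \<tau>(z S(1\<^sub>2))\<close>. Comparing \<open>\<tau>\<close> and \<open>\<lambda> Tr\<close> block by block gives the eigenvector equation,
  which forces \<open>1/\<lambda>\<close> to be an integer because all \<open>\<lambda>\<^sup>-\<^sup>k m\<^sub>\<alpha>\<close> are integers.

  A basis with \<open>n\<close> elements makes \<open>K\<close> a free right \<open>K\<^sub>s\<close>-module, so right multiplication by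
  \<open>z \<in> K\<^sub>s\<close> has trace \<open>n \<tau>(z)\<close>. Conversely, orthonormal bases \<open>v\<^sup>\<alpha>\<close> of the spaces \<open>K f\<^sup>\<alpha>\<^sub>0\<^sub>0\<close>, which have
  dimension \<open>n m\<^sub>\<alpha>\<close>, are combined with matrix units \<open>f\<^sup>\<alpha>\<^sub>k\<^sub>l\<close> of \<open>K\<^sub>s\<close> to
  \<open>u\<^sub>\<nu> = \<Sum> v\<^sup>\<alpha>\<^bsub>\<nu>k\<^esub> f\<^sup>\<alpha>\<^sub>0\<^sub>k\<close>. The map \<open>x \<mapsto> S(x)\<^sup>\<star>\<close> exchanges bases for \<open>E\<^sub>s\<close> and \<open>E\<^sub>t\<close>.
\<close>

section \<open>Tensor products and traces\<close>

lemma clinearI: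
  "\<lbrakk>\<And>x y. f (x + y) = f x + f y; \<And>c x. f (c *\<^sub>C x) = c *\<^sub>C f x\<rbrakk> \<Longrightarrow> clinear f"
  by (simp add: clinear_iff)

lemma clinear_sum: "clinear f \<Longrightarrow> f (sum g A) = (\<Sum>a\<in>A. f (g a))"
  by (rule complex_vector_pair.linear_sum)

lemma cbilinearI:
  assumes "\<And>x y z. f (x + y) z = f x z + f y z" "\<And>x y z. f x (y + z) = f x y + f x z"
    "\<And>c x y. f (c *\<^sub>C x) y = c *\<^sub>C f x y" "\<And>c x y. f x (c *\<^sub>C y) = c *\<^sub>C f x y"
  shows "cbilinear f"
  using assms by (simp add: cbilinear_def clinear_iff)

section \<open>Bilinear maps on tensors, as a form of Sweedler notation\<close>

lemma tensor_lift_add: "cbilinear f \<Longrightarrow> tensor_lift f (s + t) = tensor_lift f s + tensor_lift f t"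
  and tensor_lift_scaleC: "cbilinear f \<Longrightarrow> tensor_lift f (c *\<^sub>C t) = c *\<^sub>C tensor_lift f t"
  using clinear_tensor_lift[of f] by (auto simp: clinear_iff)

text \<open>For \<open>t = \<Delta> x\<close>, \<open>tensor_lift f t\<close> stands for the
  Sweedler sum f(x_1, x_2). This rule carries a linear map into or out of such a sum; both sides are
  additive in \<open>t\<close>, so pure tensors suffice.\<close>

lemma tensor_lift_comp:
  assumes "cbilinear f" "clinear g"
  shows "g (tensor_lift f t) = tensor_lift (\<lambda>a b. g (f a b)) t"
proof -
  have "cbilinear (\<lambda>a b. g (f a b))"
    using assms by (simp add: cbilinear_def clinear_iff)
  then show ?thesis
    using assms by (induction t) (simp_all add: tensor_lift_add clinear_iff)
qed

lemma tensor_lift_add_fun: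
  assumes "cbilinear f" "cbilinear g"
  shows "tensor_lift (\<lambda>a b. f a b + g a b) t = tensor_lift f t + tensor_lift g t"
proof -
  have "cbilinear (\<lambda>a b. f a b + g a b)"
    using assms by (simp add: cbilinear_def clinear_iff scaleC_add_right)
  then show ?thesis
    using assms by (induction t) (simp_all add: tensor_lift_add)
qed

lemma tensor_lift_scaleC_fun:
  "cbilinear f \<Longrightarrow> tensor_lift (\<lambda>a b. c *\<^sub>C f a b) t = c *\<^sub>C tensor_lift f t"
  using tensor_lift_comp[of f "scaleC c" t]
  by (simp add: clinear_iff scaleC_add_right scaleC_scaleC mult.commute)

lemma tensor_lift_sum:
  assumes "\<And>i. i \<in> I \<Longrightarrow> cbilinear (f i)"
  shows "(\<Sum>i\<in>I. tensor_lift (f i) t) = tensor_lift (\<lambda>a b. \<Sum>i\<in>I. f i a b) t"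
proof -
  have "cbilinear (\<lambda>a b. \<Sum>i\<in>I. f i a b)"
    using assms
    by (simp add: cbilinear_def clinear_iff sum.distrib complex_vector.scale_sum_right)
  then show ?thesis
    using assms by (induction t) (simp_all add: tensor_lift_add sum.distrib)
qed

lemma clinear_ident [simp]: "clinear (\<lambda>x. x)" "clinear id"
  by (auto simp: clinear_iff)

lemma cbilinear_tensor_map:
  assumes "clinear g" "clinear h"
  shows "cbilinear (\<lambda>x y. g x \<otimes>\<^sub>C h y)"
  using assms by (simp add: cbilinear_def clinear_iff tensor_of_add_left tensor_of_add_right
      tensor_of_scaleC_left tensor_of_scaleC_right)

lemma tensor_map_tensor_of [simp]:
  "clinear g \<Longrightarrow> clinear h \<Longrightarrow> tensor_map g h (x \<otimes>\<^sub>C y) = g x \<otimes>\<^sub>C h y"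
  by (simp add: tensor_map_def cbilinear_tensor_map)

lemma clinear_tensor_map: "clinear g \<Longrightarrow> clinear h \<Longrightarrow> clinear (tensor_map g h)"
  unfolding tensor_map_def by (rule clinear_tensor_lift[OF cbilinear_tensor_map])

lemma tensor_map_add:
  "clinear g \<Longrightarrow> clinear h \<Longrightarrow> tensor_map g h (s + t) = tensor_map g h s + tensor_map g h t"
  using clinear_tensor_map[of g h] by (simp add: clinear_iff)

lemma tensor_lift_tensor_map:
  assumes "cbilinear f" "clinear g" "clinear h"
  shows "tensor_lift f (tensor_map g h t) = tensor_lift (\<lambda>a b. f (g a) (h b)) t"
proof -
  have "cbilinear (\<lambda>a b. f (g a) (h b))"
    using assms by (simp add: cbilinear_def clinear_iff)
  then show ?thesis
    using assms by (induction t) (simp_all add: tensor_lift_add tensor_map_add)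
qed

lemma tensor_lift_mult_left:
  assumes "cbilinear f"
  shows "tensor_lift f ((x \<otimes>\<^sub>C y) * t) = tensor_lift (\<lambda>a b. f (x * a) (y * b)) t"
proof -
  have "cbilinear (\<lambda>a b. f (x * a) (y * b))"
    using assms by (simp add: cbilinear_def clinear_iff distrib_left mult_scaleC_right)
  then show ?thesis
    using assms
    by (induction t) (simp_all add: tensor_lift_add distrib_left tensor_of_mult_tensor_of)
qed

lemma tensor_lift_mult_right:
  assumes "cbilinear f"
  shows "tensor_lift f (t * (x \<otimes>\<^sub>C y)) = tensor_lift (\<lambda>a b. f (a * x) (b * y)) t"
proof -
  have "cbilinear (\<lambda>a b. f (a * x) (b * y))"
    using assms by (simp add: cbilinear_def clinear_iff distrib_right mult_scaleC_left)
  then show ?thesis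
    using assms
    by (induction t) (simp_all add: tensor_lift_add distrib_right tensor_of_mult_tensor_of)
qed

text \<open>The star is antilinear and so cannot pass through a sum as \<open>g\<close> does in
  \<open>tensor_lift_comp\<close>. Starring the arguments together with the value makes the
  integrand bilinear again.\<close>

lemma tensor_lift_star:
  assumes "cbilinear f"
  shows "tensor_lift (\<lambda>a b. (f (a\<^sup>\<star>) (b\<^sup>\<star>))\<^sup>\<star>) t = (tensor_lift f (t\<^sup>\<star>))\<^sup>\<star>"
proof -
  have "cbilinear (\<lambda>a b. (f (a\<^sup>\<star>) (b\<^sup>\<star>))\<^sup>\<star>)"
    using assms by (simp add: cbilinear_def clinear_iff star_add star_scaleC)
  then show ?thesis
    using assms
    by (induction t) (simp_all add: tensor_lift_add star_tensor_of star_add)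
qed

lemma cbilinear_tensor_flip: "cbilinear (\<lambda>x y. y \<otimes>\<^sub>C x)"
  by (intro cbilinearI) (simp_all add: tensor_of_add_left tensor_of_add_right
      tensor_of_scaleC_left tensor_of_scaleC_right)

lemma tensor_flip_tensor_of [simp]: "tensor_flip (x \<otimes>\<^sub>C y) = y \<otimes>\<^sub>C x"
  by (simp add: tensor_flip_def cbilinear_tensor_flip)

lemma tensor_flip_add: "tensor_flip (s + t) = tensor_flip s + tensor_flip t"
  by (simp add: tensor_flip_def tensor_lift_add cbilinear_tensor_flip)

lemma tensor_lift_flip:
  assumes "cbilinear f"
  shows "tensor_lift f (tensor_flip t) = tensor_lift (\<lambda>a b. f b a) t"
proof -
  have "cbilinear (\<lambda>a b. f b a)"
    using assms by (simp add: cbilinear_def)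
  then show ?thesis
    using assms by (induction t) (simp_all add: tensor_lift_add tensor_flip_add)
qed

lemma cbilinear_tensor_assoc: "cbilinear (\<lambda>x y. x \<otimes>\<^sub>C (y \<otimes>\<^sub>C z))"
  by (intro cbilinearI) (simp_all add: tensor_of_add_left tensor_of_add_right
      tensor_of_scaleC_left tensor_of_scaleC_right)

lemma cbilinear_tensor_assoc_lift:
  "cbilinear (\<lambda>t z. tensor_lift (\<lambda>x y. x \<otimes>\<^sub>C (y \<otimes>\<^sub>C z)) t)"
proof (intro cbilinearI)
  fix s t :: "('a::complex_vector, 'b::complex_vector) tensor" and y z :: "'c::complex_vector" and c
  show "tensor_lift (\<lambda>a b. a \<otimes>\<^sub>C (b \<otimes>\<^sub>C (y + z))) t =
      tensor_lift (\<lambda>a b. a \<otimes>\<^sub>C (b \<otimes>\<^sub>C y)) t + tensor_lift (\<lambda>a b. a \<otimes>\<^sub>C (b \<otimes>\<^sub>C z)) t"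
    by (simp add: tensor_of_add_right tensor_lift_add_fun cbilinear_tensor_assoc)
  show "tensor_lift (\<lambda>a b. a \<otimes>\<^sub>C (b \<otimes>\<^sub>C (c *\<^sub>C y))) t =
      c *\<^sub>C tensor_lift (\<lambda>a b. a \<otimes>\<^sub>C (b \<otimes>\<^sub>C y)) t"
    by (simp add: tensor_of_scaleC_right tensor_lift_scaleC_fun cbilinear_tensor_assoc)
qed (simp_all add: tensor_lift_add tensor_lift_scaleC cbilinear_tensor_assoc)

lemma tensor_assoc_tensor_of:
  "tensor_assoc (t \<otimes>\<^sub>C z) = tensor_lift (\<lambda>x y. x \<otimes>\<^sub>C (y \<otimes>\<^sub>C z)) t"
  by (simp add: tensor_assoc_def cbilinear_tensor_assoc_lift)

lemma clinear_tensor_assoc: "clinear tensor_assoc"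
  unfolding tensor_assoc_def by (rule clinear_tensor_lift[OF cbilinear_tensor_assoc_lift])

lemma slice_left_eq: "slice_left \<omega> id t = tensor_lift (\<lambda>x y. \<omega> x *\<^sub>C y) t"
  by (simp add: slice_left_def)

lemma slice_right_eq: "slice_right id \<omega> t = tensor_lift (\<lambda>x y. \<omega> y *\<^sub>C x) t"
  by (simp add: slice_right_def)

section \<open>Traces of endomorphisms through rank-one operators\<close>

context
  assumes fin: "cfinite_dimensional TYPE('a::complex_vector)"
begin

lemma finite_extend_basis: "finite (complex_vector.extend_basis ({} :: 'a set))"
  and span_extend_basis: "complex_vector.span (complex_vector.extend_basis ({} :: 'a set)) = UNIV"
  and independent_extend_basis: "complex_vector.independent (complex_vector.extend_basis ({} :: 'a set))"
proof -
  obtain F :: "'a set" where F: "finite F" "complex_vector.span F = UNIV"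
    using fin unfolding cfinite_dimensional_def by blast
  show ind: "complex_vector.independent (complex_vector.extend_basis ({} :: 'a set))"
    using complex_vector.independent_extend_basis complex_vector.independent_empty by blast
  show "complex_vector.span (complex_vector.extend_basis ({} :: 'a set)) = UNIV"
    using complex_vector.span_extend_basis complex_vector.independent_empty by blast
  show "finite (complex_vector.extend_basis ({} :: 'a set))"
    using complex_vector.independent_span_bound[OF F(1) ind] F(2) by simp
qed

lemma ctrace_add:
  assumes "clinear f" "clinear g"
  shows "ctrace (\<lambda>y::'a. f y + g y) = ctrace f + ctrace g"
  using span_extend_basis independent_extend_basis
  by (simp add: ctrace_def Let_def sum.distrib complex_vector.representation_add)

lemma ctrace_sum:
  assumes "finite I" "\<And>i. i \<in> I \<Longrightarrow> clinear (f i)"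
  shows "ctrace (\<lambda>y::'a. \<Sum>i\<in>I. f i y) = (\<Sum>i\<in>I. ctrace (f i))"
  using assms
proof (induction I)
  case empty
  then show ?case
    by (simp add: ctrace_def Let_def complex_vector.representation_zero)
next
  case (insert i I)
  have "clinear (\<lambda>y. \<Sum>i\<in>I. f i y)"
    using insert.prems by (simp add: clinear_iff sum.distrib complex_vector.scale_sum_right)
  with insert show ?case
    by (simp add: ctrace_add)
qed

lemma ctrace_scaleC:
  assumes "clinear f"
  shows "ctrace (\<lambda>y::'a. c *\<^sub>C f y) = c * ctrace f"
  using span_extend_basis independent_extend_basis
  by (simp add: ctrace_def Let_def complex_vector.representation_scale sum_distrib_left)

text \<open>Expanding \<open>a\<close> in the basis reassembles the diagonal sum into
  \<open>\<omega> a\<close>. Operators written as sums of rank-one operators thus get traces that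
  refer to no basis.\<close>

lemma ctrace_rank_one:
  assumes "clinear \<omega>"
  shows "ctrace (\<lambda>y::'a. \<omega> y *\<^sub>C a) = \<omega> a"
proof -
  let ?B = "complex_vector.extend_basis ({} :: 'a set)"
  let ?r = "complex_vector.representation ?B"
  have a: "(\<Sum>b\<in>?B. ?r a b *\<^sub>C b) = a"
    by (rule complex_vector.sum_representation_eq)
      (use finite_extend_basis span_extend_basis independent_extend_basis in auto)
  have "ctrace (\<lambda>y. \<omega> y *\<^sub>C a) = (\<Sum>b\<in>?B. \<omega> b * ?r a b)"
    using span_extend_basis independent_extend_basis
    by (simp add: ctrace_def Let_def complex_vector.representation_scale)
  also have "\<dots> = \<omega> (\<Sum>b\<in>?B. ?r a b *\<^sub>C b)"
    using assms by (simp add: clinear_sum clinear_iff mult.commute)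
  finally show ?thesis by (simp add: a)
qed

text \<open>A tensor with legs a, b encodes the sum of the rank-one operators sending y to g(b, y)
  h(a); induction over the tensor adds up their traces. The dual bases \<open>\<Delta> p\<close> and
  \<open>\<Delta> 1\<close> enter in this way.\<close>

lemma ctrace_tensor_lift:
  fixes h :: "'c::complex_vector \<Rightarrow> 'a"
  assumes g: "cbilinear g" and h: "clinear h"
  shows "ctrace (\<lambda>y::'a. tensor_lift (\<lambda>a b. g b y *\<^sub>C h a) t) = tensor_lift (\<lambda>a b. g b (h a)) t"
proof -
  have bil: "cbilinear (\<lambda>a b. g b y *\<^sub>C h a)" for y
    using g h by (simp add: cbilinear_def clinear_iff scaleC_add_right scaleC_add_left scaleC_scaleC
        mult.commute)
  have lin: "clinear (\<lambda>y. tensor_lift (\<lambda>a b. g b y *\<^sub>C h a) t)" for t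
    using g by (induction t)
      (simp_all add: tensor_lift_add bil clinear_iff scaleC_add_right scaleC_add_left scaleC_scaleC
        cbilinear_def)
  have bil': "cbilinear (\<lambda>a b. g b (h a))"
    using g h by (simp add: cbilinear_def clinear_iff)
  show ?thesis
  proof (induction t)
    case (tensor_of a b)
    have "clinear (g b)"
      using g by (simp add: cbilinear_def)
    then show ?case
      by (simp add: bil bil' ctrace_rank_one)
  qed (simp add: tensor_lift_add bil bil' lin ctrace_add)
qed

end

section \<open>Weak Kac algebras\<close>

lemma tensor_lift_tensor_of_id: "tensor_lift (\<otimes>\<^sub>C) t = t"
  by (induction t) (simp_all add: tensor_lift_add cbilinear_tensor_of)

lemma star_one: "(1::'a::complex_star_algebra)\<^sup>\<star> = 1"
  by (metis star_mult star_star mult.left_neutral mult.right_neutral)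

text \<open>Polarisation: \<open>\<omega>\<close> is real on \<open>y\<^sup>\<star> * y\<close> for
  y = c1 + x. The choice c = 1 compares the imaginary parts of the two sides, and c = i the real
  parts.\<close>

lemma positive_functional_star:
  assumes "positive_functional \<omega>"
  shows "\<omega> (x\<^sup>\<star>) = cnj (\<omega> x)"
proof -
  have lin: "\<omega> (a + b) = \<omega> a + \<omega> b" "\<omega> (c *\<^sub>C a) = c * \<omega> a" for a b c
    using assms by (auto simp: positive_functional_def clinear_iff)
  have re: "Im (\<omega> (a\<^sup>\<star> * a)) = 0" for a
    using assms by (auto simp: positive_functional_def less_eq_complex_def)
  have scale: "(c *\<^sub>C 1 + x)\<^sup>\<star> * (c *\<^sub>C 1 + x)
      = (cnj c * c) *\<^sub>C 1 + cnj c *\<^sub>C x + c *\<^sub>C x\<^sup>\<star> + x\<^sup>\<star> * x" for c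
    by (simp add: star_add star_scaleC star_one distrib_left distrib_right mult_scaleC_left
        mult_scaleC_right scaleC_scaleC scaleC_add_right mult.commute)
  have *: "Im (cnj c * \<omega> x + c * \<omega> (x\<^sup>\<star>)) = 0" for c
  proof -
    have "Im (\<omega> ((c *\<^sub>C 1 + x)\<^sup>\<star> * (c *\<^sub>C 1 + x))) = 0" by (rule re)
    moreover have "Im (\<omega> 1) = 0" using re[of 1] by (simp add: star_one)
    ultimately show ?thesis
      using re[of x] unfolding scale by (simp add: lin)
  qed
  show ?thesis
    using *[of 1] *[of \<i>] by (simp add: complex_eq_iff)
qed

lemma star_sum: "(sum f A :: 'a::complex_star_algebra)\<^sup>\<star> = (\<Sum>i\<in>A. (f i)\<^sup>\<star>)"
proof -
  have "(0::'a)\<^sup>\<star> = 0"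
    using star_scaleC[of 0 "0::'a"] by simp
  then show ?thesis
    by (induction A rule: infinite_finite_induct) (auto simp: star_add)
qed

lemma tensor_assoc_add: "tensor_assoc (s + t) = tensor_assoc s + tensor_assoc t"
  using clinear_tensor_assoc unfolding clinear_iff by blast

context weak_kac_algebra
begin

abbreviation source ("\<epsilon>\<^sub>s") where "\<epsilon>\<^sub>s \<equiv> counital_source \<Delta> \<epsilon>"
abbreviation target ("\<epsilon>\<^sub>t") where "\<epsilon>\<^sub>t \<equiv> counital_target \<Delta> \<epsilon>"
abbreviation Ks ("K\<^sub>s") where "K\<^sub>s \<equiv> source_cartan \<Delta> \<epsilon>"
abbreviation Kt ("K\<^sub>t") where "K\<^sub>t \<equiv> target_cartan \<Delta> \<epsilon>"

section \<open>The counital maps and their exchange by the antipode\<close>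

lemma counit_linear: "clinear \<epsilon>"
  using counit_positive by (simp add: positive_functional_def)

lemma linear_maps:
  "\<Delta> (x + y) = \<Delta> x + \<Delta> y" "\<Delta> (c *\<^sub>C x) = c *\<^sub>C \<Delta> x"
  "S (x + y) = S x + S y" "S (c *\<^sub>C x) = c *\<^sub>C S x"
  "\<epsilon> (x + y) = \<epsilon> x + \<epsilon> y" "\<epsilon> (c *\<^sub>C x) = c * \<epsilon> x"
  using comult_linear antipode_linear counit_linear by (auto simp: clinear_iff)

lemmas linear_simps = linear_maps distrib_left distrib_right mult_scaleC_left mult_scaleC_right
  tensor_of_add_left tensor_of_add_right tensor_of_scaleC_left tensor_of_scaleC_right
  scaleC_add_right scaleC_add_left scaleC_scaleC

lemma source_eq: "\<epsilon>\<^sub>s x = tensor_lift (\<lambda>a b. \<epsilon> (x * b) *\<^sub>C a) (\<Delta> 1)"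
  unfolding counital_source_def slice_right_eq
  by (subst tensor_lift_mult_left) (auto intro!: cbilinearI simp: linear_simps mult.commute)

lemma target_eq: "\<epsilon>\<^sub>t x = tensor_lift (\<lambda>a b. \<epsilon> (a * x) *\<^sub>C b) (\<Delta> 1)"
  unfolding counital_target_def slice_left_eq
  by (subst tensor_lift_mult_right) (auto intro!: cbilinearI simp: linear_simps mult.commute)

lemma source_linear: "clinear \<epsilon>\<^sub>s"
proof (rule clinearI)
  fix x y c
  have b: "cbilinear (\<lambda>a b. \<epsilon> (x * b) *\<^sub>C a)" for x
    by (auto intro!: cbilinearI simp: linear_simps mult.commute)
  show "\<epsilon>\<^sub>s (x + y) = \<epsilon>\<^sub>s x + \<epsilon>\<^sub>s y"
    by (simp add: source_eq linear_simps tensor_lift_add_fun b)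
  show "\<epsilon>\<^sub>s (c *\<^sub>C x) = c *\<^sub>C \<epsilon>\<^sub>s x"
    by (simp add: source_eq linear_simps b flip: tensor_lift_scaleC_fun)
qed

lemma source_antipode_aux: "S (\<epsilon>\<^sub>s x) = tensor_lift (\<lambda>a b. \<epsilon> (x * b) *\<^sub>C S a) (\<Delta> 1)"
  unfolding source_eq
  by (subst tensor_lift_comp) (auto intro!: cbilinearI simp: linear_simps mult.commute antipode_linear)

lemma antipode_one: "S 1 = 1"
  by (metis antipode_antimult antipode_involutive mult.left_neutral mult.right_neutral)

text \<open>\<open>S\<close> reverses both products and legs, so this rule turns identities on the
  source side into their mirror images on the target side.\<close>

lemma lift_comult_antipode:
  assumes "cbilinear f"
  shows "tensor_lift f (\<Delta> (S x)) = tensor_lift (\<lambda>a b. f (S b) (S a)) (\<Delta> x)"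
proof -
  have "cbilinear (\<lambda>a b. f b a)"
    using assms by (simp add: cbilinear_def)
  then show ?thesis
    by (simp add: antipode_anticomult tensor_lift_flip assms tensor_lift_tensor_map antipode_linear)
qed

lemma counit_left': "tensor_lift (\<lambda>a b. \<epsilon> a *\<^sub>C b) (\<Delta> x) = x"
  and counit_right': "tensor_lift (\<lambda>a b. \<epsilon> b *\<^sub>C a) (\<Delta> x) = x"
  using counit_left counit_right by (simp_all add: slice_left_eq slice_right_eq)

text \<open>Applying \<open>S\<close> to the right counit law at \<open>S x\<close> shows that
  \<open>\<epsilon> \<circ> S\<close> is a left counit. It then agrees with the right counit
  \<open>\<epsilon>\<close>: evaluate \<epsilon>(S(x_1)) \<epsilon>(x_2) in two ways.\<close>

lemma counit_antipode: "\<epsilon> (S x) = \<epsilon> x"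
proof -
  have b: "cbilinear (\<lambda>a b. \<epsilon> b *\<^sub>C a)" "cbilinear (\<lambda>a b. \<epsilon> (S a) *\<^sub>C S b)"
    "cbilinear (\<lambda>a b. \<epsilon> (S a) *\<^sub>C b)"
    by (auto intro!: cbilinearI simp: linear_simps mult.commute)
  have "S (S x) = S (tensor_lift (\<lambda>a b. \<epsilon> (S a) *\<^sub>C S b) (\<Delta> x))"
    using counit_right'[of "S x"] by (simp add: lift_comult_antipode b)
  then have "x = tensor_lift (\<lambda>a b. \<epsilon> (S a) *\<^sub>C b) (\<Delta> x)"
    by (simp add: tensor_lift_comp b antipode_linear antipode_involutive linear_maps)
  then have "\<epsilon> x = tensor_lift (\<lambda>a b. \<epsilon> (S a) * \<epsilon> b) (\<Delta> x)"
    using tensor_lift_comp[OF b(3) counit_linear, of "\<Delta> x"] by (simp add: linear_maps)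
  also have "\<dots> = tensor_lift (\<lambda>a b. \<epsilon> (S (\<epsilon> b *\<^sub>C a))) (\<Delta> x)"
    by (simp add: linear_maps mult.commute)
  also have "\<dots> = \<epsilon> (S (tensor_lift (\<lambda>a b. \<epsilon> b *\<^sub>C a) (\<Delta> x)))"
    by (rule tensor_lift_comp[symmetric, of _ "\<lambda>x. \<epsilon> (S x)"])
      (auto intro!: clinearI simp: b linear_maps)
  finally show ?thesis by (simp add: counit_right')
qed

lemma target_antipode: "\<epsilon>\<^sub>t (S x) = S (\<epsilon>\<^sub>s x)"
proof -
  have "\<epsilon>\<^sub>t (S x) = tensor_lift (\<lambda>a b. \<epsilon> (a * S x) *\<^sub>C b) (\<Delta> (S 1))"
    by (simp add: target_eq antipode_one)
  also have "\<dots> = tensor_lift (\<lambda>a b. \<epsilon> (S (x * b)) *\<^sub>C S a) (\<Delta> 1)"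
    by (subst lift_comult_antipode)
      (auto intro!: cbilinearI simp: linear_simps mult.commute antipode_antimult)
  finally show ?thesis
    by (simp add: counit_antipode source_antipode_aux)
qed

lemma source_antipode: "\<epsilon>\<^sub>s (S x) = S (\<epsilon>\<^sub>t x)"
  using target_antipode[of "S x"] by (metis antipode_involutive)

lemma target_linear: "clinear \<epsilon>\<^sub>t"
proof -
  have "\<epsilon>\<^sub>t = (\<lambda>x. S (\<epsilon>\<^sub>s (S x)))"
    by (simp add: source_antipode antipode_involutive)
  moreover have "clinear (\<lambda>x. S (\<epsilon>\<^sub>s (S x)))"
    using source_linear by (auto simp: clinear_iff linear_maps)
  ultimately show ?thesis by simp
qed

lemma counital_linear_maps:
  "\<epsilon>\<^sub>s (x + y) = \<epsilon>\<^sub>s x + \<epsilon>\<^sub>s y" "\<epsilon>\<^sub>s (c *\<^sub>C x) = c *\<^sub>C \<epsilon>\<^sub>s x"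
  "\<epsilon>\<^sub>t (x + y) = \<epsilon>\<^sub>t x + \<epsilon>\<^sub>t y" "\<epsilon>\<^sub>t (c *\<^sub>C x) = c *\<^sub>C \<epsilon>\<^sub>t x"
  using source_linear target_linear by (auto simp: clinear_iff)

lemma source_mult: "\<epsilon>\<^sub>s x * y = tensor_lift (\<lambda>a b. \<epsilon> (x * b) *\<^sub>C a) (\<Delta> y)"
  unfolding counital_source_mult slice_right_eq
  by (subst tensor_lift_mult_left) (auto intro!: cbilinearI simp: linear_simps mult.commute)

text \<open>This is \<open>counital_source_comult\<close> under a bilinear map. At
  \<open>x = 1\<close> it allows \<open>\<epsilon>\<^sub>s\<close> to be inserted into the first leg
  of \<open>\<Delta> 1\<close> or dropped from it.\<close>

lemma lift_source_comult:
  assumes "cbilinear f"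
  shows "tensor_lift (\<lambda>a b. f (\<epsilon>\<^sub>s a) b) (\<Delta> x) = tensor_lift (\<lambda>a b. f a (x * b)) (\<Delta> 1)"
  using arg_cong[OF counital_source_comult, of "tensor_lift f" x] assms
  by (simp add: tensor_lift_tensor_map source_linear tensor_lift_mult_left)

text \<open>Mirror image of the previous rule, x_1 \<otimes> \<epsilon>_t(x_2) = 1_1 x \<otimes>
  1_2, obtained by writing x as S(S x) and using the source version at \<open>S x\<close>.\<close>

lemma lift_target_comult:
  assumes "cbilinear f"
  shows "tensor_lift (\<lambda>a b. f a (\<epsilon>\<^sub>t b)) (\<Delta> x) = tensor_lift (\<lambda>a b. f (a * x) b) (\<Delta> 1)"
proof -
  have f: "f (x + y) z = f x z + f y z" "f x (y + z) = f x y + f x z"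
    "f (c *\<^sub>C x) y = c *\<^sub>C f x y" "f x (c *\<^sub>C y) = c *\<^sub>C f x y" for x y z c
    using assms by (auto simp: cbilinear_def clinear_iff)
  have "tensor_lift (\<lambda>a b. f a (\<epsilon>\<^sub>t b)) (\<Delta> (S (S x)))
      = tensor_lift (\<lambda>a b. f (S b) (\<epsilon>\<^sub>t (S a))) (\<Delta> (S x))"
    by (subst lift_comult_antipode)
      (auto intro!: cbilinearI simp: f counital_linear_maps)
  also have "\<dots> = tensor_lift (\<lambda>a b. f (S b) (S (\<epsilon>\<^sub>s a))) (\<Delta> (S x))"
    by (simp add: target_antipode)
  also have "\<dots> = tensor_lift (\<lambda>a b. f (S b * x) (S a)) (\<Delta> 1)"
    by (subst lift_source_comult[of "\<lambda>a b. f (S b) (S a)"])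
      (auto intro!: cbilinearI simp: f linear_maps antipode_antimult antipode_involutive)
  also have "\<dots> = tensor_lift (\<lambda>a b. f (a * x) b) (\<Delta> (S 1))"
    by (subst lift_comult_antipode) (auto intro!: cbilinearI simp: f linear_simps)
  finally show ?thesis
    by (simp add: antipode_involutive antipode_one)
qed

lemma antipode_source: "tensor_lift (\<lambda>a b. S a * b) (\<Delta> x) = \<epsilon>\<^sub>s x"
proof -
  have "tensor_lift (\<lambda>a b. S a * b) (\<Delta> x) = tensor_collapse (tensor_map S id (\<Delta> x))"
    unfolding tensor_collapse_def
    by (subst tensor_lift_tensor_map) (auto intro!: cbilinearI simp: linear_simps antipode_linear)
  then show ?thesis by (simp add: antipode_counital_source)
qed

lemma antipode_target: "tensor_lift (\<lambda>a b. a * S b) (\<Delta> x) = \<epsilon>\<^sub>t x"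
proof -
  have "tensor_lift (\<lambda>a b. a * S b) (\<Delta> (S (S x))) = tensor_lift (\<lambda>a b. S (S a * b)) (\<Delta> (S x))"
    by (subst lift_comult_antipode)
      (auto intro!: cbilinearI simp: linear_simps antipode_antimult antipode_involutive)
  also have "\<dots> = S (\<epsilon>\<^sub>s (S x))"
    unfolding antipode_source[symmetric]
    by (subst tensor_lift_comp) (auto intro!: cbilinearI simp: linear_simps antipode_linear)
  finally show ?thesis by (simp add: antipode_involutive source_antipode)
qed

lemma source_one: "\<epsilon>\<^sub>s 1 = 1"
  by (simp add: source_eq counit_right')

lemma target_one: "\<epsilon>\<^sub>t 1 = 1"
  by (simp add: target_eq counit_left')

text \<open>By \<open>lift_source_comult\<close> at 1, the first leg of \<open>\<Delta> 1\<close> is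
  already fixed by \<open>\<epsilon>\<^sub>s\<close>.\<close>

lemma source_source: "\<epsilon>\<^sub>s (\<epsilon>\<^sub>s x) = \<epsilon>\<^sub>s x"
proof -
  have b: "cbilinear (\<lambda>a b. \<epsilon> (x * b) *\<^sub>C a)"
    by (auto intro!: cbilinearI simp: linear_simps mult.commute)
  have "\<epsilon>\<^sub>s (\<epsilon>\<^sub>s x) = tensor_lift (\<lambda>a b. \<epsilon>\<^sub>s (\<epsilon> (x * b) *\<^sub>C a)) (\<Delta> 1)"
    by (subst (2) source_eq) (simp add: tensor_lift_comp b source_linear)
  also have "\<dots> = \<epsilon>\<^sub>s x"
    by (simp add: counital_linear_maps lift_source_comult[OF b]) (simp add: source_eq)
  finally show ?thesis .
qed

text \<open>By \<open>source_mult\<close> the left side is \<epsilon>(y_1) \<epsilon>(x y_2), and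
  the counit law absorbs y_1.\<close>

lemma counit_source_mult: "\<epsilon> (\<epsilon>\<^sub>s x * y) = \<epsilon> (x * y)"
proof -
  have "\<epsilon> (\<epsilon>\<^sub>s x * y) = tensor_lift (\<lambda>a b. \<epsilon> (\<epsilon> (x * b) *\<^sub>C a)) (\<Delta> y)"
    unfolding source_mult
    by (subst tensor_lift_comp) (auto intro!: cbilinearI simp: linear_simps mult.commute counit_linear)
  also have "\<dots> = tensor_lift (\<lambda>a b. \<epsilon> (x * (\<epsilon> a *\<^sub>C b))) (\<Delta> y)"
    by (simp add: linear_simps mult.commute)
  also have "\<dots> = \<epsilon> (x * tensor_lift (\<lambda>a b. \<epsilon> a *\<^sub>C b) (\<Delta> y))"
    by (subst tensor_lift_comp[of _ "\<lambda>z. \<epsilon> (x * z)"])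
      (auto intro!: cbilinearI clinearI simp: linear_simps mult.commute)
  finally show ?thesis by (simp add: counit_left')
qed

lemma counit_source: "\<epsilon> (\<epsilon>\<^sub>s x) = \<epsilon> x"
  using counit_source_mult[of x 1] by simp

lemma counit_target_mult: "\<epsilon> (x * \<epsilon>\<^sub>t y) = \<epsilon> (x * y)"
  by (metis antipode_antimult counit_antipode counit_source_mult source_antipode)

text \<open>Coassociativity \<open>x\<^sub>1 \<otimes> \<Delta> x\<^sub>2 = \<Delta> x\<^sub>1 \<otimes> x\<^sub>2\<close> in Sweedler notation, evaluated on
  an arbitrary trilinear map.\<close>

lemma lift_coassociative:
  assumes F: "cbilinear F"
  shows "tensor_lift (\<lambda>a b. F a (\<Delta> b)) (\<Delta> x)
    = tensor_lift (\<lambda>a b. tensor_lift (\<lambda>c d. F c (d \<otimes>\<^sub>C b)) (\<Delta> a)) (\<Delta> x)"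
proof -
  have f: "F (x + y) z = F x z + F y z" "F x (u + v) = F x u + F x v"
    "F (c *\<^sub>C x) u = c *\<^sub>C F x u" "F x (c *\<^sub>C u) = c *\<^sub>C F x u" for x y z u v c
    using F by (auto simp: cbilinear_def clinear_iff)
  have b1: "cbilinear (\<lambda>c d. F c (d \<otimes>\<^sub>C b))" for b
    by (auto intro!: cbilinearI simp: f linear_simps)
  have b2: "cbilinear (\<lambda>a b. tensor_lift (\<lambda>c d. F c (d \<otimes>\<^sub>C b)) (\<Delta> a))"
    by (auto intro!: cbilinearI simp: linear_simps f tensor_lift_add tensor_lift_scaleC b1
        tensor_lift_add_fun tensor_lift_scaleC_fun)
  \<comment> \<open>Replacing \<open>\<Delta> x\<close> in the coassociativity axiom by an arbitrary
    tensor \<open>t\<close> makes induction on \<open>t\<close> possible.\<close>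
  have "tensor_lift F (tensor_assoc (tensor_map \<Delta> id t))
      = tensor_lift (\<lambda>a b. tensor_lift (\<lambda>c d. F c (d \<otimes>\<^sub>C b)) (\<Delta> a)) t" for t
  proof (induction t)
    case (tensor_of a b)
    have "clinear (tensor_lift F)"
      by (rule clinear_tensor_lift[OF F])
    then show ?case
      by (simp add: comult_linear tensor_assoc_tensor_of tensor_lift_comp cbilinear_tensor_assoc b2 F)
  next
    case (add s t)
    then show ?case
      by (simp add: tensor_assoc_add tensor_map_add[OF comult_linear clinear_ident(2)] tensor_lift_add F b2 del: id_apply)
  qed
  from this[of "\<Delta> x"] show ?thesis
    by (simp add: coassociative tensor_lift_tensor_map F comult_linear)
qed

section \<open>The Cartan subalgebras and the coproduct on them\<close>

lemma mult_tensor_lift_left: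
  "cbilinear f \<Longrightarrow> (u::'b::complex_algebra_1) * tensor_lift f t = tensor_lift (\<lambda>a b. u * f a b) t"
  by (rule tensor_lift_comp[of f "(*) u" t]) (auto intro: clinearI simp: linear_simps)

lemma mult_tensor_lift_right:
  "cbilinear f \<Longrightarrow> tensor_lift f t * (u::'b::complex_algebra_1) = tensor_lift (\<lambda>a b. f a b * u) t"
  by (rule tensor_lift_comp[of f "\<lambda>x. x * u" t]) (auto intro: clinearI simp: linear_simps)

lemma tensor_left_mult_eq: "(x \<otimes>\<^sub>C y) * t = tensor_lift (\<lambda>a b. (x * a) \<otimes>\<^sub>C (y * b)) t"
  using tensor_lift_mult_left[OF cbilinear_tensor_of, of x y t] by (simp add: tensor_lift_tensor_of_id)

text \<open>By \<open>source_mult\<close> the right side is 1_1 \<otimes> 1_2 \<epsilon>(x 1_3).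
  Coassociativity regroups it as \<Delta>(1_1) \<epsilon>(x 1_2), which is \<Delta> applied to
  \<open>source_eq\<close>.\<close>

lemma comult_source: "\<Delta> (\<epsilon>\<^sub>s x) = (1 \<otimes>\<^sub>C \<epsilon>\<^sub>s x) * \<Delta> 1"
proof -
  have b: "cbilinear (\<lambda>c d. \<epsilon> (x * d) *\<^sub>C c)"
    by (auto intro!: cbilinearI simp: linear_simps mult.commute)
  let ?F = "\<lambda>a t. a \<otimes>\<^sub>C tensor_lift (\<lambda>c d. \<epsilon> (x * d) *\<^sub>C c) t"
  have F: "cbilinear ?F"
    by (auto intro!: cbilinearI simp: linear_simps tensor_lift_add tensor_lift_scaleC b)
  have "(1 \<otimes>\<^sub>C \<epsilon>\<^sub>s x) * \<Delta> 1 = tensor_lift (\<lambda>a b. ?F a (\<Delta> b)) (\<Delta> 1)"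
    by (simp add: tensor_left_mult_eq source_mult)
  also have "\<dots> = tensor_lift (\<lambda>a b. tensor_lift (\<lambda>c d. ?F c (d \<otimes>\<^sub>C b)) (\<Delta> a)) (\<Delta> 1)"
    by (rule lift_coassociative[OF F])
  also have "\<dots> = tensor_lift (\<lambda>a b. \<Delta> (\<epsilon> (x * b) *\<^sub>C a)) (\<Delta> 1)"
    by (simp add: b tensor_lift_scaleC_fun linear_simps cbilinear_tensor_of tensor_lift_tensor_of_id)
  also have "\<dots> = \<Delta> (\<epsilon>\<^sub>s x)"
    unfolding source_eq by (simp add: tensor_lift_comp b comult_linear)
  finally show ?thesis ..
qed

text \<open>An equation in place of the range of a map: closure under the algebra operations becomes
  a computation with \<open>\<Delta> 1\<close>. For the converse, slicing the equation with
  \<open>\<epsilon>\<close> gives \<open>z = \<epsilon>\<^sub>s z\<close>.\<close>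

lemma source_cartan_iff: "z \<in> K\<^sub>s \<longleftrightarrow> \<Delta> z = (1 \<otimes>\<^sub>C z) * \<Delta> 1"
proof
  show "z \<in> K\<^sub>s \<Longrightarrow> \<Delta> z = (1 \<otimes>\<^sub>C z) * \<Delta> 1"
    unfolding source_cartan_def using comult_source by auto
  assume "\<Delta> z = (1 \<otimes>\<^sub>C z) * \<Delta> 1"
  then have "slice_right id \<epsilon> (\<Delta> z) = \<epsilon>\<^sub>s z"
    by (simp add: counital_source_def)
  then show "z \<in> K\<^sub>s"
    unfolding source_cartan_def counit_right by (metis rangeI)
qed

lemma source_mem: "\<epsilon>\<^sub>s x \<in> K\<^sub>s"
  by (simp add: source_cartan_def)

lemma source_id: "z \<in> K\<^sub>s \<Longrightarrow> \<epsilon>\<^sub>s z = z"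
  unfolding source_cartan_def using source_source by auto

lemma source_cartan_closed:
  shows "1 \<in> K\<^sub>s"
    and "z \<in> K\<^sub>s \<Longrightarrow> w \<in> K\<^sub>s \<Longrightarrow> z + w \<in> K\<^sub>s"
    and "z \<in> K\<^sub>s \<Longrightarrow> c *\<^sub>C z \<in> K\<^sub>s"
    and "z \<in> K\<^sub>s \<Longrightarrow> w \<in> K\<^sub>s \<Longrightarrow> z * w \<in> K\<^sub>s"
proof -
  show "1 \<in> K\<^sub>s"
    using source_one source_mem by metis
  show "z \<in> K\<^sub>s \<Longrightarrow> w \<in> K\<^sub>s \<Longrightarrow> z + w \<in> K\<^sub>s" "z \<in> K\<^sub>s \<Longrightarrow> c *\<^sub>C z \<in> K\<^sub>s"
    by (simp_all add: source_cartan_iff linear_simps)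
  assume z: "z \<in> K\<^sub>s" and w: "w \<in> K\<^sub>s"
  have "\<Delta> (z * w) = (1 \<otimes>\<^sub>C z) * (\<Delta> 1 * \<Delta> w)"
    using z by (simp add: comult_mult source_cartan_iff mult.assoc)
  also have "\<Delta> 1 * \<Delta> w = \<Delta> w"
    by (metis comult_mult mult.left_neutral)
  also have "(1 \<otimes>\<^sub>C z) * \<Delta> w = (1 \<otimes>\<^sub>C (z * w)) * \<Delta> 1"
    using w by (simp add: source_cartan_iff tensor_of_mult_tensor_of flip: mult.assoc)
  finally show "z * w \<in> K\<^sub>s"
    by (simp add: source_cartan_iff)
qed

lemma comult_one_star: "(\<Delta> 1)\<^sup>\<star> = \<Delta> 1"
  using comult_star[of 1] by (simp add: star_one)

text \<open>Starring the defining equation moves \<open>z\<^sup>\<star>\<close> to the right of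
  \<open>\<Delta> 1\<close>. Contracting with S(a) b then yields \<open>\<epsilon>\<^sub>s
  (z\<^sup>\<star>) = \<epsilon>\<^sub>s 1 * z\<^sup>\<star>\<close>.\<close>

lemma source_cartan_star:
  assumes "z \<in> K\<^sub>s"
  shows "z\<^sup>\<star> \<in> K\<^sub>s" and "\<Delta> (z\<^sup>\<star>) = \<Delta> 1 * (1 \<otimes>\<^sub>C z\<^sup>\<star>)"
proof -
  show *: "\<Delta> (z\<^sup>\<star>) = \<Delta> 1 * (1 \<otimes>\<^sub>C z\<^sup>\<star>)"
    using assms
    by (simp add: comult_star source_cartan_iff star_mult star_tensor_of comult_one_star star_one)
  have b: "cbilinear (\<lambda>a b. S a * b)"
    by (auto intro!: cbilinearI simp: linear_simps)
  have "\<epsilon>\<^sub>s (z\<^sup>\<star>) = tensor_lift (\<lambda>a b. S a * b) (\<Delta> 1 * (1 \<otimes>\<^sub>C z\<^sup>\<star>))"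
    by (simp add: antipode_source flip: *)
  also have "\<dots> = \<epsilon>\<^sub>s 1 * z\<^sup>\<star>"
    by (simp add: tensor_lift_mult_right b mult_tensor_lift_right mult.assoc flip: antipode_source)
  finally show "z\<^sup>\<star> \<in> K\<^sub>s"
    using source_mem[of "z\<^sup>\<star>"] by (simp add: source_one)
qed

lemma comult_source_right: "z \<in> K\<^sub>s \<Longrightarrow> \<Delta> z = \<Delta> 1 * (1 \<otimes>\<^sub>C z)"
  using source_cartan_star[of "z\<^sup>\<star>"] source_cartan_star(1)[of z] by (simp add: star_star)

lemma source_cartan_diff: "z \<in> K\<^sub>s \<Longrightarrow> w \<in> K\<^sub>s \<Longrightarrow> z - w \<in> K\<^sub>s"
  using source_cartan_closed(2)[of z "(-1) *\<^sub>C w"] source_cartan_closed(3)[of w "-1"]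
  by (simp add: complex_vector.scale_minus_left scaleC_one)

lemma source_cartan_zero: "0 \<in> K\<^sub>s"
  using source_cartan_closed(3)[OF source_cartan_closed(1), of 0] by simp

lemma target_cartan_iff: "w \<in> K\<^sub>t \<longleftrightarrow> S w \<in> K\<^sub>s"
proof
  show "w \<in> K\<^sub>t \<Longrightarrow> S w \<in> K\<^sub>s"
    unfolding target_cartan_def by (auto simp: source_mem simp flip: source_antipode)
  assume "S w \<in> K\<^sub>s"
  then have "S (\<epsilon>\<^sub>t w) = S w"
    using source_id source_antipode by metis
  then have "\<epsilon>\<^sub>t w = w"
    by (metis antipode_involutive)
  then show "w \<in> K\<^sub>t"
    unfolding target_cartan_def by (metis rangeI)
qed

lemma target_mem: "\<epsilon>\<^sub>t x \<in> K\<^sub>t"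
  by (simp add: target_cartan_def)

lemma target_id: "w \<in> K\<^sub>t \<Longrightarrow> \<epsilon>\<^sub>t w = w"
  by (metis antipode_involutive source_antipode source_id target_cartan_iff)

text \<open>The element \<open>S w\<close> lies in \<open>K\<^sub>s\<close>; applying the
  leg-reversing \<open>S\<close> to its right-handed coproduct formula moves it to the left of the
  first leg.\<close>

lemma comult_target:
  assumes "w \<in> K\<^sub>t"
  shows "\<Delta> w = (w \<otimes>\<^sub>C 1) * \<Delta> 1"
proof -
  define z where "z = S w"
  have z: "\<Delta> z = \<Delta> 1 * (1 \<otimes>\<^sub>C z)" and w: "w = S z"
    using assms by (simp_all add: z_def antipode_involutive comult_source_right target_cartan_iff)
  have b: "cbilinear (\<lambda>a b. S b \<otimes>\<^sub>C S a)"
    by (auto intro!: cbilinearI simp: linear_simps)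
  have \<Delta>S: "\<Delta> (S x) = tensor_lift (\<lambda>a b. S b \<otimes>\<^sub>C S a) (\<Delta> x)" for x
    using lift_comult_antipode[OF cbilinear_tensor_of, of x] by (simp add: tensor_lift_tensor_of_id)
  have "\<Delta> w = tensor_lift (\<lambda>a b. (w \<otimes>\<^sub>C 1) * (S b \<otimes>\<^sub>C S a)) (\<Delta> 1)"
    by (simp add: w \<Delta>S z tensor_lift_mult_right b antipode_antimult tensor_of_mult_tensor_of)
  also have "\<dots> = (w \<otimes>\<^sub>C 1) * \<Delta> (S 1)"
    unfolding \<Delta>S by (simp add: mult_tensor_lift_left b)
  finally show ?thesis by (simp add: antipode_one)
qed

text \<open>On (1 \<otimes> u) \<Delta>(1) the contraction a S(b) becomes 1_1 S(1_2) S(u).\<close>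

lemma target_source:
  assumes "u \<in> K\<^sub>s"
  shows "\<epsilon>\<^sub>t u = S u"
proof -
  have b: "cbilinear (\<lambda>a b. a * S b)"
    by (auto intro!: cbilinearI simp: linear_simps)
  have "\<epsilon>\<^sub>t u = tensor_lift (\<lambda>a b. a * S b) ((1 \<otimes>\<^sub>C u) * \<Delta> 1)"
    using assms by (simp add: source_cartan_iff flip: antipode_target)
  also have "\<dots> = \<epsilon>\<^sub>t 1 * S u"
    by (simp add: tensor_lift_mult_left b antipode_antimult mult_tensor_lift_right mult.assoc
        flip: antipode_target)
  finally show ?thesis by (simp add: target_one)
qed

end

section \<open>The Haar projection and the Haar trace\<close>

locale weak_kac_haar = weak_kac_algebra \<Delta> \<epsilon> S
  for \<Delta> :: "'a::cstar_algebra \<Rightarrow> ('a, 'a) tensor" and \<epsilon> S +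
  fixes \<tau> :: "'a \<Rightarrow> complex" and p :: 'a
  assumes haar_projection: "haar_projection \<Delta> \<epsilon> p"
    and haar_trace: "haar_trace \<Delta> \<epsilon> \<tau>"
begin

lemma comult_one_mult: "\<Delta> 1 * \<Delta> x = \<Delta> x" "\<Delta> x * \<Delta> 1 = \<Delta> x"
  by (simp_all flip: comult_mult)

abbreviation Es ("E\<^sub>s") where "E\<^sub>s \<equiv> source_expectation \<Delta> \<tau>"
abbreviation Et ("E\<^sub>t") where "E\<^sub>t \<equiv> target_expectation \<Delta> \<tau>"

lemma haar_proj:
  "p\<^sup>\<star> = p" "p * x = p * \<epsilon>\<^sub>s x" "x * p = \<epsilon>\<^sub>t x * p" "\<epsilon>\<^sub>s p = 1" "\<epsilon>\<^sub>t p = 1"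
  using haar_projection unfolding haar_projection_def by auto

lemma trace_positive: "positive_functional \<tau>"
  and trace_commute: "\<tau> (x * y) = \<tau> (y * x)"
  and trace_faithful: "\<tau> (x\<^sup>\<star> * x) = 0 \<Longrightarrow> x = 0"
  using haar_trace by (auto simp: haar_trace_def faithful_trace_def)

lemma trace_linear: "clinear \<tau>"
  using trace_positive by (simp add: positive_functional_def)

lemma trace_linear_maps: "\<tau> (x + y) = \<tau> x + \<tau> y" "\<tau> (c *\<^sub>C x) = c * \<tau> x"
  using trace_linear by (auto simp: clinear_iff)

lemma trace_diff: "\<tau> (x - y) = \<tau> x - \<tau> y"
  using trace_linear_maps(1)[of "x - y" y] by simp

lemmas lsimps = linear_simps counital_linear_maps trace_linear_maps

section \<open>The conditional expectations onto the Cartan subalgebras\<close>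

lemma Es_eq: "E\<^sub>s x = tensor_lift (\<lambda>a b. \<tau> a *\<^sub>C b) (\<Delta> x)"
  by (simp add: source_expectation_def slice_left_eq)

lemma Et_eq: "E\<^sub>t x = tensor_lift (\<lambda>a b. \<tau> b *\<^sub>C a) (\<Delta> x)"
  by (simp add: target_expectation_def slice_right_eq)

lemma bil_Es: "cbilinear (\<lambda>a b. \<tau> a *\<^sub>C b)"
  by (auto intro!: cbilinearI simp: lsimps mult.commute)

lemma bil_Et: "cbilinear (\<lambda>a b. \<tau> b *\<^sub>C a)"
  by (auto intro!: cbilinearI simp: lsimps mult.commute)

lemma Es_linear: "clinear E\<^sub>s"
  by (rule clinearI) (simp_all add: Es_eq lsimps tensor_lift_add tensor_lift_scaleC bil_Es)

lemma Es_linear_maps: "E\<^sub>s (x + y) = E\<^sub>s x + E\<^sub>s y" "E\<^sub>s (c *\<^sub>C x) = c *\<^sub>C E\<^sub>s x"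
  using Es_linear by (auto simp: clinear_iff)

text \<open>Invariance of the Haar trace says exactly that \<open>\<epsilon>\<^sub>s\<close> fixes
  the values of \<open>E\<^sub>s\<close>.\<close>

lemma Es_mem: "E\<^sub>s x \<in> K\<^sub>s"
proof -
  have "E\<^sub>s x = tensor_lift (\<lambda>a b. \<epsilon>\<^sub>s (\<tau> a *\<^sub>C b)) (\<Delta> x)"
    using haar_trace
    by (simp add: haar_trace_def source_expectation_def slice_left_def lsimps)
  also have "\<dots> = \<epsilon>\<^sub>s (E\<^sub>s x)"
    unfolding Es_eq by (rule tensor_lift_comp[symmetric]) (simp_all add: bil_Es source_linear)
  finally show ?thesis using source_mem by metis
qed

lemma trace_source: "z \<in> K\<^sub>s \<Longrightarrow> \<tau> z = \<epsilon> z"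
  using haar_trace source_id counit_source unfolding haar_trace_def by metis

lemma trace_target: "z \<in> K\<^sub>t \<Longrightarrow> \<tau> z = \<epsilon> z"
  using haar_trace target_id unfolding haar_trace_def by metis

text \<open>On \<open>K\<^sub>s\<close> the trace is the counit, which turns \<tau>(x_1) x_2 into
  \<tau>(x_1 \<epsilon>(x_2)).\<close>

lemma trace_Es: "\<tau> (E\<^sub>s x) = \<tau> x"
proof -
  have "\<tau> (E\<^sub>s x) = \<epsilon> (E\<^sub>s x)"
    by (simp add: trace_source Es_mem)
  also have "\<dots> = tensor_lift (\<lambda>a b. \<tau> (\<epsilon> b *\<^sub>C a)) (\<Delta> x)"
    unfolding Es_eq
    by (subst tensor_lift_comp) (simp_all add: bil_Es counit_linear lsimps mult.commute)
  also have "\<dots> = \<tau> (tensor_lift (\<lambda>a b. \<epsilon> b *\<^sub>C a) (\<Delta> x))"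
    by (subst tensor_lift_comp)
      (auto intro!: cbilinearI simp: lsimps trace_linear mult.commute)
  finally show ?thesis by (simp add: counit_right')
qed

lemma Es_mult_right:
  assumes "z \<in> K\<^sub>s"
  shows "E\<^sub>s (x * z) = E\<^sub>s x * z"
proof -
  have "\<Delta> (x * z) = \<Delta> x * (1 \<otimes>\<^sub>C z)"
    unfolding comult_mult comult_source_right[OF assms] by (simp add: comult_one_mult flip: mult.assoc)
  then show ?thesis
    unfolding Es_eq
    by (simp add: tensor_lift_mult_right mult_tensor_lift_right bil_Es mult_scaleC_left)
qed

lemma Es_mult_left:
  assumes "z \<in> K\<^sub>s"
  shows "E\<^sub>s (z * x) = z * E\<^sub>s x"
proof -
  have "\<Delta> z = (1 \<otimes>\<^sub>C z) * \<Delta> 1"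
    using assms by (simp add: source_cartan_iff)
  then have "\<Delta> (z * x) = (1 \<otimes>\<^sub>C z) * \<Delta> x"
    by (simp add: comult_mult mult.assoc comult_one_mult)
  then show ?thesis
    unfolding Es_eq
    by (simp add: tensor_lift_mult_left mult_tensor_lift_left bil_Es mult_scaleC_right)
qed

lemma Es_star: "E\<^sub>s (x\<^sup>\<star>) = (E\<^sub>s x)\<^sup>\<star>"
proof -
  have "(E\<^sub>s x)\<^sup>\<star> = (tensor_lift (\<lambda>a b. \<tau> a *\<^sub>C b) ((\<Delta> (x\<^sup>\<star>))\<^sup>\<star>))\<^sup>\<star>"
    by (simp add: Es_eq comult_star star_star)
  also have "\<dots> = tensor_lift (\<lambda>a b. \<tau> a *\<^sub>C b) (\<Delta> (x\<^sup>\<star>))"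
    unfolding tensor_lift_star[OF bil_Es, symmetric]
    by (simp add: star_scaleC star_star positive_functional_star[OF trace_positive])
  finally show ?thesis by (simp add: Es_eq)
qed

text \<open>Uniqueness of the Haar trace, applied to \<open>\<tau>\<close> and \<open>\<tau> \<circ> S\<close>: evaluate
  \<open>(\<tau> \<otimes> \<tau> \<circ> S) \<Delta>\<close> one leg at a time.\<close>

lemma trace_antipode: "\<tau> (S x) = \<tau> x"
proof -
  have b: "cbilinear (\<lambda>a b. \<tau> (S b) *\<^sub>C a)"
    by (auto intro!: cbilinearI simp: lsimps mult.commute)
  have lin: "clinear (\<lambda>x. \<tau> (S x))"
    by (rule clinearI) (simp_all add: lsimps)
  let ?E = "\<lambda>x. tensor_lift (\<lambda>a b. \<tau> (S b) *\<^sub>C a) (\<Delta> x)"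
  \<comment> \<open>\<open>?E\<close> is \<open>E\<^sub>s\<close> conjugated by \<open>S\<close>, so
    its values lie in \<open>K\<^sub>t\<close>, where \<open>\<tau>\<close> is the counit. This
    evaluates one leg and gives \<open>\<tau> (S x)\<close>.\<close>
  have E: "S (?E x) = E\<^sub>s (S x)"
    unfolding Es_eq lift_comult_antipode[OF bil_Es]
    by (subst tensor_lift_comp) (simp_all add: b antipode_linear lsimps)
  then have "?E x \<in> K\<^sub>t"
    by (simp add: target_cartan_iff Es_mem)
  then have "\<tau> (?E x) = \<epsilon> (?E x)"
    by (rule trace_target)
  also have "\<dots> = tensor_lift (\<lambda>a b. \<tau> (S (\<epsilon> a *\<^sub>C b))) (\<Delta> x)"
    by (subst tensor_lift_comp) (simp_all add: b counit_linear lsimps mult.commute)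
  also have "\<dots> = \<tau> (S (tensor_lift (\<lambda>a b. \<epsilon> a *\<^sub>C b) (\<Delta> x)))"
    by (subst tensor_lift_comp[of _ "\<lambda>x. \<tau> (S x)"])
      (auto intro!: cbilinearI clinearI simp: lsimps mult.commute)
  finally have 1: "\<tau> (?E x) = \<tau> (S x)"
    by (simp add: counit_left')
  \<comment> \<open>Evaluating the other leg first leaves \<open>\<tau> \<circ> S\<close> on a value
    of \<open>E\<^sub>s\<close>, where it is again the counit.\<close>
  have "\<tau> (?E x) = tensor_lift (\<lambda>a b. \<tau> (S (\<tau> a *\<^sub>C b))) (\<Delta> x)"
    by (subst tensor_lift_comp) (simp_all add: b trace_linear lsimps mult.commute)
  also have "\<dots> = \<tau> (S (E\<^sub>s x))"
    unfolding Es_eq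
    by (subst tensor_lift_comp[of _ "\<lambda>x. \<tau> (S x)"]) (simp_all add: bil_Es lin)
  also have "\<dots> = \<epsilon> (S (E\<^sub>s x))"
    by (rule trace_target) (simp add: target_cartan_iff antipode_involutive Es_mem)
  also have "\<dots> = \<tau> x"
    by (simp add: counit_antipode trace_Es flip: trace_source[OF Es_mem])
  finally show ?thesis using 1 by simp
qed

lemma Et_antipode: "E\<^sub>t (S x) = S (E\<^sub>s x)"
proof -
  have "E\<^sub>t (S x) = tensor_lift (\<lambda>a b. \<tau> a *\<^sub>C S b) (\<Delta> x)"
    unfolding Et_eq lift_comult_antipode[OF bil_Et] by (simp add: trace_antipode)
  also have "\<dots> = S (E\<^sub>s x)"
    unfolding Es_eq by (subst tensor_lift_comp) (simp_all add: bil_Es antipode_linear lsimps)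
  finally show ?thesis .
qed

section \<open>Invariance of the Haar projection and the dual basis of K\<close>

lemma haar_antipode: "S p = p"
proof -
  \<comment> \<open>The product \<open>p * S p\<close> equals both \<open>S p\<close> and
    \<open>p\<close>: absorption by \<open>p\<close>, used directly and after applying
    \<open>S\<close>, replaces one factor by a counital value equal to 1.\<close>
  have "S p = \<epsilon>\<^sub>t p * S p"
    by (simp add: haar_proj)
  also have "\<dots> = p * S p"
    by (metis antipode_antimult antipode_involutive haar_proj(2) source_antipode)
  also have "\<dots> = p * \<epsilon>\<^sub>s (S p)"
    by (rule haar_proj)
  finally show ?thesis
    by (simp add: source_antipode haar_proj antipode_one)
qed

text \<open>Since (1 \<otimes> x) \<Delta>(1) = (S(x_1) \<otimes> 1) \<Delta>(x_2), multiplying by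
  \<Delta>(p) produces \<Delta>(x_2 p), where \<open>p\<close> absorbs x_2 into \<epsilon>_t(x_2).
  The remaining S(x_1) \<epsilon>_t(x_2) is S(x) S(1_1) 1_2 = S(x).\<close>

lemma haar_shift: "(1 \<otimes>\<^sub>C x) * \<Delta> p = (S x \<otimes>\<^sub>C 1) * \<Delta> p"
proof -
  have F: "cbilinear (\<lambda>a t. (S a \<otimes>\<^sub>C 1) * (t :: ('a, 'a) tensor))"
    by (auto intro!: cbilinearI simp: lsimps)
  have b: "cbilinear (\<lambda>c d. (S c * d) \<otimes>\<^sub>C y)" for y :: 'a
    by (auto intro!: cbilinearI simp: lsimps)
  have b': "cbilinear (\<lambda>c d. S c * d)"
    by (auto intro!: cbilinearI simp: lsimps)
  have b'': "cbilinear (\<lambda>a b. ((S a * b) \<otimes>\<^sub>C 1) * \<Delta> p)"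
    by (auto intro!: cbilinearI simp: lsimps)
  have inner: "tensor_lift (\<lambda>c d. (S c * d) \<otimes>\<^sub>C y) t = tensor_lift (\<lambda>c d. S c * d) t \<otimes>\<^sub>C y" for y t
    by (rule tensor_lift_comp[symmetric, of _ "\<lambda>x. x \<otimes>\<^sub>C y"])
      (auto intro!: clinearI simp: b' lsimps)
  have "(1 \<otimes>\<^sub>C x) * \<Delta> 1 = tensor_lift (\<lambda>a b. \<epsilon>\<^sub>s a \<otimes>\<^sub>C b) (\<Delta> x)"
    by (simp add: lift_source_comult[OF cbilinear_tensor_of] tensor_left_mult_eq)
  also have "\<dots> = tensor_lift (\<lambda>a b. (S a \<otimes>\<^sub>C 1) * \<Delta> b) (\<Delta> x)"
    using lift_coassociative[OF F, of x] by (simp add: tensor_of_mult_tensor_of inner antipode_source)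
  finally have 1: "(1 \<otimes>\<^sub>C x) * \<Delta> 1 = tensor_lift (\<lambda>a b. (S a \<otimes>\<^sub>C 1) * \<Delta> b) (\<Delta> x)" .
  have p: "\<Delta> (b * p) = (\<epsilon>\<^sub>t b \<otimes>\<^sub>C 1) * \<Delta> p" for b
  proof -
    have "\<Delta> (b * p) = (\<epsilon>\<^sub>t b \<otimes>\<^sub>C 1) * \<Delta> 1 * \<Delta> p"
      by (subst haar_proj) (simp add: comult_mult comult_target target_mem)
    then show ?thesis
      by (simp add: mult.assoc comult_one_mult)
  qed
  have "(1 \<otimes>\<^sub>C x) * \<Delta> p = (1 \<otimes>\<^sub>C x) * \<Delta> 1 * \<Delta> p"
    by (simp add: mult.assoc comult_one_mult)
  also have "\<dots> = tensor_lift (\<lambda>a b. (S a \<otimes>\<^sub>C 1) * \<Delta> (b * p)) (\<Delta> x)"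
    unfolding 1
    by (subst mult_tensor_lift_right)
      (auto intro!: cbilinearI simp: lsimps comult_mult mult.assoc)
  also have "\<dots> = tensor_lift (\<lambda>a b. ((S a * \<epsilon>\<^sub>t b) \<otimes>\<^sub>C 1) * \<Delta> p) (\<Delta> x)"
    unfolding p by (simp add: tensor_of_mult_tensor_of flip: mult.assoc)
  also have "\<dots> = tensor_lift (\<lambda>a b. ((S x * (S a * b)) \<otimes>\<^sub>C 1) * \<Delta> p) (\<Delta> 1)"
    by (simp add: lift_target_comult[OF b''] antipode_antimult mult.assoc)
  also have "\<dots> = ((S x * tensor_lift (\<lambda>a b. S a * b) (\<Delta> 1)) \<otimes>\<^sub>C 1) * \<Delta> p"
    by (rule tensor_lift_comp[symmetric, of _ "\<lambda>y. ((S x * y) \<otimes>\<^sub>C 1) * \<Delta> p"])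
      (auto intro!: clinearI simp: b' lsimps)
  finally show ?thesis
    by (simp add: antipode_source source_one)
qed

lemma haar_shift_right: "\<Delta> p * (1 \<otimes>\<^sub>C x) = \<Delta> p * (S x \<otimes>\<^sub>C 1)"
proof -
  have "((1 \<otimes>\<^sub>C x\<^sup>\<star>) * \<Delta> p)\<^sup>\<star> = ((S (x\<^sup>\<star>) \<otimes>\<^sub>C 1) * \<Delta> p)\<^sup>\<star>"
    by (simp add: haar_shift)
  then show ?thesis
    by (simp add: star_mult star_tensor_of star_star star_one antipode_star haar_proj flip: comult_star)
qed

text \<open>Shifting \<open>x\<close> from the second leg to the first as \<open>S x\<close>, and
  applying \<open>S\<close> there, releases \<open>x\<close> on one side of the sum. Thus
  \<open>\<Delta> p\<close> holds a dual basis for \<open>\<tau>\<close>, up to the factor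
  \<open>E\<^sub>s p\<close>.\<close>

lemma haar_frobenius:
  "tensor_lift (\<lambda>a b. \<tau> (b * x) *\<^sub>C S a) (\<Delta> p) = x * E\<^sub>s p"
  "tensor_lift (\<lambda>a b. \<tau> (x * b) *\<^sub>C S a) (\<Delta> p) = E\<^sub>s p * x"
proof -
  have b: "cbilinear (\<lambda>a b. \<tau> b *\<^sub>C S a)"
    by (auto intro!: cbilinearI simp: lsimps mult.commute)
  \<comment> \<open>The invariances \<open>S p = p\<close> and
    \<open>\<tau> \<circ> S = \<tau>\<close> turn this sum into \<open>E\<^sub>s p\<close>.\<close>
  have h: "tensor_lift (\<lambda>a b. \<tau> b *\<^sub>C S a) (\<Delta> p) = E\<^sub>s p"
  proof -
    have "tensor_lift (\<lambda>a b. \<tau> b *\<^sub>C S a) (\<Delta> p) = tensor_lift (\<lambda>a b. \<tau> a *\<^sub>C b) (\<Delta> (S p))"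
      by (simp add: lift_comult_antipode[OF bil_Es] trace_antipode)
    then show ?thesis by (simp add: haar_antipode Es_eq)
  qed
  have "tensor_lift (\<lambda>a b. \<tau> (b * x) *\<^sub>C S a) (\<Delta> p) = tensor_lift (\<lambda>a b. \<tau> b *\<^sub>C S a) (\<Delta> p * (1 \<otimes>\<^sub>C x))"
    by (simp add: tensor_lift_mult_right b)
  also have "\<dots> = tensor_lift (\<lambda>a b. x * (\<tau> b *\<^sub>C S a)) (\<Delta> p)"
    unfolding haar_shift_right
    by (simp add: tensor_lift_mult_right b antipode_antimult antipode_involutive mult_scaleC_right)
  also have "\<dots> = x * E\<^sub>s p"
    by (simp add: b h flip: mult_tensor_lift_left)
  finally show "tensor_lift (\<lambda>a b. \<tau> (b * x) *\<^sub>C S a) (\<Delta> p) = x * E\<^sub>s p" .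
  have "tensor_lift (\<lambda>a b. \<tau> (x * b) *\<^sub>C S a) (\<Delta> p) = tensor_lift (\<lambda>a b. \<tau> b *\<^sub>C S a) ((1 \<otimes>\<^sub>C x) * \<Delta> p)"
    by (simp add: tensor_lift_mult_left b)
  also have "\<dots> = tensor_lift (\<lambda>a b. (\<tau> b *\<^sub>C S a) * x) (\<Delta> p)"
    unfolding haar_shift
    by (simp add: tensor_lift_mult_left b antipode_antimult antipode_involutive mult_scaleC_left)
  also have "\<dots> = E\<^sub>s p * x"
    by (simp add: b h flip: mult_tensor_lift_right)
  finally show "tensor_lift (\<lambda>a b. \<tau> (x * b) *\<^sub>C S a) (\<Delta> p) = E\<^sub>s p * x" .
qed

lemma Es_haar_central: "x * E\<^sub>s p = E\<^sub>s p * x"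
  using haar_frobenius[of x] by (simp add: trace_commute)

lemma regular_trace_density: "regular_trace (x * E\<^sub>s p) = \<tau> x"
proof -
  have b: "cbilinear (\<lambda>a b. \<tau> (b * y) *\<^sub>C S a)" for y
    by (auto intro!: cbilinearI simp: lsimps mult.commute)
  have b': "cbilinear (\<lambda>a b. S a * b)"
    by (auto intro!: cbilinearI simp: lsimps)
  \<comment> \<open>Centrality moves \<open>E\<^sub>s p\<close> past \<open>y\<close>, so that the
    dual basis can expand \<open>y * E\<^sub>s p\<close>.\<close>
  have "x * E\<^sub>s p * y = tensor_lift (\<lambda>a b. \<tau> (b * y) *\<^sub>C (x * S a)) (\<Delta> p)" for y
  proof -
    have "x * E\<^sub>s p * y = x * (y * E\<^sub>s p)"
      by (simp only: mult.assoc Es_haar_central[of y])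
    then show ?thesis
      by (simp add: mult_tensor_lift_left b mult_scaleC_right flip: haar_frobenius(1))
  qed
  then have "regular_trace (x * E\<^sub>s p) = ctrace (\<lambda>y. tensor_lift (\<lambda>a b. \<tau> (b * y) *\<^sub>C (x * S a)) (\<Delta> p))"
    by (simp add: regular_trace_def)
  also have "\<dots> = tensor_lift (\<lambda>a b. \<tau> (b * (x * S a))) (\<Delta> p)"
    by (rule ctrace_tensor_lift[OF finite_dimensional])
      (auto intro!: cbilinearI clinearI simp: lsimps)
  \<comment> \<open>Cyclicity brings \<open>S a\<close> next to \<open>b\<close>, where
    \<open>antipode_source\<close> contracts them to
    \<open>\<epsilon>\<^sub>s p = 1\<close>.\<close>
  also have "\<dots> = tensor_lift (\<lambda>a b. \<tau> (x * (S a * b))) (\<Delta> p)"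
    by (simp only: trace_commute[of _ "x * _"] mult.assoc)
  also have "\<dots> = \<tau> (x * tensor_lift (\<lambda>a b. S a * b) (\<Delta> p))"
    by (rule tensor_lift_comp[symmetric, of _ "\<lambda>y. \<tau> (x * y)"])
      (auto intro!: clinearI simp: b' lsimps)
  finally show ?thesis
    by (simp add: antipode_source haar_proj)
qed

section \<open>The Markov condition as a comparison of traces\<close>

lemma regular_trace_linear: "clinear (regular_trace :: 'a \<Rightarrow> complex)"
proof (rule clinearI)
  fix x y :: 'a and c
  have lin: "clinear ((*) z)" for z :: 'a
    by (auto intro!: clinearI simp: lsimps)
  show "regular_trace (x + y) = regular_trace x + regular_trace y"
    by (simp add: regular_trace_def lsimps ctrace_add[OF finite_dimensional] lin)
  show "regular_trace (c *\<^sub>C x) = c *\<^sub>C regular_trace x"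
    by (simp add: regular_trace_def lsimps ctrace_scaleC[OF finite_dimensional] lin)
qed

text \<open>The target equation is the image of the source equation under \<open>S\<close>, because
  \<open>S p = p\<close>.\<close>

lemma markov_iff: "markov_condition \<Delta> \<tau> p l \<longleftrightarrow> E\<^sub>s p = complex_of_real l *\<^sub>C 1"
  using Et_antipode[of p] by (auto simp: markov_condition_def haar_antipode linear_maps antipode_one)

lemma markov_trace:
  assumes "markov_condition \<Delta> \<tau> p l"
  shows "\<tau> x = complex_of_real l * regular_trace x"
proof -
  have "\<tau> x = regular_trace (complex_of_real l *\<^sub>C x)"
    using assms regular_trace_density[of x] by (simp add: markov_iff mult_scaleC_right)
  then show ?thesis
    using regular_trace_linear by (simp add: clinear_iff)
qed

lemma trace_eq_zero: "z \<in> K\<^sub>s \<Longrightarrow> (\<And>x. x \<in> K\<^sub>s \<Longrightarrow> \<tau> (x * z) = 0) \<Longrightarrow> z = 0"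
  using source_cartan_star trace_faithful by blast

lemma markov_iff_source:
  "markov_condition \<Delta> \<tau> p l \<longleftrightarrow> (\<forall>x\<in>K\<^sub>s. \<tau> x = complex_of_real l * regular_trace x)"
proof
  assume "markov_condition \<Delta> \<tau> p l"
  then show "\<forall>x\<in>K\<^sub>s. \<tau> x = complex_of_real l * regular_trace x"
    by (simp add: markov_trace)
next
  assume l: "\<forall>x\<in>K\<^sub>s. \<tau> x = complex_of_real l * regular_trace x"
  let ?z = "E\<^sub>s p - complex_of_real l *\<^sub>C 1"
  have z: "?z \<in> K\<^sub>s"
    by (intro source_cartan_diff Es_mem source_cartan_closed)
  \<comment> \<open>The product \<open>x * E\<^sub>s p\<close> stays in \<open>K\<^sub>s\<close>, so
    the hypothesis applies to it, and the density formula turns its regular trace into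
    \<open>\<tau> x\<close>. Faithfulness then forces \<open>?z = 0\<close>.\<close>
  have "\<tau> (x * ?z) = 0" if x: "x \<in> K\<^sub>s" for x
  proof -
    have "\<tau> (x * E\<^sub>s p) = complex_of_real l * regular_trace (x * E\<^sub>s p)"
      using l x by (simp add: source_cartan_closed Es_mem)
    then show ?thesis
      by (simp add: regular_trace_density right_diff_distrib mult_scaleC_right trace_diff trace_linear_maps)
  qed
  then have "?z = 0"
    using trace_eq_zero z by blast
  then show "markov_condition \<Delta> \<tau> p l"
    by (simp add: markov_iff)
qed

lemma markov_iff_regular:
  "markov_condition \<Delta> \<tau> p l \<longleftrightarrow> (\<forall>x. \<tau> x = complex_of_real l * regular_trace x)"
proof
  assume "markov_condition \<Delta> \<tau> p l"
  then show "\<forall>x. \<tau> x = complex_of_real l * regular_trace x"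
    by (simp add: markov_trace)
qed (simp add: markov_iff_source)

section \<open>The dual basis of the source algebra and its regular trace\<close>

lemma source_frobenius:
  assumes z: "z \<in> K\<^sub>s"
  shows "tensor_lift (\<lambda>a b. \<tau> (z * S b) *\<^sub>C \<epsilon>\<^sub>s a) (\<Delta> 1) = z"
proof -
  \<comment> \<open>Here \<open>w\<close> is \<open>\<epsilon>\<^sub>t (S w)\<close>, so to the
    right of \<open>z\<close> the counit does not distinguish \<open>w\<close> from
    \<open>S w\<close>.\<close>
  have c: "\<epsilon> (z * w) = \<tau> (z * S w)" if w: "w \<in> K\<^sub>t" for w
  proof -
    have Sw: "S w \<in> K\<^sub>s"
      using w by (simp add: target_cartan_iff)
    then have "w = \<epsilon>\<^sub>t (S w)"
      by (simp add: target_source antipode_involutive)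
    then have "\<epsilon> (z * w) = \<epsilon> (z * S w)"
      using counit_target_mult by metis
    then show ?thesis
      by (simp add: trace_source source_cartan_closed z Sw)
  qed
  have b: "cbilinear (\<lambda>a b. \<epsilon> (z * b) *\<^sub>C a)" "cbilinear (\<lambda>a b. \<tau> (z * S b) *\<^sub>C a)"
    "cbilinear (\<lambda>a b. \<tau> (z * S b) *\<^sub>C \<epsilon>\<^sub>s a)"
    by (auto intro!: cbilinearI simp: lsimps mult.commute)
  have "z = tensor_lift (\<lambda>a b. \<epsilon> (z * b) *\<^sub>C a) (\<Delta> 1)"
    using source_id[OF z] by (simp add: source_eq)
  \<comment> \<open>Inserting \<open>\<epsilon>\<^sub>t\<close> into the second leg of
    \<open>\<Delta> 1\<close> changes nothing and puts that leg in \<open>K\<^sub>t\<close>, where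
    \<open>c\<close> applies. The map \<open>\<epsilon>\<^sub>s\<close> enters the first leg in the
    same way.\<close>
  also have "\<dots> = tensor_lift (\<lambda>a b. \<tau> (z * S (\<epsilon>\<^sub>t b)) *\<^sub>C a) (\<Delta> 1)"
    using lift_target_comult[OF b(1), of 1] by (simp add: c target_mem)
  also have "\<dots> = tensor_lift (\<lambda>a b. \<tau> (z * S b) *\<^sub>C a) (\<Delta> 1)"
    using lift_target_comult[OF b(2), of 1] by simp
  also have "\<dots> = tensor_lift (\<lambda>a b. \<tau> (z * S b) *\<^sub>C \<epsilon>\<^sub>s a) (\<Delta> 1)"
    using lift_source_comult[OF b(2), of 1] by simp
  finally show ?thesis ..
qed

lemma lift_source_antipode_one: "tensor_lift (\<lambda>a b. \<epsilon>\<^sub>s a * S b) (\<Delta> 1) = 1"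
proof -
  have b: "cbilinear (\<lambda>a b. a * S b)"
    by (auto intro!: cbilinearI simp: lsimps)
  have "tensor_lift (\<lambda>a b. \<epsilon>\<^sub>s a * S b) (\<Delta> 1) = tensor_lift (\<lambda>a b. a * S b) (\<Delta> 1)"
    using lift_source_comult[OF b, of 1] by simp
  then show ?thesis by (simp add: antipode_target target_one)
qed

lemma lift_antipode_source_one: "tensor_lift (\<lambda>a b. S b * \<epsilon>\<^sub>s a) (\<Delta> 1) = 1"
proof -
  have b: "cbilinear (\<lambda>a b. S b * a)" "cbilinear (\<lambda>a b. S a * b)"
    by (auto intro!: cbilinearI simp: lsimps)
  have "tensor_lift (\<lambda>a b. S b * \<epsilon>\<^sub>s a) (\<Delta> 1) = tensor_lift (\<lambda>a b. S b * a) (\<Delta> 1)"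
    using lift_source_comult[OF b(1), of 1] by simp
  also have "\<dots> = tensor_lift (\<lambda>a b. S (S a * b)) (\<Delta> 1)"
    by (simp add: antipode_antimult antipode_involutive)
  also have "\<dots> = S (tensor_lift (\<lambda>a b. S a * b) (\<Delta> 1))"
    by (rule tensor_lift_comp[symmetric]) (simp_all add: b antipode_linear)
  finally show ?thesis by (simp add: antipode_source source_one antipode_one)
qed

text \<open>\<open>K\<^sub>s\<close> is only a subset of the type, so the trace of left
  multiplication by \<open>x\<close> on it is written as a coordinate sum. The coordinates are
  linear on \<open>K\<^sub>s\<close>, hence the composition with \<open>\<epsilon>\<^sub>s\<close>.
  Expanding each \<open>x * e j\<close> in the dual basis and summing over j leaves \<tau>(x
  \<epsilon>_s(1_1) S(1_2)).\<close>

lemma source_regular_trace: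
  assumes J: "finite J" "\<And>j. j \<in> J \<Longrightarrow> e j \<in> K\<^sub>s" "\<And>j. j \<in> J \<Longrightarrow> clinear (\<lambda>x. f j (\<epsilon>\<^sub>s x))"
    and basis: "\<And>z. z \<in> K\<^sub>s \<Longrightarrow> (\<Sum>j\<in>J. f j z *\<^sub>C e j) = z"
    and x: "x \<in> K\<^sub>s"
  shows "(\<Sum>j\<in>J. f j (x * e j)) = \<tau> x"
proof -
  have f: "f j (\<epsilon>\<^sub>s x + \<epsilon>\<^sub>s y) = f j (\<epsilon>\<^sub>s x) + f j (\<epsilon>\<^sub>s y)" "f j (c *\<^sub>C \<epsilon>\<^sub>s x) = c * f j (\<epsilon>\<^sub>s x)"
    if "j \<in> J" for j x y c
    using J(3)[OF that] by (simp_all add: clinear_iff counital_linear_maps)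
  have b: "cbilinear (\<lambda>a b. \<tau> (z * S b) *\<^sub>C \<epsilon>\<^sub>s a)" for z
    by (auto intro!: cbilinearI simp: lsimps mult.commute)
  have b': "cbilinear (\<lambda>a b. \<epsilon>\<^sub>s a * S b)"
    by (auto intro!: cbilinearI simp: lsimps)
  have "f j (x * e j) = tensor_lift (\<lambda>a b. \<tau> (x * e j * S b) * f j (\<epsilon>\<^sub>s a)) (\<Delta> 1)" if j: "j \<in> J" for j
  proof -
    have z: "x * e j \<in> K\<^sub>s"
      using x J(2)[OF j] by (rule source_cartan_closed)
    have "f j (x * e j) = f j (\<epsilon>\<^sub>s (tensor_lift (\<lambda>a b. \<tau> (x * e j * S b) *\<^sub>C \<epsilon>\<^sub>s a) (\<Delta> 1)))"
      by (simp add: source_frobenius z source_id)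
    also have "\<dots> = tensor_lift (\<lambda>a b. f j (\<epsilon>\<^sub>s (\<tau> (x * e j * S b) *\<^sub>C \<epsilon>\<^sub>s a))) (\<Delta> 1)"
      by (rule tensor_lift_comp[of _ "\<lambda>y. f j (\<epsilon>\<^sub>s y)"]) (simp_all add: b J(3) j)
    finally show ?thesis by (simp add: f j source_source counital_linear_maps)
  qed
  then have "(\<Sum>j\<in>J. f j (x * e j))
      = tensor_lift (\<lambda>a b. \<Sum>j\<in>J. \<tau> (x * e j * S b) * f j (\<epsilon>\<^sub>s a)) (\<Delta> 1)"
    by (simp, subst tensor_lift_sum) (auto intro!: cbilinearI simp: lsimps f mult.commute)
  also have "\<dots> = tensor_lift (\<lambda>a b. \<tau> (x * (\<Sum>j\<in>J. f j (\<epsilon>\<^sub>s a) *\<^sub>C e j) * S b)) (\<Delta> 1)"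
    by (simp add: sum_distrib_left sum_distrib_right clinear_sum[OF trace_linear] lsimps mult.commute)
  also have "\<dots> = tensor_lift (\<lambda>a b. \<tau> (x * (\<epsilon>\<^sub>s a * S b))) (\<Delta> 1)"
    by (simp add: basis source_mem mult.assoc)
  also have "\<dots> = \<tau> (x * tensor_lift (\<lambda>a b. \<epsilon>\<^sub>s a * S b) (\<Delta> 1))"
    by (rule tensor_lift_comp[symmetric, of _ "\<lambda>y. \<tau> (x * y)"])
      (auto intro!: clinearI simp: b' lsimps)
  finally show ?thesis by (simp add: lift_source_antipode_one)
qed

section \<open>Bases for the conditional expectations\<close>

lemma expectation_basis_sum:
  assumes "expectation_basis A E I u"
  shows "(\<Sum>i\<in>I. u i * E ((u i)\<^sup>\<star> * b)) = b"
  using assms unfolding expectation_basis_def by (metis (no_types))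

lemma expectation_basis_independent:
  assumes "expectation_basis A E I u" "\<forall>i\<in>I. a i \<in> A" "(\<Sum>i\<in>I. u i * a i) = 0" "i \<in> I"
  shows "a i = 0"
proof -
  have "(\<forall>i\<in>I. a i \<in> A) \<and> (\<Sum>i\<in>I. u i * a i) = 0 \<longrightarrow> (\<forall>i\<in>I. a i = 0)"
    using assms(1) unfolding expectation_basis_def by (elim conjE) (erule spec)
  with assms show ?thesis by blast
qed

text \<open>The expansion of \<open>u j\<close> through \<open>E\<^sub>s\<close> and the trivial one
  both have coefficients in \<open>K\<^sub>s\<close>, so independence identifies them.\<close>

lemma expectation_basis_orthonormal:
  assumes u: "expectation_basis K\<^sub>s E\<^sub>s I u" and ij: "i \<in> I" "j \<in> I"
  shows "E\<^sub>s ((u i)\<^sup>\<star> * u j) = (if i = j then 1 else 0)"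
proof -
  let ?a = "\<lambda>i. E\<^sub>s ((u i)\<^sup>\<star> * u j) - (if i = j then 1 else 0)"
  have I: "finite I"
    using u by (simp add: expectation_basis_def)
  have "(\<Sum>i\<in>I. u i * E\<^sub>s ((u i)\<^sup>\<star> * u j)) = u j"
    by (rule expectation_basis_sum[OF u])
  moreover have "(\<Sum>i\<in>I. u i * (if i = j then 1 else 0)) = u j"
    using I ij by (simp add: if_distrib sum.delta cong: if_cong)
  ultimately have "(\<Sum>i\<in>I. u i * ?a i) = 0"
    by (simp add: right_diff_distrib sum_subtractf)
  moreover have "\<forall>i\<in>I. ?a i \<in> K\<^sub>s"
    by (auto intro!: source_cartan_diff Es_mem source_cartan_closed source_cartan_zero)
  ultimately have "?a i = 0"
    using expectation_basis_independent[OF u, of ?a i] ij by blast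
  then show ?thesis by simp
qed

text \<open>The basis gives \<open>y\<close> coordinates in \<open>K\<^sub>s\<close>, and the dual
  basis of \<open>K\<^sub>s\<close> turns these into scalars. Right multiplication becomes a sum of
  rank-one operators in which each index i contributes \<open>\<tau> z\<close>.\<close>

lemma right_trace_basis:
  assumes u: "expectation_basis K\<^sub>s E\<^sub>s I u" and z: "z \<in> K\<^sub>s"
  shows "ctrace (\<lambda>y. y * z) = of_nat (card I) * \<tau> z"
proof -
  have I: "finite I"
    using u by (simp add: expectation_basis_def)
  have b: "cbilinear (\<lambda>a b. \<tau> (w * S b) *\<^sub>C \<epsilon>\<^sub>s a)" for w
    by (auto intro!: cbilinearI simp: lsimps mult.commute)
  have b': "cbilinear (\<lambda>a b. S b * \<epsilon>\<^sub>s a)"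
    by (auto intro!: cbilinearI simp: lsimps)
  let ?T = "\<lambda>i y. tensor_lift (\<lambda>a b. \<tau> (E\<^sub>s ((u i)\<^sup>\<star> * y) * S b) *\<^sub>C (u i * \<epsilon>\<^sub>s a * z)) (\<Delta> 1)"
  have T: "u i * E\<^sub>s ((u i)\<^sup>\<star> * y) * z = ?T i y" for i y
  proof -
    have "u i * tensor_lift (\<lambda>a b. \<tau> (E\<^sub>s ((u i)\<^sup>\<star> * y) * S b) *\<^sub>C \<epsilon>\<^sub>s a) (\<Delta> 1) * z = ?T i y"
      by (subst tensor_lift_comp[of _ "\<lambda>w. u i * w * z"])
        (auto intro!: clinearI simp: b lsimps mult.assoc)
    then show ?thesis
      by (simp add: source_frobenius Es_mem)
  qed
  have lin: "clinear (?T i)" for i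
    unfolding T[symmetric] by (auto intro!: clinearI simp: lsimps Es_linear_maps)
  have "y * z = (\<Sum>i\<in>I. ?T i y)" for y
  proof -
    have "y * z = (\<Sum>i\<in>I. u i * E\<^sub>s ((u i)\<^sup>\<star> * y)) * z"
      by (simp only: expectation_basis_sum[OF u])
    then show ?thesis
      by (simp add: sum_distrib_right T)
  qed
  then have "ctrace (\<lambda>y. y * z) = ctrace (\<lambda>y. \<Sum>i\<in>I. ?T i y)"
    by (intro arg_cong[of _ _ ctrace] ext)
  also have "\<dots> = (\<Sum>i\<in>I. ctrace (?T i))"
    by (rule ctrace_sum[OF finite_dimensional I lin])
  also have "\<dots> = (\<Sum>i\<in>I. \<tau> z)"
  proof (rule sum.cong[OF refl])
    fix i assume i: "i \<in> I"
    have "ctrace (?T i) = tensor_lift (\<lambda>a b. \<tau> (E\<^sub>s ((u i)\<^sup>\<star> * (u i * \<epsilon>\<^sub>s a * z)) * S b)) (\<Delta> 1)"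
      by (rule ctrace_tensor_lift[OF finite_dimensional])
        (auto intro!: cbilinearI clinearI simp: lsimps Es_linear_maps)
    also have "\<dots> = tensor_lift (\<lambda>a b. \<tau> (E\<^sub>s ((u i)\<^sup>\<star> * u i) * \<epsilon>\<^sub>s a * z * S b)) (\<Delta> 1)"
      using z by (simp add: Es_mult_right source_mem flip: mult.assoc)
    \<comment> \<open>Orthonormality removes the expectation, and cyclicity arranges the two legs of
      \<open>\<Delta> 1\<close> so that they contract to 1.\<close>
    also have "\<dots> = tensor_lift (\<lambda>a b. \<tau> (z * (S b * \<epsilon>\<^sub>s a))) (\<Delta> 1)"
    proof -
      have "\<tau> (\<epsilon>\<^sub>s a * z * S b) = \<tau> (z * (S b * \<epsilon>\<^sub>s a))" for a b
        by (metis mult.assoc trace_commute)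
      then show ?thesis
        by (simp add: expectation_basis_orthonormal[OF u i i])
    qed
    also have "\<dots> = \<tau> (z * tensor_lift (\<lambda>a b. S b * \<epsilon>\<^sub>s a) (\<Delta> 1))"
      by (rule tensor_lift_comp[symmetric, of _ "\<lambda>y. \<tau> (z * y)"])
        (auto intro!: clinearI simp: b' lsimps)
    finally show "ctrace (?T i) = \<tau> z"
      by (simp add: lift_antipode_source_one)
  qed
  finally show ?thesis by simp
qed

text \<open>Composing \<open>S\<close> with the star restores the order of products, which
  \<open>S\<close> alone would reverse. So \<open>T\<close> is an antilinear involution that is
  multiplicative, exchanges the Cartan subalgebras and intertwines the expectations.\<close>

lemma target_basis_iff:
  fixes I :: "'i set"
  shows "(\<exists>y. expectation_basis K\<^sub>t E\<^sub>t I y) \<longleftrightarrow> (\<exists>x. expectation_basis K\<^sub>s E\<^sub>s I x)"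
proof -
  define T where "T x = (S x)\<^sup>\<star>" for x
  have TT: "T (T x) = x" for x
    by (simp add: T_def antipode_star antipode_involutive star_star flip: antipode_star)
  have T: "T (x * y) = T x * T y" "T (x\<^sup>\<star>) = (T x)\<^sup>\<star>" for x y
    by (simp_all add: T_def antipode_antimult antipode_star star_mult)
  have Tsum: "T (sum f A) = (\<Sum>i\<in>A. T (f i))" for f :: "'i \<Rightarrow> 'a" and A
    by (simp add: T_def clinear_sum[OF antipode_linear] star_sum)
  \<comment> \<open>The empty sum gives \<open>T 0 = 0\<close>; involutivity gives the
    converse.\<close>
  have T0: "T x = 0 \<longleftrightarrow> x = 0" for x
    using Tsum[of undefined "{}"] by (metis TT sum.empty)
  have Kt: "T x \<in> K\<^sub>s \<longleftrightarrow> x \<in> K\<^sub>t" for x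
    unfolding T_def target_cartan_iff using source_cartan_star(1) star_star by metis
  have Ks: "T x \<in> K\<^sub>t \<longleftrightarrow> x \<in> K\<^sub>s" for x
    using Kt[of "T x"] by (simp add: TT)
  have E: "E\<^sub>t (T x) = T (E\<^sub>s x)" for x
    by (simp add: T_def Et_antipode Es_star antipode_star flip: antipode_star)
  have E': "E\<^sub>s (T x) = T (E\<^sub>t x)" for x
    using E[of "T x"] by (metis TT)
  have transfer: "expectation_basis B F I (\<lambda>i. T (u i))"
    if u: "expectation_basis A E I u" and A: "\<And>x. T x \<in> A \<longleftrightarrow> x \<in> B" and F: "\<And>x. F (T x) = T (E x)"
    for A B E F and u :: "'i \<Rightarrow> 'a"
    unfolding expectation_basis_def
  proof (intro conjI allI impI)
    show "finite I"
      using u by (simp add: expectation_basis_def)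
    fix b
    have "T b = (\<Sum>i\<in>I. u i * E ((u i)\<^sup>\<star> * T b))"
      by (rule expectation_basis_sum[OF u, symmetric])
    then have "T (T b) = T (\<Sum>i\<in>I. u i * E ((u i)\<^sup>\<star> * T b))"
      by (rule arg_cong)
    then show "b = (\<Sum>i\<in>I. T (u i) * F ((T (u i))\<^sup>\<star> * b))"
      by (simp add: TT Tsum T flip: F)
  next
    fix a assume a: "(\<forall>i\<in>I. a i \<in> B) \<and> (\<Sum>i\<in>I. T (u i) * a i) = 0"
    then have "T (\<Sum>i\<in>I. T (u i) * a i) = 0"
      by (simp add: T0)
    then have "(\<Sum>i\<in>I. u i * T (a i)) = 0"
      by (simp add: Tsum T TT)
    moreover have "\<forall>i\<in>I. T (a i) \<in> A"
      using a A by blast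
    ultimately have "\<forall>i\<in>I. T (a i) = 0"
      using expectation_basis_independent[OF u, of "\<lambda>i. T (a i)"] by blast
    then show "\<forall>i\<in>I. a i = 0" by (simp add: T0)
  qed
  show ?thesis
    using transfer[of "K\<^sub>s" "E\<^sub>s" _ "K\<^sub>t" "E\<^sub>t"] transfer[of "K\<^sub>t" "E\<^sub>t" _ "K\<^sub>s" "E\<^sub>s"] Kt Ks E E'
    by metis
qed

end

section \<open>Multimatrix algebras\<close>

lemma mult_delta_left: "(if b then x else 0) * y = (if b then x * y else (0::'a::mult_zero))"
  and mult_delta_right: "y * (if b then x else 0) = (if b then y * x else (0::'a::mult_zero))"
  by simp_all

section \<open>Traces of block-diagonal matrices\<close>

definition mat_trace :: "'a::comm_monoid_add mat \<Rightarrow> 'a"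
  where "mat_trace A = (\<Sum>i<dim_row A. A $$ (i, i))"

lemma mat_trace_comm:
  fixes A B :: "'a::comm_semiring_0 mat"
  assumes "A \<in> carrier_mat n k" "B \<in> carrier_mat k n"
  shows "mat_trace (A * B) = mat_trace (B * A)"
proof -
  have "mat_trace (A * B) = (\<Sum>i<n. \<Sum>j<k. A $$ (i, j) * B $$ (j, i))"
    using assms by (simp add: mat_trace_def scalar_prod_def atLeast0LessThan)
  also have "\<dots> = (\<Sum>j<k. \<Sum>i<n. B $$ (j, i) * A $$ (i, j))"
    by (subst sum.swap) (simp add: mult.commute)
  also have "\<dots> = mat_trace (B * A)"
    using assms by (simp add: mat_trace_def scalar_prod_def atLeast0LessThan)
  finally show ?thesis .
qed

lemma mat_trace_similar:
  fixes A B :: "'a::comm_ring_1 mat"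
  assumes "similar_mat_wit A B P Q"
  shows "mat_trace A = mat_trace B"
proof -
  note D = similar_mat_witD[OF refl assms]
  have "mat_trace A = mat_trace (P * B * Q)"
    by (rule arg_cong[OF D(3)])
  also have "\<dots> = mat_trace (Q * (P * B))"
    by (rule mat_trace_comm) (rule mult_carrier_mat D)+
  also have "Q * (P * B) = Q * P * B"
    by (rule assoc_mult_mat[symmetric]) (rule D)+
  also have "\<dots> = B"
    using D(2,5) by simp
  finally show ?thesis .
qed

lemma mat_trace_four_block:
  assumes "A \<in> carrier_mat n n" "D \<in> carrier_mat k k"
  shows "mat_trace (four_block_mat A B C D) = mat_trace A + mat_trace D"
proof -
  have split: "(\<Sum>i<n + k. f i) = (\<Sum>i<n. f i) + (\<Sum>i<k. f (n + i))" for f :: "nat \<Rightarrow> 'a" and k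
    by (induction k) (simp_all add: add.assoc)
  have "mat_trace (four_block_mat A B C D) =
      (\<Sum>i<n + k. if i < n then A $$ (i, i) else D $$ (i - n, i - n))"
    using carrier_matD[OF assms(1)] carrier_matD[OF assms(2)]
    by (auto simp: mat_trace_def intro!: sum.cong)
  also have "\<dots> = (\<Sum>i<n. A $$ (i, i)) + (\<Sum>i<k. D $$ (i, i))"
    unfolding split by simp
  finally show ?thesis
    using assms by (simp add: mat_trace_def)
qed

lemma mat_trace_diag_block:
  assumes "\<forall>A\<in>set As. square_mat A"
  shows "mat_trace (diag_block_mat As) = sum_list (map mat_trace As)"
  using assms
proof (induction As)
  case Nil
  then show ?case by (simp add: mat_trace_def)
next
  case (Cons A As)
  let ?D = "diag_block_mat As"
  have "square_mat ?D"
    using Cons.prems by (intro diag_block_mat_square) simp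
  then have D: "?D \<in> carrier_mat (dim_row ?D) (dim_row ?D)"
    by (intro carrier_matI) simp_all
  have A: "A \<in> carrier_mat (dim_row A) (dim_row A)"
    using Cons.prems by (intro carrier_matI) simp_all
  have "mat_trace (diag_block_mat (A # As)) = mat_trace A + mat_trace ?D"
    unfolding diag_block_mat.simps Let_def by (rule mat_trace_four_block[OF A D])
  with Cons show ?case by simp
qed

lemma sum_list_concat_replicate:
  "sum_list (map f (concat (map (\<lambda>\<alpha>. replicate (c \<alpha>) (g \<alpha>)) [0..<n])))
    = (\<Sum>\<alpha><n. of_nat (c \<alpha>) * (f (g \<alpha>) :: 'a::semiring_1))"
  by (induction n) (simp_all add: sum_list_replicate)

lemma mat_adjoint_index:
  assumes "A \<in> carrier_mat n k" "i < k" "j < n"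
  shows "mat_adjoint A $$ (i, j) = cnj (A $$ (j, i))"
  using assms unfolding mat_adjoint_def by (simp add: mat_of_rows_index conjugate_complex_def)

section \<open>Coordinates and matrix units of a multimatrix algebra\<close>

locale multimatrix =
  fixes A :: "'a::complex_star_algebra set" and m :: "nat vec" and \<psi> :: "'a \<Rightarrow> nat \<Rightarrow> complex mat"
  assumes iso: "multimatrix_iso A m \<psi>"
    and one_mem: "1 \<in> A"
    and add_mem: "\<And>x y. x \<in> A \<Longrightarrow> y \<in> A \<Longrightarrow> x + y \<in> A"
    and scale_mem: "\<And>c x. x \<in> A \<Longrightarrow> c *\<^sub>C x \<in> A"
    and mult_mem: "\<And>x y. x \<in> A \<Longrightarrow> y \<in> A \<Longrightarrow> x * y \<in> A"
    and star_mem: "\<And>x. x \<in> A \<Longrightarrow> x\<^sup>\<star> \<in> A"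
begin

text \<open>Indices outside the range give the preimage of the zero tuple, so membership in
  \<open>A\<close> holds for all indices.\<close>

definition matrix_unit :: "nat \<Rightarrow> nat \<Rightarrow> nat \<Rightarrow> 'a" where
  "matrix_unit \<alpha> k l = inv_into A \<psi> (\<lambda>i\<in>{..<dim_vec m}. mat (m $ i) (m $ i)
     (\<lambda>(r, c). if i = \<alpha> \<and> r = k \<and> c = l then 1 else 0))"

definition unit_index :: "(nat \<times> nat \<times> nat) set" where
  "unit_index = (SIGMA \<alpha>:{..<dim_vec m}. {..<m $ \<alpha>} \<times> {..<m $ \<alpha>})"

lemma zero_mem: "0 \<in> A"
  using scale_mem[OF one_mem, of 0] by simp

lemma sum_mem: "(\<And>i. i \<in> I \<Longrightarrow> f i \<in> A) \<Longrightarrow> sum f I \<in> A"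
  by (induction I rule: infinite_finite_induct) (auto intro: add_mem zero_mem)

lemma dim_pos: "\<alpha> < dim_vec m \<Longrightarrow> 0 < m $ \<alpha>"
  using iso by (simp add: multimatrix_iso_def)

lemma iso_bij: "bij_betw \<psi> A (multimatrix_carrier m)"
  using iso by (simp add: multimatrix_iso_def)

lemma iso_carrier: "x \<in> A \<Longrightarrow> \<alpha> < dim_vec m \<Longrightarrow> \<psi> x \<alpha> \<in> carrier_mat (m $ \<alpha>) (m $ \<alpha>)"
  using bij_betwE[OF iso_bij] by (auto simp: multimatrix_carrier_def)

lemma iso_dim: "x \<in> A \<Longrightarrow> \<alpha> < dim_vec m \<Longrightarrow> dim_row (\<psi> x \<alpha>) = m $ \<alpha>"
    "x \<in> A \<Longrightarrow> \<alpha> < dim_vec m \<Longrightarrow> dim_col (\<psi> x \<alpha>) = m $ \<alpha>"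
  using iso_carrier by blast+

lemma iso_eqI:
  assumes "x \<in> A" "y \<in> A"
    and "\<And>\<alpha> k l. \<alpha> < dim_vec m \<Longrightarrow> k < m $ \<alpha> \<Longrightarrow> l < m $ \<alpha> \<Longrightarrow> \<psi> x \<alpha> $$ (k, l) = \<psi> y \<alpha> $$ (k, l)"
  shows "x = y"
proof -
  have "\<psi> x \<alpha> = \<psi> y \<alpha>" if "\<alpha> < dim_vec m" for \<alpha>
    by (rule eq_matI) (use assms that iso_dim in auto)
  moreover have "\<psi> x \<in> multimatrix_carrier m" "\<psi> y \<in> multimatrix_carrier m"
    using assms bij_betwE[OF iso_bij] by auto
  ultimately have "\<psi> x = \<psi> y"
    unfolding multimatrix_carrier_def by (intro PiE_ext[of "\<psi> x" _ _ "\<psi> y"]) auto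
  then show ?thesis
    using assms iso_bij by (metis bij_betw_imp_inj_on inj_onD)
qed

lemma
  assumes "\<alpha> < dim_vec m" "k < m $ \<alpha>" "l < m $ \<alpha>" and x: "x \<in> A"
  shows coeff_add: "y \<in> A \<Longrightarrow> \<psi> (x + y) \<alpha> $$ (k, l) = \<psi> x \<alpha> $$ (k, l) + \<psi> y \<alpha> $$ (k, l)"
    and coeff_scale: "\<psi> (c *\<^sub>C x) \<alpha> $$ (k, l) = c * \<psi> x \<alpha> $$ (k, l)"
    and coeff_mult: "y \<in> A \<Longrightarrow> \<psi> (x * y) \<alpha> $$ (k, l) = (\<Sum>r<m $ \<alpha>. \<psi> x \<alpha> $$ (k, r) * \<psi> y \<alpha> $$ (r, l))"
    and coeff_star: "\<psi> (x\<^sup>\<star>) \<alpha> $$ (k, l) = cnj (\<psi> x \<alpha> $$ (l, k))"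
    and coeff_one: "\<psi> 1 \<alpha> $$ (k, l) = (if k = l then 1 else 0)"
    and coeff_zero: "\<psi> 0 \<alpha> $$ (k, l) = 0"
proof -
  have i: "\<And>y. y \<in> A \<Longrightarrow> \<psi> (x + y) \<alpha> = \<psi> x \<alpha> + \<psi> y \<alpha>"
    "\<And>x c. x \<in> A \<Longrightarrow> \<psi> (c *\<^sub>C x) \<alpha> = c \<cdot>\<^sub>m \<psi> x \<alpha>"
    "\<And>y. y \<in> A \<Longrightarrow> \<psi> (x * y) \<alpha> = \<psi> x \<alpha> * \<psi> y \<alpha>"
    "\<psi> (x\<^sup>\<star>) \<alpha> = mat_adjoint (\<psi> x \<alpha>)" "\<psi> 1 \<alpha> = 1\<^sub>m (m $ \<alpha>)"
    using iso assms by (simp_all add: multimatrix_iso_def)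
  note simps = i iso_dim[OF x assms(1)] iso_dim[OF _ assms(1)] iso_carrier[OF x assms(1)] assms(2,3)
  show "y \<in> A \<Longrightarrow> \<psi> (x + y) \<alpha> $$ (k, l) = \<psi> x \<alpha> $$ (k, l) + \<psi> y \<alpha> $$ (k, l)"
    by (simp add: simps)
  show "\<psi> (c *\<^sub>C x) \<alpha> $$ (k, l) = c * \<psi> x \<alpha> $$ (k, l)"
    using x by (simp add: simps)
  show "y \<in> A \<Longrightarrow> \<psi> (x * y) \<alpha> $$ (k, l) = (\<Sum>r<m $ \<alpha>. \<psi> x \<alpha> $$ (k, r) * \<psi> y \<alpha> $$ (r, l))"
    by (simp add: simps scalar_prod_def atLeast0LessThan)
  show "\<psi> (x\<^sup>\<star>) \<alpha> $$ (k, l) = cnj (\<psi> x \<alpha> $$ (l, k))"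
    by (simp add: simps mat_adjoint_index[of _ "m $ \<alpha>" "m $ \<alpha>"])
  show "\<psi> 1 \<alpha> $$ (k, l) = (if k = l then 1 else 0)"
    by (simp add: simps)
  show "\<psi> 0 \<alpha> $$ (k, l) = 0"
    using i(2)[OF one_mem, of 0] by (simp add: iso_dim[OF one_mem assms(1)] assms)
qed

lemma coeff_sum:
  assumes "\<alpha> < dim_vec m" "k < m $ \<alpha>" "l < m $ \<alpha>" "\<And>i. i \<in> I \<Longrightarrow> f i \<in> A"
  shows "\<psi> (sum f I) \<alpha> $$ (k, l) = (\<Sum>i\<in>I. \<psi> (f i) \<alpha> $$ (k, l))"
  using assms(4)
  by (induction I rule: infinite_finite_induct)
    (simp_all add: coeff_zero[OF assms(1-3) one_mem] coeff_add[OF assms(1-3)] sum_mem)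

lemma matrix_unit_mem: "matrix_unit \<alpha> k l \<in> A"
  and coeff_matrix_unit: "\<lbrakk>\<beta> < dim_vec m; r < m $ \<beta>; c < m $ \<beta>\<rbrakk> \<Longrightarrow>
    \<psi> (matrix_unit \<alpha> k l) \<beta> $$ (r, c) = (if \<beta> = \<alpha> \<and> r = k \<and> c = l then 1 else 0)"
proof -
  let ?E = "\<lambda>i\<in>{..<dim_vec m}. mat (m $ i) (m $ i)
     (\<lambda>(r, c). if i = \<alpha> \<and> r = k \<and> c = l then 1 else (0::complex))"
  have "?E \<in> multimatrix_carrier m"
    unfolding multimatrix_carrier_def by auto
  then have E: "?E \<in> \<psi> ` A"
    using iso_bij by (simp add: bij_betw_def)
  show "matrix_unit \<alpha> k l \<in> A"
    unfolding matrix_unit_def using E by (rule inv_into_into)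
  show "\<psi> (matrix_unit \<alpha> k l) \<beta> $$ (r, c) = (if \<beta> = \<alpha> \<and> r = k \<and> c = l then 1 else 0)"
    if "\<beta> < dim_vec m" "r < m $ \<beta>" "c < m $ \<beta>"
    unfolding matrix_unit_def f_inv_into_f[OF E] using that by simp
qed

lemmas mem_intros = one_mem add_mem scale_mem mult_mem star_mem zero_mem sum_mem matrix_unit_mem
lemmas coeff_simps = mult_delta_left mult_delta_right coeff_add coeff_scale coeff_mult coeff_star coeff_one[OF _ _ _ one_mem]
  coeff_zero[OF _ _ _ one_mem] coeff_sum coeff_matrix_unit

lemma finite_unit_index: "finite unit_index"
  by (simp add: unit_index_def)

lemma matrix_unit_expansion:
  assumes "x \<in> A"
  shows "(\<Sum>(\<alpha>, k, l)\<in>unit_index. \<psi> x \<alpha> $$ (k, l) *\<^sub>C matrix_unit \<alpha> k l) = x"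
proof (rule iso_eqI)
  show "(\<Sum>(\<alpha>, k, l)\<in>unit_index. \<psi> x \<alpha> $$ (k, l) *\<^sub>C matrix_unit \<alpha> k l) \<in> A"
    by (auto intro!: mem_intros)
  fix \<beta> r c assume i: "\<beta> < dim_vec m" "r < m $ \<beta>" "c < m $ \<beta>"
  have "\<psi> (\<Sum>(\<alpha>, k, l)\<in>unit_index. \<psi> x \<alpha> $$ (k, l) *\<^sub>C matrix_unit \<alpha> k l) \<beta> $$ (r, c)
      = (\<Sum>j\<in>unit_index. \<psi> x (fst j) $$ snd j * (if j = (\<beta>, r, c) then 1 else 0))"
    using i by (subst coeff_sum)
      (auto intro!: mem_intros sum.cong simp: coeff_simps mem_intros split: prod.splits)
  also have "\<dots> = \<psi> x \<beta> $$ (r, c)"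
    using i by (simp add: finite_unit_index if_distrib sum.delta unit_index_def cong: if_cong)
  finally show "\<psi> (\<Sum>(\<alpha>, k, l)\<in>unit_index. \<psi> x \<alpha> $$ (k, l) *\<^sub>C matrix_unit \<alpha> k l) \<beta> $$ (r, c)
      = \<psi> x \<beta> $$ (r, c)" .
qed (rule assms)

lemma matrix_unit_mult:
  assumes "\<alpha> < dim_vec m" "k < m $ \<alpha>" "l < m $ \<alpha>" "\<beta> < dim_vec m" "r < m $ \<beta>" "s < m $ \<beta>"
  shows "matrix_unit \<alpha> k l * matrix_unit \<beta> r s = (if \<alpha> = \<beta> \<and> l = r then matrix_unit \<alpha> k s else 0)"
proof (rule iso_eqI)
  fix \<gamma> a b assume i: "\<gamma> < dim_vec m" "a < m $ \<gamma>" "b < m $ \<gamma>"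
  have "\<psi> (matrix_unit \<alpha> k l * matrix_unit \<beta> r s) \<gamma> $$ (a, b)
      = (\<Sum>t<m $ \<gamma>. if t = l then (if \<gamma> = \<alpha> \<and> a = k \<and> \<gamma> = \<beta> \<and> t = r \<and> b = s then 1 else 0) else 0)"
    using i by (auto simp: coeff_simps mem_intros intro!: sum.cong)
  also have "\<dots> = \<psi> (if \<alpha> = \<beta> \<and> l = r then matrix_unit \<alpha> k s else 0) \<gamma> $$ (a, b)"
    using i assms by (auto simp: coeff_simps sum.delta)
  finally show "\<psi> (matrix_unit \<alpha> k l * matrix_unit \<beta> r s) \<gamma> $$ (a, b)
      = \<psi> (if \<alpha> = \<beta> \<and> l = r then matrix_unit \<alpha> k s else 0) \<gamma> $$ (a, b)" .
qed (auto intro!: mem_intros)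

lemma matrix_unit_star:
  assumes "\<alpha> < dim_vec m" "k < m $ \<alpha>" "l < m $ \<alpha>"
  shows "(matrix_unit \<alpha> k l)\<^sup>\<star> = matrix_unit \<alpha> l k"
  by (rule iso_eqI) (use assms in \<open>auto simp: coeff_simps mem_intros\<close>)

lemma sum_matrix_units: "(\<Sum>\<alpha><dim_vec m. \<Sum>k<m $ \<alpha>. matrix_unit \<alpha> k k) = 1"
proof (rule iso_eqI)
  fix \<gamma> a b assume i: "\<gamma> < dim_vec m" "a < m $ \<gamma>" "b < m $ \<gamma>"
  have "\<psi> (\<Sum>\<alpha><dim_vec m. \<Sum>k<m $ \<alpha>. matrix_unit \<alpha> k k) \<gamma> $$ (a, b)
      = (\<Sum>\<alpha><dim_vec m. \<Sum>k<m $ \<alpha>. if \<gamma> = \<alpha> \<and> a = k \<and> b = k then 1 else 0)"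
    using i by (simp add: coeff_simps mem_intros)
  also have "\<dots> = (\<Sum>\<alpha><dim_vec m. if \<alpha> = \<gamma> then (\<Sum>k<m $ \<alpha>. if k = a then (if a = b then 1 else 0) else 0) else 0)"
    by (intro sum.cong refl) (auto intro!: sum.cong)
  also have "\<dots> = \<psi> 1 \<gamma> $$ (a, b)"
    using i by (simp add: coeff_simps sum.delta)
  finally show "\<psi> (\<Sum>\<alpha><dim_vec m. \<Sum>k<m $ \<alpha>. matrix_unit \<alpha> k k) \<gamma> $$ (a, b) = \<psi> 1 \<gamma> $$ (a, b)" .
qed (auto intro!: mem_intros)

text \<open>The elements \<open>matrix_unit \<alpha> 0 0\<close> are minimal projections, one for
  each block. Cutting down by them makes values of the expectation scalar, or zero between different
  blocks.\<close>

lemma matrix_unit_compress: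
  assumes "\<alpha> < dim_vec m" "\<beta> < dim_vec m" "z \<in> A"
  shows "matrix_unit \<alpha> 0 0 * z * matrix_unit \<beta> 0 0
    = (if \<alpha> = \<beta> then \<psi> z \<alpha> $$ (0, 0) *\<^sub>C matrix_unit \<alpha> 0 0 else 0)"
proof (rule iso_eqI)
  fix \<gamma> a b assume i: "\<gamma> < dim_vec m" "a < m $ \<gamma>" "b < m $ \<gamma>"
  have "\<psi> (matrix_unit \<alpha> 0 0 * z) \<gamma> $$ (a, c)
      = (if \<gamma> = \<alpha> \<and> a = 0 then \<psi> z \<gamma> $$ (0, c) else 0)" if "c < m $ \<gamma>" for c
  proof -
    have "\<psi> (matrix_unit \<alpha> 0 0 * z) \<gamma> $$ (a, c)
        = (\<Sum>r<m $ \<gamma>. if r = 0 then (if \<gamma> = \<alpha> \<and> a = 0 then \<psi> z \<gamma> $$ (0, c) else 0) else 0)"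
      using i that assms by (auto simp: coeff_simps mem_intros intro!: sum.cong)
    then show ?thesis
      using dim_pos[OF i(1)] by (simp add: sum.delta)
  qed
  then have "\<psi> (matrix_unit \<alpha> 0 0 * z * matrix_unit \<beta> 0 0) \<gamma> $$ (a, b)
      = (\<Sum>c<m $ \<gamma>. if c = 0 then (if \<gamma> = \<alpha> \<and> a = 0 \<and> \<gamma> = \<beta> \<and> b = 0 then \<psi> z \<gamma> $$ (0, 0) else 0) else 0)"
    using i assms by (subst coeff_mult) (auto simp: coeff_simps mem_intros intro!: sum.cong)
  also have "\<dots> = (if \<gamma> = \<alpha> \<and> a = 0 \<and> \<gamma> = \<beta> \<and> b = 0 then \<psi> z \<gamma> $$ (0, 0) else 0)"
    using dim_pos[OF i(1)] by (simp add: sum.delta)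
  also have "\<dots> = \<psi> (if \<alpha> = \<beta> then \<psi> z \<alpha> $$ (0, 0) *\<^sub>C matrix_unit \<alpha> 0 0 else 0) \<gamma> $$ (a, b)"
    using i assms by (auto simp: coeff_simps mem_intros)
  finally show "\<psi> (matrix_unit \<alpha> 0 0 * z * matrix_unit \<beta> 0 0) \<gamma> $$ (a, b)
      = \<psi> (if \<alpha> = \<beta> then \<psi> z \<alpha> $$ (0, 0) *\<^sub>C matrix_unit \<alpha> 0 0 else 0) \<gamma> $$ (a, b)" .
qed (auto intro!: mem_intros assms)

text \<open>Testing a combination of block traces on these elements reads off its coefficients one
  at a time.\<close>

lemma mat_trace_matrix_unit:
  assumes "\<alpha> < dim_vec m" "\<beta> < dim_vec m"
  shows "mat_trace (\<psi> (matrix_unit \<alpha> 0 0) \<beta>) = (if \<beta> = \<alpha> then 1 else 0)"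
proof -
  have "mat_trace (\<psi> (matrix_unit \<alpha> 0 0) \<beta>) = (\<Sum>i<m $ \<beta>. if i = 0 then (if \<beta> = \<alpha> then 1 else 0) else 0)"
    using assms by (auto simp: mat_trace_def iso_dim coeff_simps mem_intros intro!: sum.cong)
  then show ?thesis
    using dim_pos[OF assms(2)] by (simp add: sum.delta)
qed

lemma sum_unit_index: "(\<Sum>(\<alpha>, k, l)\<in>unit_index. f \<alpha> k l) = (\<Sum>\<alpha><dim_vec m. \<Sum>k<m $ \<alpha>. \<Sum>l<m $ \<alpha>. f \<alpha> k l)"
  unfolding unit_index_def
  by (subst sum.Sigma[symmetric]) (auto simp: sum.cartesian_product)

text \<open>The sums are the traces of left and right multiplication on \<open>A\<close>. The
  diagonal entry at (k, l) is x_kk or x_ll respectively, and the other index ranges freely, whence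
  the factor \<open>m $ \<alpha>\<close>.\<close>

lemma regular_trace_sum:
  assumes x: "x \<in> A"
  shows "(\<Sum>(\<alpha>, k, l)\<in>unit_index. \<psi> (x * matrix_unit \<alpha> k l) \<alpha> $$ (k, l))
      = (\<Sum>\<alpha><dim_vec m. of_nat (m $ \<alpha>) * mat_trace (\<psi> x \<alpha>))" (is "?left = ?tr")
    and "(\<Sum>(\<alpha>, k, l)\<in>unit_index. \<psi> (matrix_unit \<alpha> k l * x) \<alpha> $$ (k, l))
      = (\<Sum>\<alpha><dim_vec m. of_nat (m $ \<alpha>) * mat_trace (\<psi> x \<alpha>))" (is "?right = ?tr")
proof -
  have l: "\<psi> (x * matrix_unit \<alpha> k l) \<alpha> $$ (k, l) = \<psi> x \<alpha> $$ (k, k)"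
    and r: "\<psi> (matrix_unit \<alpha> k l * x) \<alpha> $$ (k, l) = \<psi> x \<alpha> $$ (l, l)"
    if i: "\<alpha> < dim_vec m" "k < m $ \<alpha>" "l < m $ \<alpha>" for \<alpha> k l
  proof -
    have "\<psi> (x * matrix_unit \<alpha> k l) \<alpha> $$ (k, l) = (\<Sum>r<m $ \<alpha>. if r = k then \<psi> x \<alpha> $$ (k, k) else 0)"
      using i x by (auto simp: coeff_simps mem_intros intro!: sum.cong)
    then show "\<psi> (x * matrix_unit \<alpha> k l) \<alpha> $$ (k, l) = \<psi> x \<alpha> $$ (k, k)"
      using i by (simp add: sum.delta)
    have "\<psi> (matrix_unit \<alpha> k l * x) \<alpha> $$ (k, l) = (\<Sum>r<m $ \<alpha>. if r = l then \<psi> x \<alpha> $$ (l, l) else 0)"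
      using i x by (auto simp: coeff_simps mem_intros intro!: sum.cong)
    then show "\<psi> (matrix_unit \<alpha> k l * x) \<alpha> $$ (k, l) = \<psi> x \<alpha> $$ (l, l)"
      using i by (simp add: sum.delta)
  qed
  show "?left = ?tr"
    unfolding sum_unit_index using x
    by (intro sum.cong) (simp_all add: l mat_trace_def iso_dim sum_distrib_left)
  show "?right = ?tr"
    unfolding sum_unit_index using x
    by (intro sum.cong) (simp_all add: r mat_trace_def iso_dim)
qed

end

lemma (in multimatrix) regular_trace_eq:
  fixes x :: 'a
  assumes A: "A = UNIV" and fin: "cfinite_dimensional TYPE('a)"
  shows "regular_trace x = (\<Sum>\<alpha><dim_vec m. of_nat (m $ \<alpha>) * mat_trace (\<psi> x \<alpha>))"
    and "ctrace (\<lambda>y. y * x) = (\<Sum>\<alpha><dim_vec m. of_nat (m $ \<alpha>) * mat_trace (\<psi> x \<alpha>))"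
proof -
  \<comment> \<open>Expanding \<open>f y\<close> in matrix units presents \<open>f\<close> as a sum
    of rank-one operators, whose traces are the diagonal coordinates.\<close>
  have tr: "ctrace f = (\<Sum>(\<alpha>, k, l)\<in>unit_index. \<psi> (f (matrix_unit \<alpha> k l)) \<alpha> $$ (k, l))"
    if f: "clinear f" for f :: "'a \<Rightarrow> 'a"
  proof -
    have lin: "clinear (\<lambda>y. \<psi> y \<alpha> $$ (k, l))" if "(\<alpha>, k, l) \<in> unit_index" for \<alpha> k l
      using that A by (auto intro!: clinearI simp: unit_index_def coeff_simps)
    have lin': "clinear (\<lambda>y. \<psi> (f y) \<alpha> $$ (k, l))" if "(\<alpha>, k, l) \<in> unit_index" for \<alpha> k l
      using lin[OF that] f by (simp add: clinear_iff)
    have "ctrace f = ctrace (\<lambda>y. \<Sum>j\<in>unit_index. \<psi> (f y) (fst j) $$ snd j *\<^sub>C matrix_unit (fst j) (fst (snd j)) (snd (snd j)))"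
      using matrix_unit_expansion A by (simp add: case_prod_unfold)
    also have "\<dots> = (\<Sum>j\<in>unit_index. ctrace (\<lambda>y. \<psi> (f y) (fst j) $$ snd j *\<^sub>C matrix_unit (fst j) (fst (snd j)) (snd (snd j))))"
      using lin' by (intro ctrace_sum[OF fin finite_unit_index] clinearI)
        (auto simp: clinear_iff scaleC_add_left scaleC_scaleC)
    also have "\<dots> = (\<Sum>j\<in>unit_index. \<psi> (f (matrix_unit (fst j) (fst (snd j)) (snd (snd j)))) (fst j) $$ snd j)"
      using lin' by (intro sum.cong refl ctrace_rank_one[OF fin]) auto
    finally show ?thesis by (simp add: case_prod_unfold)
  qed
  have "clinear ((*) x)" "clinear (\<lambda>y. y * x)"
    by (auto intro!: clinearI simp: distrib_left distrib_right mult_scaleC_left mult_scaleC_right)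
  then show "regular_trace x = (\<Sum>\<alpha><dim_vec m. of_nat (m $ \<alpha>) * mat_trace (\<psi> x \<alpha>))"
    "ctrace (\<lambda>y. y * x) = (\<Sum>\<alpha><dim_vec m. of_nat (m $ \<alpha>) * mat_trace (\<psi> x \<alpha>))"
    using regular_trace_sum[of x] A by (simp_all add: regular_trace_def tr)
qed

text \<open>The trace is blind to the unitary conjugation and adds up diagonal blocks, so only the
  multiplicities of the inclusion remain.\<close>

lemma inclusion_matrix_trace:
  assumes A: "multimatrix A m \<psi>" and inc: "inclusion_matrix A m \<psi> d \<phi> \<Lambda>"
    and x: "x \<in> A" and i: "i < dim_vec d"
  shows "mat_trace (\<phi> x i) = (\<Sum>\<alpha><dim_vec m. of_nat (\<Lambda> $$ (\<alpha>, i)) * mat_trace (\<psi> x \<alpha>))"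
proof -
  let ?B = "concat (map (\<lambda>\<alpha>. replicate (\<Lambda> $$ (\<alpha>, i)) (\<psi> x \<alpha>)) [0..<dim_vec m])"
  obtain U where "similar_mat_wit (\<phi> x i) (diag_block_mat ?B) U (mat_adjoint U)"
    using inc x i unfolding inclusion_matrix_def by blast
  then have "mat_trace (\<phi> x i) = mat_trace (diag_block_mat ?B)"
    by (rule mat_trace_similar)
  also have "\<dots> = sum_list (map mat_trace ?B)"
    by (rule mat_trace_diag_block) (use multimatrix.iso_dim[OF A x] in auto)
  finally show ?thesis
    by (simp only: sum_list_concat_replicate)
qed

section \<open>Orthonormal families\<close>

text \<open>Gram-Schmidt by induction over \<open>F\<close>: the new vector is reduced by its
  projection \<open>s\<close>. A zero remainder leaves the span unchanged; a nonzero one is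
  normalised and joined.\<close>

lemma ex_orthonormal_span:
  fixes ip :: "'a::complex_vector \<Rightarrow> 'a \<Rightarrow> complex"
  assumes lin: "\<And>x. clinear (ip x)" and herm: "\<And>x y. ip y x = cnj (ip x y)"
    and pos: "\<And>x. 0 \<le> ip x x" and definite: "\<And>x. ip x x = 0 \<Longrightarrow> x = 0"
    and "finite F"
  obtains B where "finite B" "complex_vector.span B = complex_vector.span F"
    "\<And>x y. x \<in> B \<Longrightarrow> y \<in> B \<Longrightarrow> ip x y = (if x = y then 1 else 0)"
proof -
  have ipr: "ip x (y + z) = ip x y + ip x z" "ip x (c *\<^sub>C y) = c * ip x y" "ip x (y - z) = ip x y - ip x z"
    for x y z c
    using lin[of x] by (auto simp: clinear_iff complex_vector_pair.linear_diff[OF lin])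
  have ipl: "ip (c *\<^sub>C y) x = cnj c * ip y x" for c x y
    by (subst herm) (simp add: ipr herm[of x y])
  have "\<exists>B. finite B \<and> complex_vector.span B = complex_vector.span F
    \<and> (\<forall>x\<in>B. \<forall>y\<in>B. ip x y = (if x = y then 1 else 0))"
    using \<open>finite F\<close>
  proof (induction F)
    case empty
    show ?case by (intro exI[of _ "{}"]) simp
  next
    case (insert a F)
    then obtain B where B: "finite B" "complex_vector.span B = complex_vector.span F"
      and on: "\<And>x y. x \<in> B \<Longrightarrow> y \<in> B \<Longrightarrow> ip x y = (if x = y then 1 else 0)"
      by blast
    define s where "s = (\<Sum>v\<in>B. ip v a *\<^sub>C v)"
    have s: "s \<in> complex_vector.span B"
      unfolding s_def by (intro complex_vector.span_sum complex_vector.span_scale complex_vector.span_base)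
    have ort: "ip v (a - s) = 0" if v: "v \<in> B" for v
    proof -
      have "ip v s = (\<Sum>w\<in>B. ip w a * (if v = w then 1 else 0))"
        unfolding s_def clinear_sum[OF lin] using v by (intro sum.cong) (simp_all add: ipr on)
      also have "\<dots> = ip v a"
        using v B(1) by (simp add: if_distrib sum.delta cong: if_cong)
      finally show ?thesis by (simp add: ipr)
    qed
    show ?case
    proof (cases "a - s = 0")
      case True
      then have "a \<in> complex_vector.span F"
        using s B(2) by simp
      then have "complex_vector.span B = complex_vector.span (insert a F)"
        using B(2) complex_vector.span_redundant by metis
      with B on show ?thesis by blast
    next
      case False
      define r where "r = Re (ip (a - s) (a - s))"
      have r: "ip (a - s) (a - s) = complex_of_real r" "r > 0"
        using pos[of "a - s"] definite[of "a - s"] False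
        by (auto simp: r_def less_eq_complex_def complex_eq_iff order_less_le)
      define c where "c = complex_of_real (1 / sqrt r)"
      define w where "w = c *\<^sub>C (a - s)"
      have c: "c \<noteq> 0" "cnj c * (c * complex_of_real r) = 1"
        using r(2) by (auto simp: c_def simp flip: of_real_mult)
      have w1: "ip w w = 1"
        using c(2) by (simp add: w_def ipr(2) ipl r(1) mult.left_commute)
      have w0: "ip v w = 0" "ip w v = 0" if "v \<in> B" for v
        using ort[OF that] herm[of v w] by (simp_all add: w_def ipr(2))
      have "a = (1 / c) *\<^sub>C w + s"
        using c(1) by (simp add: w_def scaleC_scaleC scaleC_one)
      moreover have "(1 / c) *\<^sub>C w + s \<in> complex_vector.span (insert w B)"
        using s complex_vector.span_mono[of B "insert w B"]
        by (intro complex_vector.span_add complex_vector.span_scale) (auto intro: complex_vector.span_base)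
      ultimately have a: "a \<in> complex_vector.span (insert w B)"
        by simp
      have w: "w \<in> complex_vector.span (insert a F)"
        unfolding w_def using s B(2)
          complex_vector.span_mono[of F "insert a F"]
        by (intro complex_vector.span_scale complex_vector.span_diff) (auto intro: complex_vector.span_base)
      have "F \<subseteq> complex_vector.span B" "B \<subseteq> complex_vector.span F"
        using B(2) complex_vector.span_superset by auto
      then have "complex_vector.span (insert w B) = complex_vector.span (insert a F)"
        unfolding complex_vector.span_eq using a w
          complex_vector.span_mono[of B "insert w B"] complex_vector.span_mono[of F "insert a F"]
        by blast
      moreover have "w \<notin> B"
        using w0(1)[of w] w1 by auto
      then have "\<forall>x\<in>insert w B. \<forall>y\<in>insert w B. ip x y = (if x = y then 1 else 0)"
        using on w0 w1 by auto
      ultimately show ?thesis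
        using B(1) by blast
    qed
  qed
  with that show ?thesis by blast
qed

lemma orthonormal_expansion:
  fixes ip :: "'a::complex_vector \<Rightarrow> 'a \<Rightarrow> complex"
  assumes lin: "\<And>x. clinear (ip x)" and "finite B"
    and on: "\<And>x y. x \<in> B \<Longrightarrow> y \<in> B \<Longrightarrow> ip x y = (if x = y then 1 else 0)"
    and y: "y \<in> complex_vector.span B"
  shows "(\<Sum>v\<in>B. ip v y *\<^sub>C v) = y"
proof (rule complex_vector_pair.linear_eq_on_span[OF _ _ _ y])
  have "ip x (y + z) = ip x y + ip x z" "ip x (c *\<^sub>C y) = c * ip x y" for x y z c
    using lin[of x] by (auto simp: clinear_iff)
  then show "clinear (\<lambda>y. \<Sum>v\<in>B. ip v y *\<^sub>C v)"
    by (intro clinearI)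
      (simp_all add: scaleC_add_left sum.distrib complex_vector.scale_sum_right scaleC_scaleC)
  fix y assume y: "y \<in> B"
  have "(\<Sum>v\<in>B. ip v y *\<^sub>C v) = (\<Sum>v\<in>B. if v = y then v else 0)"
    using y by (intro sum.cong) (simp_all add: on scaleC_one)
  also have "\<dots> = y"
    using y \<open>finite B\<close> by simp
  finally show "(\<Sum>v\<in>B. ip v y *\<^sub>C v) = y" .
qed simp

section \<open>Integrality of the eigenvalue\<close>

text \<open>Iterating a natural matrix on a natural vector makes every
  \<open>r ^ k * real (v i)\<close> a natural number. The denominators of all powers of
  \<open>r\<close> thus divide the fixed number \<open>v i\<close>.\<close>

lemma integer_eigenvalue:
  fixes M :: "nat \<Rightarrow> nat \<Rightarrow> nat" and v :: "nat \<Rightarrow> nat" and r :: real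
  assumes eig: "\<And>i. i < n \<Longrightarrow> (\<Sum>j<n. real (M i j) * real (v j)) = r * real (v i)"
    and i: "i < n" "v i > 0" and "r \<ge> 0"
  shows "r \<in> \<nat>"
proof -
  have pow: "\<exists>w. \<forall>i<n. r ^ k * real (v i) = real (w i)" for k
  proof (induction k)
    case 0
    show ?case by (intro exI[of _ v]) simp
  next
    case (Suc k)
    then obtain w where w: "\<And>i. i < n \<Longrightarrow> r ^ k * real (v i) = real (w i)" by blast
    have "r ^ Suc k * real (v i) = real (\<Sum>j<n. M i j * w j)" if "i < n" for i
    proof -
      have "r ^ Suc k * real (v i) = r ^ k * (\<Sum>j<n. real (M i j) * real (v j))"
        by (simp add: eig that)
      also have "\<dots> = (\<Sum>j<n. real (M i j) * (r ^ k * real (v j)))"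
        by (simp add: sum_distrib_left mult.left_commute)
      finally show ?thesis by (simp add: w)
    qed
    then show ?case
      by (intro exI[of _ "\<lambda>i. \<Sum>j<n. M i j * w j"]) blast
  qed
  have "r * real (v i) \<in> \<rat>"
    using pow[of 1] i(1) by force
  then have "r * real (v i) / real (v i) \<in> \<rat>"
    by (rule Rats_divide) simp
  then have "r \<in> \<rat>"
    using i by simp
  then obtain a b :: nat where b: "b \<noteq> 0" and r: "r = real a / real b" and "coprime a b"
    using \<open>r \<ge> 0\<close> by (metis Rats_abs_nat_div_natE abs_of_nonneg)
  \<comment> \<open>The exponent \<open>v i\<close> is large enough: \<open>b ^ v i\<close> divides
    \<open>v i\<close>, whereas already \<open>2 ^ v i\<close> exceeds it, so \<open>b\<close> must
    be 1.\<close>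
  obtain w where "r ^ v i * real (v i) = real (w i)"
    using pow i(1) by blast
  then have "real (a ^ v i * v i) = real (w i * b ^ v i)"
    using b by (simp add: r power_divide field_simps)
  then have "a ^ v i * v i = w i * b ^ v i"
    by (simp only: of_nat_eq_iff)
  then have "b ^ v i dvd a ^ v i * v i"
    by simp
  moreover have "coprime (b ^ v i) (a ^ v i)"
    using \<open>coprime a b\<close> by (simp add: coprime_commute)
  ultimately have "b ^ v i dvd v i"
    by (simp add: coprime_dvd_mult_right_iff)
  then have "b ^ v i \<le> v i"
    using i(2) by (rule dvd_imp_le)
  moreover have "2 ^ v i \<le> b ^ v i" if "2 \<le> b"
    using that by (rule power_mono) simp
  ultimately have "\<not> 2 \<le> b"
    using less_exp[of "v i"] by linarith
  with b have "b = 1" by simp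
  then show ?thesis by (simp add: r)
qed

section \<open>The Markov condition\<close>

lemma sum_nested_delta:
  assumes "finite A" "\<And>i. i \<in> A \<Longrightarrow> finite (B i)" "i \<in> A" "j \<in> B i"
  shows "(\<Sum>x\<in>A. \<Sum>y\<in>B x. if x = i \<and> y = j then f x y else 0) = (f i j :: 'a::comm_monoid_add)"
proof -
  have "(\<Sum>x\<in>A. \<Sum>y\<in>B x. if x = i \<and> y = j then f x y else 0)
      = (\<Sum>x\<in>A. if x = i then f i j else 0)"
  proof (rule sum.cong[OF refl])
    fix x assume "x \<in> A"
    show "(\<Sum>y\<in>B x. if x = i \<and> y = j then f x y else 0) = (if x = i then f i j else 0)"
      using assms by (cases "x = i") (simp_all add: sum.delta)
  qed
  then show ?thesis using assms by simp
qed

locale weak_kac_inclusion = weak_kac_haar \<Delta> \<epsilon> S \<tau> p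
  for \<Delta> :: "'a::cstar_algebra \<Rightarrow> ('a, 'a) tensor" and \<epsilon> S \<tau> p +
  fixes d m :: "nat vec" and \<phi> \<psi> :: "'a \<Rightarrow> nat \<Rightarrow> complex mat" and \<Lambda> :: "nat mat"
  assumes iso_all: "multimatrix_iso UNIV d \<phi>"
    and iso_source: "multimatrix_iso (source_cartan \<Delta> \<epsilon>) m \<psi>"
    and inclusion: "inclusion_matrix (source_cartan \<Delta> \<epsilon>) m \<psi> d \<phi> \<Lambda>"
begin

sublocale A: multimatrix UNIV d \<phi>
  by unfold_locales (simp_all add: iso_all)

sublocale B: multimatrix "source_cartan \<Delta> \<epsilon>" m \<psi>
  by unfold_locales (simp_all add: iso_source source_cartan_closed source_cartan_star)

abbreviation unit :: "nat \<Rightarrow> nat \<Rightarrow> nat \<Rightarrow> 'a" where "unit \<equiv> B.matrix_unit"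

section \<open>The two traces on the source algebra in block coordinates\<close>

lemma trace_source_eq:
  assumes x: "x \<in> K\<^sub>s"
  shows "\<tau> x = (\<Sum>\<alpha><dim_vec m. of_nat (m $ \<alpha>) * mat_trace (\<psi> x \<alpha>))"
proof -
  \<comment> \<open>The matrix units with their coordinate functionals are the family for which
    \<open>source_regular_trace\<close> is evaluated.\<close>
  have "(\<Sum>j\<in>B.unit_index. \<psi> (x * unit (fst j) (fst (snd j)) (snd (snd j))) (fst j) $$ snd j) = \<tau> x"
  proof (rule source_regular_trace[OF B.finite_unit_index _ _ _ x])
    show "clinear (\<lambda>x. \<psi> (\<epsilon>\<^sub>s x) (fst j) $$ snd j)" if "j \<in> B.unit_index" for j
      using that
      by (auto intro!: clinearI simp: B.unit_index_def counital_linear_maps B.coeff_simps source_mem)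
    show "(\<Sum>j\<in>B.unit_index. \<psi> z (fst j) $$ snd j *\<^sub>C unit (fst j) (fst (snd j)) (snd (snd j))) = z"
      if "z \<in> K\<^sub>s" for z
      using B.matrix_unit_expansion[OF that] by (simp add: case_prod_unfold)
  qed (rule B.matrix_unit_mem)
  then show ?thesis
    using B.regular_trace_sum(1)[OF x] by (simp add: case_prod_unfold)
qed

text \<open>Links bases over \<open>K\<^sub>s\<close>, which compute traces of right
  multiplications, to the regular trace.\<close>

lemma right_trace_eq: "ctrace (\<lambda>y. y * x) = regular_trace (x :: 'a)"
  using A.regular_trace_eq[OF refl finite_dimensional] by simp

text \<open>The coefficient of the block trace \<alpha> in the regular trace: the block occurs
  \<Lambda>_\<alpha>i times in the i-th summand, which the regular representation repeats d_i times.
  By \<open>weight_eq\<close> it is an entry of the vector (\<Lambda> \<Lambda>^t) m.\<close>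

definition weight :: "nat \<Rightarrow> nat"
  where "weight \<alpha> = (\<Sum>i<dim_vec d. \<Lambda> $$ (\<alpha>, i) * d $ i)"

lemma regular_trace_source:
  assumes x: "x \<in> K\<^sub>s"
  shows "regular_trace x = (\<Sum>\<alpha><dim_vec m. of_nat (weight \<alpha>) * mat_trace (\<psi> x \<alpha>))"
proof -
  have "regular_trace x = (\<Sum>i<dim_vec d. of_nat (d $ i) * mat_trace (\<phi> x i))"
    by (rule A.regular_trace_eq[OF refl finite_dimensional])
  also have "\<dots> = (\<Sum>i<dim_vec d. \<Sum>\<alpha><dim_vec m. of_nat (d $ i) * (of_nat (\<Lambda> $$ (\<alpha>, i)) * mat_trace (\<psi> x \<alpha>)))"
    using inclusion_matrix_trace[OF B.multimatrix_axioms inclusion x] by (simp add: sum_distrib_left)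
  also have "\<dots> = (\<Sum>\<alpha><dim_vec m. of_nat (weight \<alpha>) * mat_trace (\<psi> x \<alpha>))"
    by (subst sum.swap) (simp add: weight_def sum_distrib_left sum_distrib_right mult_ac)
  finally show ?thesis .
qed

text \<open>The trace formula for the inclusion, evaluated at the unit, counts dimensions.\<close>

lemma inclusion_dim:
  assumes i: "i < dim_vec d"
  shows "d $ i = (\<Sum>\<alpha><dim_vec m. \<Lambda> $$ (\<alpha>, i) * m $ \<alpha>)"
proof -
  have \<phi>1: "\<phi> 1 i = 1\<^sub>m (d $ i)"
    using iso_all i by (simp add: multimatrix_iso_def)
  have \<psi>1: "\<psi> 1 \<alpha> = 1\<^sub>m (m $ \<alpha>)" if "\<alpha> < dim_vec m" for \<alpha>
    using iso_source that by (simp add: multimatrix_iso_def)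
  have one: "mat_trace (1\<^sub>m n :: complex mat) = of_nat n" for n
    by (simp add: mat_trace_def)
  have "(of_nat (d $ i) :: complex) = (\<Sum>\<alpha><dim_vec m. of_nat (\<Lambda> $$ (\<alpha>, i)) * mat_trace (\<psi> 1 \<alpha>))"
    using inclusion_matrix_trace[OF B.multimatrix_axioms inclusion B.one_mem i] by (simp add: \<phi>1 one)
  also have "\<dots> = of_nat (\<Sum>\<alpha><dim_vec m. \<Lambda> $$ (\<alpha>, i) * m $ \<alpha>)"
    by (simp add: \<psi>1 one)
  finally show ?thesis
    by (simp only: of_nat_eq_iff)
qed

lemma inclusion_square_index:
  assumes "\<alpha> < dim_vec m" "\<beta> < dim_vec m"
  shows "(\<Lambda> * \<Lambda>\<^sup>T) $$ (\<alpha>, \<beta>) = (\<Sum>i<dim_vec d. \<Lambda> $$ (\<alpha>, i) * \<Lambda> $$ (\<beta>, i))"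
proof -
  have "\<Lambda> \<in> carrier_mat (dim_vec m) (dim_vec d)"
    using inclusion by (simp add: inclusion_matrix_def)
  from carrier_matD[OF this] show ?thesis
    using assms by (simp add: scalar_prod_def atLeast0LessThan)
qed

lemma weight_eq:
  assumes \<alpha>: "\<alpha> < dim_vec m"
  shows "weight \<alpha> = (\<Sum>\<beta><dim_vec m. (\<Lambda> * \<Lambda>\<^sup>T) $$ (\<alpha>, \<beta>) * m $ \<beta>)"
proof -
  have "weight \<alpha> = (\<Sum>i<dim_vec d. \<Sum>\<beta><dim_vec m. \<Lambda> $$ (\<alpha>, i) * (\<Lambda> $$ (\<beta>, i) * m $ \<beta>))"
    unfolding weight_def sum_distrib_left[symmetric] by (intro sum.cong) (simp_all add: inclusion_dim)
  also have "\<dots> = (\<Sum>\<beta><dim_vec m. \<Sum>i<dim_vec d. \<Lambda> $$ (\<alpha>, i) * \<Lambda> $$ (\<beta>, i) * m $ \<beta>)"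
    by (subst sum.swap) (simp add: mult.assoc)
  finally show ?thesis
    using \<alpha> by (simp add: inclusion_square_index sum_distrib_right)
qed

text \<open>On \<open>K\<^sub>s\<close> both traces are combinations of the block traces, with
  coefficients \<open>m $ \<alpha>\<close> and \<open>weight \<alpha>\<close>. Minimal projections
  from the blocks separate these coefficients.\<close>

lemma markov_iff_weight:
  "markov_condition \<Delta> \<tau> p l \<longleftrightarrow> (\<forall>\<alpha><dim_vec m. real (m $ \<alpha>) = l * real (weight \<alpha>))"
  unfolding markov_iff_source
proof
  assume l: "\<forall>x\<in>K\<^sub>s. \<tau> x = complex_of_real l * regular_trace x"
  show "\<forall>\<alpha><dim_vec m. real (m $ \<alpha>) = l * real (weight \<alpha>)"
  proof (intro allI impI)
    fix \<alpha> assume \<alpha>: "\<alpha> < dim_vec m"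
    have delta: "(\<Sum>\<beta><dim_vec m. c \<beta> * mat_trace (\<psi> (unit \<alpha> 0 0) \<beta>)) = c \<alpha>" for c
      using \<alpha> by (simp add: B.mat_trace_matrix_unit mult_delta_right)
    have "complex_of_real (real (m $ \<alpha>)) = complex_of_real (l * real (weight \<alpha>))"
      using l[rule_format, OF B.matrix_unit_mem[of \<alpha> 0 0]]
      by (simp add: trace_source_eq regular_trace_source B.matrix_unit_mem delta)
    then show "real (m $ \<alpha>) = l * real (weight \<alpha>)"
      by (simp only: of_real_eq_iff)
  qed
next
  assume l: "\<forall>\<alpha><dim_vec m. real (m $ \<alpha>) = l * real (weight \<alpha>)"
  have l': "complex_of_nat (m $ \<alpha>) = complex_of_real l * complex_of_nat (weight \<alpha>)" if "\<alpha> < dim_vec m" for \<alpha>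
    using l that by (metis of_real_mult of_real_of_nat_eq)
  show "\<forall>x\<in>K\<^sub>s. \<tau> x = complex_of_real l * regular_trace x"
    by (simp add: trace_source_eq regular_trace_source l' sum_distrib_left mult.assoc)
qed

lemma eigenvector_iff:
  "map_mat real (\<Lambda> * \<Lambda>\<^sup>T) *\<^sub>v map_vec real m = c \<cdot>\<^sub>v map_vec real m \<longleftrightarrow>
    (\<forall>\<alpha><dim_vec m. real (weight \<alpha>) = c * real (m $ \<alpha>))" (is "?v = ?w \<longleftrightarrow> _")
proof -
  have L: "dim_row \<Lambda> = dim_vec m"
    using inclusion by (auto simp: inclusion_matrix_def)
  have v: "?v $ \<alpha> = real (weight \<alpha>)" if "\<alpha> < dim_vec m" for \<alpha>
  proof -
    have "?v $ \<alpha> = (\<Sum>\<beta><dim_vec m. real ((\<Lambda> * \<Lambda>\<^sup>T) $$ (\<alpha>, \<beta>)) * real (m $ \<beta>))"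
      using that L by (simp add: scalar_prod_def atLeast0LessThan)
    then show ?thesis
      using that by (simp add: weight_eq)
  qed
  have "?v = ?w \<longleftrightarrow> (\<forall>\<alpha><dim_vec m. ?v $ \<alpha> = ?w $ \<alpha>)"
    using L by (auto simp: vec_eq_iff)
  then show ?thesis
    by (simp add: v)
qed

lemma markov_iff_eigenvector:
  assumes "l > 0"
  shows "markov_condition \<Delta> \<tau> p l \<longleftrightarrow>
    map_mat real (\<Lambda> * \<Lambda>\<^sup>T) *\<^sub>v map_vec real m = (1 / l) \<cdot>\<^sub>v map_vec real m"
  unfolding eigenvector_iff markov_iff_weight using assms by (auto simp: field_simps)

section \<open>Integrality of the index and bases over the source algebra\<close>

lemma dim_source_pos: "0 < dim_vec m"
  using B.sum_matrix_units by (cases "dim_vec m = 0") auto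

lemma markov_integer:
  assumes l: "l > 0" and markov: "markov_condition \<Delta> \<tau> p l"
  obtains n :: nat where "real n = 1 / l"
proof -
  have "1 / l \<in> \<nat>"
  proof (rule integer_eigenvalue[of "dim_vec m" "\<lambda>\<alpha> \<beta>. (\<Lambda> * \<Lambda>\<^sup>T) $$ (\<alpha>, \<beta>)" "($) m" _ 0])
    show "(\<Sum>\<beta><dim_vec m. real ((\<Lambda> * \<Lambda>\<^sup>T) $$ (\<alpha>, \<beta>)) * real (m $ \<beta>)) = 1 / l * real (m $ \<alpha>)"
      if \<alpha>: "\<alpha> < dim_vec m" for \<alpha>
    proof -
      have "real (m $ \<alpha>) = l * real (weight \<alpha>)"
        using markov \<alpha> by (simp add: markov_iff_weight)
      then have "real (weight \<alpha>) = 1 / l * real (m $ \<alpha>)"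
        using l by simp
      then show ?thesis
        by (simp add: weight_eq[OF \<alpha>])
    qed
  qed (use l dim_source_pos B.dim_pos in auto)
  then show thesis
    using that by (metis Nats_cases)
qed

text \<open>The basis computes the trace of right multiplication by x in \<open>K\<^sub>s\<close> as
  n times \<open>\<tau> x\<close>. Agreement with the regular trace on \<open>K\<^sub>s\<close> is
  enough for the Markov condition.\<close>

lemma markov_of_basis:
  assumes l: "l > 0" and n: "real (card I) = 1 / l" and u: "expectation_basis K\<^sub>s E\<^sub>s I u"
  shows "markov_condition \<Delta> \<tau> p l"
  unfolding markov_iff_source
proof
  fix x assume "x \<in> K\<^sub>s"
  then have "regular_trace x = of_nat (card I) * \<tau> x"
    using right_trace_basis[OF u] by (simp add: right_trace_eq)
  moreover have "complex_of_real l * of_nat (card I) = 1"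
  proof -
    have "complex_of_real l * of_nat (card I) = complex_of_real (l * real (card I))"
      by simp
    also have "l * real (card I) = 1"
      using n l by simp
    finally show ?thesis by simp
  qed
  ultimately show "\<tau> x = complex_of_real l * regular_trace x"
    by (simp flip: mult.assoc)
qed

text \<open>For a minimal projection \<open>q\<close> of \<open>K\<^sub>s\<close>, right multiplication by \<open>q\<close> projects \<open>K\<close> onto
  \<open>K q\<close>, so the length of an orthonormal basis of \<open>K q\<close> is its trace.\<close>

lemma markov_block_basis:
  assumes markov: "markov_condition \<Delta> \<tau> p l" and l: "l > 0" and n: "real (card I) = 1 / l"
    and I: "finite I" and \<alpha>: "\<alpha> < dim_vec m"
  defines "q \<equiv> unit \<alpha> 0 0"
  obtains v :: "'i \<Rightarrow> nat \<Rightarrow> 'a" where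
    "\<And>i k. i \<in> I \<Longrightarrow> k < m $ \<alpha> \<Longrightarrow> v i k * q = v i k"
    "\<And>i k j r. \<lbrakk>i \<in> I; k < m $ \<alpha>; j \<in> I; r < m $ \<alpha>\<rbrakk> \<Longrightarrow>
      E\<^sub>s ((v i k)\<^sup>\<star> * v j r) = (if i = j \<and> k = r then q else 0)"
    "\<And>y. \<exists>c. y * q = (\<Sum>i\<in>I. \<Sum>k<m $ \<alpha>. c i k *\<^sub>C v i k)"
proof -
  have pos: "0 < m $ \<alpha>"
    using \<alpha> by (rule B.dim_pos)
  have q: "q \<in> K\<^sub>s" "q * q = q" "q\<^sup>\<star> = q"
    using \<alpha> pos by (simp_all add: q_def B.matrix_unit_mem B.matrix_unit_mult B.matrix_unit_star)
  have \<tau>q: "\<tau> q = of_nat (m $ \<alpha>)"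
    unfolding trace_source_eq[OF q(1)] unfolding q_def
    using \<alpha> by (simp add: B.mat_trace_matrix_unit mult_delta_right)
  \<comment> \<open>The divisor is \<open>\<tau> q\<close>, which normalises the form so that
    \<open>E\<^sub>s (x\<^sup>\<star> * y)\<close> becomes exactly \<open>ip x y *\<^sub>C q\<close>
    on the orthonormal vectors.\<close>
  define ip where "ip x y = \<tau> (x\<^sup>\<star> * y) / of_nat (m $ \<alpha>)" for x y
  have lin: "clinear (ip x)" for x
    by (auto intro!: clinearI simp: ip_def lsimps add_divide_distrib)
  have herm: "ip y x = cnj (ip x y)" for x y
    using positive_functional_star[OF trace_positive, of "x\<^sup>\<star> * y"]
    by (simp add: ip_def star_mult star_star)
  have pos_ip: "0 \<le> ip x x" for x
    using trace_positive pos
    by (auto simp: ip_def positive_functional_def less_eq_complex_def)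
  have definite: "ip x x = 0 \<Longrightarrow> x = 0" for x
    using trace_faithful[of x] pos by (simp add: ip_def)
  obtain F :: "'a set" where F: "finite F" "complex_vector.span F = UNIV"
    using finite_dimensional unfolding cfinite_dimensional_def by blast
  obtain X where X: "finite X" "complex_vector.span X = complex_vector.span ((\<lambda>x. x * q) ` F)"
    and on: "\<And>x y. x \<in> X \<Longrightarrow> y \<in> X \<Longrightarrow> ip x y = (if x = y then 1 else 0)"
    using ex_orthonormal_span[OF lin herm pos_ip definite, of "(\<lambda>x. x * q) ` F"] F(1) by blast
  have rlin: "clinear (\<lambda>x. x * q)"
    by (auto intro!: clinearI simp: lsimps)
  have span: "complex_vector.span X = range (\<lambda>x. x * q)"
    using complex_vector_pair.linear_span_image[OF rlin, of F] F(2) X(2) by simp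
  have Xq: "x * q = x" if "x \<in> X" for x
  proof -
    have "x \<in> range (\<lambda>x. x * q)"
      unfolding span[symmetric] using that by (rule complex_vector.span_base)
    then show ?thesis
      using q(2) by (auto simp: mult.assoc)
  qed
  have expand: "y * q = (\<Sum>v\<in>X. ip v (y * q) *\<^sub>C v)" for y
    by (rule orthonormal_expansion[OF lin X(1) on, symmetric]) (simp_all add: span)
  \<comment> \<open>The value lies in q K_s q, which consists of multiples of \<open>q\<close> by
    minimality; applying \<open>\<tau>\<close> identifies the scalar.\<close>
  have Es: "E\<^sub>s (x\<^sup>\<star> * y) = ip x y *\<^sub>C q" if "x \<in> X" "y \<in> X" for x y
  proof -
    have "E\<^sub>s (x\<^sup>\<star> * y) = E\<^sub>s ((x * q)\<^sup>\<star> * (y * q))"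
      using that by (simp add: Xq)
    also have "\<dots> = q * E\<^sub>s (x\<^sup>\<star> * y) * q"
      by (simp add: star_mult q mult.assoc Es_mult_left) (simp add: q Es_mult_right flip: mult.assoc)
    also have "\<dots> = \<psi> (E\<^sub>s (x\<^sup>\<star> * y)) \<alpha> $$ (0, 0) *\<^sub>C q"
      unfolding q_def using B.matrix_unit_compress[OF \<alpha> \<alpha> Es_mem] by simp
    finally have E: "E\<^sub>s (x\<^sup>\<star> * y) = \<psi> (E\<^sub>s (x\<^sup>\<star> * y)) \<alpha> $$ (0, 0) *\<^sub>C q" (is "_ = ?c *\<^sub>C q") .
    then have "\<tau> (E\<^sub>s (x\<^sup>\<star> * y)) = \<tau> (?c *\<^sub>C q)"
      by (rule arg_cong)
    then have "\<tau> (x\<^sup>\<star> * y) = ?c * of_nat (m $ \<alpha>)"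
      by (simp add: trace_Es trace_linear_maps \<tau>q)
    then have "?c = ip x y"
      using pos by (simp add: ip_def)
    with E show ?thesis by simp
  qed
  \<comment> \<open>The orthonormal expansion of \<open>y * q\<close> presents right multiplication
    by \<open>q\<close> as rank-one operators, each of trace 1. Their number is the regular trace of
    \<open>q\<close>, which the Markov condition evaluates.\<close>
  have "card X = card (I \<times> {..<m $ \<alpha>})"
  proof -
    have "complex_of_nat (card X) = (\<Sum>v\<in>X. ip v (v * q))"
      by (simp add: Xq on)
    also have "\<dots> = (\<Sum>v\<in>X. ctrace (\<lambda>y. ip v (y * q) *\<^sub>C v))"
      using lin by (intro sum.cong refl ctrace_rank_one[OF finite_dimensional, symmetric])
        (auto simp: clinear_iff lsimps)
    also have "\<dots> = ctrace (\<lambda>y. \<Sum>v\<in>X. ip v (y * q) *\<^sub>C v)"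
      using lin by (intro ctrace_sum[OF finite_dimensional X(1), symmetric])
        (auto simp: clinear_iff lsimps)
    also have "\<dots> = regular_trace q"
      by (simp only: right_trace_eq flip: expand)
    also have "\<dots> = of_nat (card I * m $ \<alpha>)"
    proof -
      have "complex_of_real (real (m $ \<alpha>)) = complex_of_real l * regular_trace q"
        using markov_trace[OF markov, of q] by (simp add: \<tau>q)
      then have "regular_trace q = complex_of_real (1 / l * real (m $ \<alpha>))"
        using l by simp
      then show ?thesis
        by (simp flip: n)
    qed
    finally have "card X = card I * m $ \<alpha>"
      by (simp only: of_nat_eq_iff)
    then show ?thesis
      by (simp add: card_cartesian_product)
  qed
  \<comment> \<open>The count allows the vectors to be arranged in an array with
    \<open>card I\<close> rows and \<open>m $ \<alpha>\<close> columns.\<close>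
  then obtain b where b: "bij_betw b (I \<times> {..<m $ \<alpha>}) X"
    using finite_same_card_bij[of "I \<times> {..<m $ \<alpha>}" X] I X(1) by auto
  have bX: "b (i, k) \<in> X" if "i \<in> I" "k < m $ \<alpha>" for i k
    using bij_betwE[OF b] that by auto
  have inj: "b (i, k) = b (j, r) \<longleftrightarrow> i = j \<and> k = r" if "i \<in> I" "k < m $ \<alpha>" "j \<in> I" "r < m $ \<alpha>" for i k j r
    using bij_betw_imp_inj_on[OF b] that by (auto simp: inj_on_def)
  show thesis
  proof (rule that[of "\<lambda>i k. b (i, k)"])
    show "b (i, k) * q = b (i, k)" if "i \<in> I" "k < m $ \<alpha>" for i k
      using bX[OF that] by (rule Xq)
    show "E\<^sub>s ((b (i, k))\<^sup>\<star> * b (j, r)) = (if i = j \<and> k = r then q else 0)"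
      if "i \<in> I" "k < m $ \<alpha>" "j \<in> I" "r < m $ \<alpha>" for i k j r
      using that by (simp add: Es bX on inj scaleC_one)
    show "\<exists>c. y * q = (\<Sum>i\<in>I. \<Sum>k<m $ \<alpha>. c i k *\<^sub>C b (i, k))" for y
    proof (intro exI)
      show "y * q = (\<Sum>i\<in>I. \<Sum>k<m $ \<alpha>. ip (b (i, k)) (y * q) *\<^sub>C b (i, k))"
        by (subst expand, subst sum.reindex_bij_betw[OF b, symmetric])
          (simp add: sum.cartesian_product)
    qed
  qed
qed

lemma basis_of_markov:
  assumes markov: "markov_condition \<Delta> \<tau> p l" and l: "l > 0" and n: "real (card I) = 1 / l"
    and I: "finite (I :: 'i set)"
  obtains u where "expectation_basis K\<^sub>s E\<^sub>s I u"
proof -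
  \<comment> \<open>Packaging the three properties lets a single choice select the families for all
    blocks at once.\<close>
  define good where "good \<alpha> v \<longleftrightarrow> (\<forall>i\<in>I. \<forall>k<m $ \<alpha>. v i k * unit \<alpha> 0 0 = v i k)
      \<and> (\<forall>i\<in>I. \<forall>k<m $ \<alpha>. \<forall>j\<in>I. \<forall>r<m $ \<alpha>.
          E\<^sub>s ((v i k)\<^sup>\<star> * v j r) = (if i = j \<and> k = r then unit \<alpha> 0 0 else 0))
      \<and> (\<forall>y. \<exists>c. y * unit \<alpha> 0 0 = (\<Sum>i\<in>I. \<Sum>k<m $ \<alpha>. c i k *\<^sub>C v i k))"
    for \<alpha> and v :: "'i \<Rightarrow> nat \<Rightarrow> 'a"
  have "\<exists>v. good \<alpha> v" if \<alpha>: "\<alpha> < dim_vec m" for \<alpha>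
    unfolding good_def by (rule markov_block_basis[OF markov l n I \<alpha>]) blast
  then obtain v where v: "\<And>\<alpha>. \<alpha> < dim_vec m \<Longrightarrow> good \<alpha> (v \<alpha>)"
    by metis
  have v1: "v \<alpha> i k * unit \<alpha> 0 0 = v \<alpha> i k" if "\<alpha> < dim_vec m" "i \<in> I" "k < m $ \<alpha>" for \<alpha> i k
    using v[OF that(1)] that by (simp add: good_def)
  have v2: "E\<^sub>s ((v \<alpha> i k)\<^sup>\<star> * v \<alpha> j r) = (if i = j \<and> k = r then unit \<alpha> 0 0 else 0)"
    if "\<alpha> < dim_vec m" "i \<in> I" "k < m $ \<alpha>" "j \<in> I" "r < m $ \<alpha>" for \<alpha> i k j r
    using v[OF that(1)] that by (simp add: good_def)
  have v3: "\<exists>c. y * unit \<alpha> 0 0 = (\<Sum>i\<in>I. \<Sum>k<m $ \<alpha>. c i k *\<^sub>C v \<alpha> i k)" if "\<alpha> < dim_vec m" for \<alpha> y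
    using v[OF that(1)] by (simp add: good_def)
  \<comment> \<open>Right multiplication by \<open>unit \<alpha> 0 k\<close> moves the k-th vector
    from column 0 to column k, so the diagonal terms of
    \<open>E\<^sub>s ((u i)\<^sup>\<star> * u i)\<close> add up to the unit as the sum of all
    \<open>unit \<alpha> k k\<close>.\<close>
  define u where "u i = (\<Sum>\<alpha><dim_vec m. \<Sum>k<m $ \<alpha>. v \<alpha> i k * unit \<alpha> 0 k)" for i
  have v4: "E\<^sub>s ((v \<alpha> i k)\<^sup>\<star> * v \<beta> j r) = (if \<beta> = \<alpha> \<and> r = k then (if i = j then unit \<alpha> 0 0 else 0) else 0)"
    if a: "\<alpha> < dim_vec m" "\<beta> < dim_vec m" "i \<in> I" "j \<in> I" "k < m $ \<alpha>" "r < m $ \<beta>" for \<alpha> \<beta> i j k r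
  proof (cases "\<alpha> = \<beta>")
    case True
    with a show ?thesis by (auto simp: v2)
  next
    case False
    \<comment> \<open>Minimal projections of two different blocks enclose an element of
      \<open>K\<^sub>s\<close> and annihilate it.\<close>
    have "E\<^sub>s ((v \<alpha> i k)\<^sup>\<star> * v \<beta> j r) = E\<^sub>s ((v \<alpha> i k * unit \<alpha> 0 0)\<^sup>\<star> * (v \<beta> j r * unit \<beta> 0 0))"
      using a by (simp add: v1)
    also have "\<dots> = unit \<alpha> 0 0 * E\<^sub>s ((v \<alpha> i k)\<^sup>\<star> * v \<beta> j r) * unit \<beta> 0 0"
      using a B.dim_pos
      by (simp add: star_mult B.matrix_unit_star mult.assoc Es_mult_left B.matrix_unit_mem)
        (simp add: Es_mult_right B.matrix_unit_mem flip: mult.assoc)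
    also have "\<dots> = 0"
      using a False by (simp add: B.matrix_unit_compress Es_mem)
    finally show ?thesis using False by simp
  qed
  have star: "(v \<alpha> i k * unit \<alpha> 0 k)\<^sup>\<star> = unit \<alpha> k 0 * (v \<alpha> i k)\<^sup>\<star>" if "\<alpha> < dim_vec m" "k < m $ \<alpha>" for \<alpha> i k
    using that B.dim_pos by (simp add: star_mult B.matrix_unit_star)
  have on: "E\<^sub>s ((u i)\<^sup>\<star> * u j) = (if i = j then 1 else 0)" if ij: "i \<in> I" "j \<in> I" for i j
  proof -
    have "E\<^sub>s ((u i)\<^sup>\<star> * u j) = (\<Sum>\<alpha><dim_vec m. \<Sum>k<m $ \<alpha>. \<Sum>\<beta><dim_vec m. \<Sum>r<m $ \<beta>.
        E\<^sub>s (unit \<alpha> k 0 * ((v \<alpha> i k)\<^sup>\<star> * v \<beta> j r) * unit \<beta> 0 r))"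
    proof -
      have "E\<^sub>s ((u i)\<^sup>\<star> * u j) = (\<Sum>\<alpha><dim_vec m. \<Sum>k<m $ \<alpha>. E\<^sub>s (unit \<alpha> k 0 * (v \<alpha> i k)\<^sup>\<star> * u j))"
        by (simp add: u_def[of i] star_sum star sum_distrib_right clinear_sum[OF Es_linear])
      then show ?thesis
        by (simp add: u_def sum_distrib_left clinear_sum[OF Es_linear] mult.assoc)
    qed
    also have "\<dots> = (\<Sum>\<alpha><dim_vec m. \<Sum>k<m $ \<alpha>. \<Sum>\<beta><dim_vec m. \<Sum>r<m $ \<beta>.
        if \<beta> = \<alpha> \<and> r = k then (if i = j then unit \<alpha> k k else 0) else 0)"
      using ij B.dim_pos
      by (intro sum.cong refl)
        (auto simp: Es_mult_left Es_mult_right B.matrix_unit_mem v4 B.matrix_unit_mult)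
    also have "\<dots> = (\<Sum>\<alpha><dim_vec m. \<Sum>k<m $ \<alpha>. if i = j then unit \<alpha> k k else 0)"
      by (intro sum.cong refl sum_nested_delta) auto
    also have "\<dots> = (if i = j then 1 else 0)"
      using B.sum_matrix_units by simp
    finally show ?thesis .
  qed
  \<comment> \<open>To show that \<open>P\<close> is the identity, its right
    \<open>K\<^sub>s\<close>-linearity reduces the claim to generators. Orthonormality fixes each
    \<open>u j\<close>, hence each \<open>v \<alpha> i k = u i * unit \<alpha> k 0\<close>, hence K
    f_00 for every block, then K f_kk; the f_kk sum to 1.\<close>
  define P where "P b = (\<Sum>i\<in>I. u i * E\<^sub>s ((u i)\<^sup>\<star> * b))" for b
  have P: "P (a + b) = P a + P b" "P (c *\<^sub>C a) = c *\<^sub>C P a" "z \<in> K\<^sub>s \<Longrightarrow> P (a * z) = P a * z" for a b c z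
    by (simp_all add: P_def lsimps Es_linear_maps sum.distrib complex_vector.scale_sum_right
        sum_distrib_right Es_mult_right flip: mult.assoc)
  have Psum: "P (sum f A) = (\<Sum>i\<in>A. P (f i))" for f :: "'j \<Rightarrow> 'a" and A
    by (rule clinear_sum) (auto intro!: clinearI P)
  have Pu: "P (u j) = u j" if "j \<in> I" for j
  proof -
    have "P (u j) = (\<Sum>i\<in>I. if i = j then u j else 0)"
      unfolding P_def using that by (intro sum.cong) (simp_all add: on)
    then show ?thesis using that I by simp
  qed
  have uv: "u i * unit \<alpha> k 0 = v \<alpha> i k" if a: "i \<in> I" "\<alpha> < dim_vec m" "k < m $ \<alpha>" for i \<alpha> k
  proof -
    have "u i * unit \<alpha> k 0 = (\<Sum>\<beta><dim_vec m. \<Sum>r<m $ \<beta>. if \<beta> = \<alpha> \<and> r = k then v \<beta> i r else 0)"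
      unfolding u_def sum_distrib_right using a B.dim_pos
      by (intro sum.cong refl) (auto simp: mult.assoc B.matrix_unit_mult v1)
    also have "\<dots> = v \<alpha> i k"
      by (rule sum_nested_delta) (use a in auto)
    finally show ?thesis .
  qed
  have Pv: "P (v \<alpha> i k) = v \<alpha> i k" if "i \<in> I" "\<alpha> < dim_vec m" "k < m $ \<alpha>" for i \<alpha> k
    by (simp add: P Pu B.matrix_unit_mem that flip: uv)
  have Pq: "P (y * unit \<alpha> 0 0) = y * unit \<alpha> 0 0" if \<alpha>: "\<alpha> < dim_vec m" for y \<alpha>
  proof -
    obtain c where "y * unit \<alpha> 0 0 = (\<Sum>i\<in>I. \<Sum>k<m $ \<alpha>. c i k *\<^sub>C v \<alpha> i k)"
      using v3[OF \<alpha>] by blast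
    then show ?thesis
      by (simp add: Psum P Pv \<alpha>)
  qed
  have Punit: "P (b * unit \<alpha> k k) = b * unit \<alpha> k k" if a: "\<alpha> < dim_vec m" "k < m $ \<alpha>" for b \<alpha> k
  proof -
    have "unit \<alpha> k k = unit \<alpha> k 0 * unit \<alpha> 0 0 * unit \<alpha> 0 k"
      using a B.dim_pos by (simp add: B.matrix_unit_mult)
    then have E: "b * unit \<alpha> k k = (b * unit \<alpha> k 0) * unit \<alpha> 0 0 * unit \<alpha> 0 k"
      by (simp only: mult.assoc)
    show ?thesis
      unfolding E P(3)[OF B.matrix_unit_mem[of \<alpha> 0 k], of "_ * unit \<alpha> 0 0"] Pq[OF a(1)] ..
  qed
  have Pb: "P b = b" for b
  proof -
    have "b = (\<Sum>\<alpha><dim_vec m. \<Sum>k<m $ \<alpha>. b * unit \<alpha> k k)"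
      using B.sum_matrix_units by (simp flip: sum_distrib_left)
    also have "P \<dots> = \<dots>"
      by (simp add: Psum Punit)
    finally show ?thesis by simp
  qed
  have "expectation_basis K\<^sub>s E\<^sub>s I u"
    unfolding expectation_basis_def
  proof (intro conjI allI impI ballI)
    show "b = (\<Sum>i\<in>I. u i * E\<^sub>s ((u i)\<^sup>\<star> * b))" for b
      using Pb[of b] by (simp add: P_def)
    fix a j assume a: "(\<forall>i\<in>I. a i \<in> K\<^sub>s) \<and> (\<Sum>i\<in>I. u i * a i) = 0" and j: "j \<in> I"
    \<comment> \<open>Pairing with \<open>u j\<close> isolates the coefficient \<open>a j\<close>,
      which gives independence.\<close>
    have "E\<^sub>s ((u j)\<^sup>\<star> * (\<Sum>i\<in>I. u i * a i)) = (\<Sum>i\<in>I. if i = j then a i else 0)"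
      unfolding sum_distrib_left clinear_sum[OF Es_linear] using a j
      by (intro sum.cong) (auto simp: Es_mult_right on simp flip: mult.assoc)
    then have "a j = E\<^sub>s ((u j)\<^sup>\<star> * 0)"
      using a j I by simp
    then show "a j = 0"
      using Es_linear_maps(2)[of 0 0] by simp
  qed (rule I)
  then show thesis by (rule that)
qed

lemma markov_iff_basis:
  assumes l: "l > 0"
  shows "markov_condition \<Delta> \<tau> p l \<longleftrightarrow>
    (\<exists>n::nat. real n = 1 / l \<and> (\<exists>x. expectation_basis K\<^sub>s E\<^sub>s {1..n} x))"
proof
  assume M: "markov_condition \<Delta> \<tau> p l"
  then obtain n :: nat where n: "real n = 1 / l"
    using l by (elim markov_integer[rotated])
  then obtain x where "expectation_basis K\<^sub>s E\<^sub>s {1..n} x"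
    using basis_of_markov[OF M l, of "{1..n}"] by auto
  with n show "\<exists>n::nat. real n = 1 / l \<and> (\<exists>x. expectation_basis K\<^sub>s E\<^sub>s {1..n} x)"
    by blast
next
  assume "\<exists>n::nat. real n = 1 / l \<and> (\<exists>x. expectation_basis K\<^sub>s E\<^sub>s {1..n} x)"
  then show "markov_condition \<Delta> \<tau> p l"
    using markov_of_basis[OF l] by (metis card_atLeastAtMost diff_Suc_1)
qed

end

theorem theorem3p5:
  fixes \<Delta> :: "'a::cstar_algebra \<Rightarrow> ('a, 'a) tensor"
    and \<epsilon> \<tau> :: "'a \<Rightarrow> complex" and S :: "'a \<Rightarrow> 'a" and p :: 'a and lam :: real
    and d m :: "nat vec" and \<phi> \<psi> :: "'a \<Rightarrow> nat \<Rightarrow> complex mat" and \<Lambda> :: "nat mat"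
  assumes "weak_kac_algebra \<Delta> \<epsilon> S"
    and "haar_projection \<Delta> \<epsilon> p"
    and "haar_trace \<Delta> \<epsilon> \<tau>"
    and "lam > 0"
    and "multimatrix_iso UNIV d \<phi>"
    and "multimatrix_iso (source_cartan \<Delta> \<epsilon>) m \<psi>"
    and "inclusion_matrix (source_cartan \<Delta> \<epsilon>) m \<psi> d \<phi> \<Lambda>"
  shows "(markov_condition \<Delta> \<tau> p lam \<longleftrightarrow>
           (\<forall>x. \<tau> x = complex_of_real lam * regular_trace x))
       \<and> (markov_condition \<Delta> \<tau> p lam \<longleftrightarrow>
           map_mat real (\<Lambda> * \<Lambda>\<^sup>T) *\<^sub>v map_vec real m = (1 / lam) \<cdot>\<^sub>v map_vec real m)
       \<and> (markov_condition \<Delta> \<tau> p lam \<longleftrightarrow>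
           (\<exists>n::nat. real n = 1 / lam \<and>
             (\<exists>x. expectation_basis (source_cartan \<Delta> \<epsilon>) (source_expectation \<Delta> \<tau>) {1..n} x)))
       \<and> (markov_condition \<Delta> \<tau> p lam \<longleftrightarrow>
           (\<exists>n::nat. real n = 1 / lam \<and>
             (\<exists>y. expectation_basis (target_cartan \<Delta> \<epsilon>) (target_expectation \<Delta> \<tau>) {1..n} y)))"
proof -
  interpret weak_kac_inclusion \<Delta> \<epsilon> S \<tau> p d m \<phi> \<psi> \<Lambda>
    using assms by (intro weak_kac_inclusion.intro weak_kac_haar.intro weak_kac_haar_axioms.intro
        weak_kac_inclusion_axioms.intro)
  show ?thesis
    \<comment> \<open>After this rewriting the condition on target bases is literally the one on
      source bases.\<close>
    unfolding target_basis_iff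
    using markov_iff_regular[of lam] markov_iff_eigenvector[OF \<open>lam > 0\<close>] markov_iff_basis[OF \<open>lam > 0\<close>]
    by (intro conjI)
qed

end
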